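(* Let $(\mathcal{X},d)$ be a complete, separable, non-compact, locally compact length space and let $p>1$. Let $(\mu_t)_{t\ge0}$ be a unit-speed ray in $P_p(\mathcal{X})$. (i) For any $\nu_0\in P_p(\mathcal{X})$ there exists at least one co-ray from $\nu_0$ to $(\mu_t)_{t\ge0}$. (ii) If moreover $\mathcal{X}$ is non-branching and $(\nu_t)_{t\ge0}$ is a co-ray from $\nu_0$ to $(\mu_t)_{t\ge0}$, then for every $\tau>0$ the subray $(\nu_{t+\tau})_{t\ge0}$ is the unique co-ray from $\nu_\tau$ to $(\mu_t)_{t\ge0}$.
   Context: $P_p(\mathcal{X})$ is the set of Borel probability measures $\mu$ on $\mathcal{X}$ with finite $p$-th moment $\int d(x_0,x)^p\,d\mu(x)<\infty$, with Wasserstein distance $W_p(\mu,\nu)=\big(\min_{\pi}\int d(x,y)^p\,d\pi(x,y)\big)^{1/p}$, the minimum over couplings $\pi$ of $\mu,\nu$. In a metric space $(\mathcal{Y},d)$, a ray is a continuous $\gamma:[0,\infty)\to\mathcal{Y}$ with $d(\gamma_s,\gamma_t)=|s-t|\,d(\gamma_0,\gamma_1)$ for all $s,t\ge0$; unit-speed means $d(\gamma_0,\gamma_1)=1$. A geodesic $\zeta:[a,b]\to\mathcal{Y}$ is a curve with $d(\zeta_s,\zeta_t)=\frac{|t-s|}{b-a}d(\zeta_a,\zeta_b)$ for $s,t\in[a,b]$. For $\mu,\nu\in P_p(\mathcal{X})$ with $L=W_p(\mu,\nu)$, $T(\mu,\nu)$ denotes the set of unit-speed geodesics from $\mu$ to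 $\nu$ in $P_p(\mathcal{X})$, i.e. curves $(\mu_t)_{0\le t\le L}$ with $\mu_0=\mu$, $\mu_L=\nu$ and $W_p(\mu_s,\mu_t)=|s-t|$. Co-ray: given a unit-speed ray $(\mu_t)_{t\ge0}$ in $P_p(\mathcal{X})$, a ray $(\nu_t)_{t\ge0}$ in $P_p(\mathcal{X})$ is a co-ray from $\nu_0$ to $(\mu_t)_{t\ge0}$ if there exist $t_n\to+\infty$, $\nu_0^n\in P_p(\mathcal{X})$ with $W_p(\nu_0^n,\nu_0)\to0$, and $(\nu^n_t)_{0\le t\le L_n}\in T(\nu_0^n,\mu_{t_n})$ with $L_n=W_p(\nu_0^n,\mu_{t_n})$, such that $\lim_{n\to\infty}W_p(\nu_t^n,\nu_t)=0$ for every $t\ge0$. $\mathcal{X}$ is non-branching if every geodesic $\zeta:[a,b]\to\mathcal{X}$ is uniquely determined by its restriction to any nontrivial subinterval. *)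

theory Defs
  imports "HOL-Probability.Probability"
begin

definition curve_length :: "(real \<Rightarrow> 'a::metric_space) \<Rightarrow> ereal" where
  "curve_length g = (SUP (n, t) \<in> {(n, t). t 0 = 0 \<and> t n = 1 \<and> (\<forall>i<n. t i \<le> t (Suc i))}.
       (\<Sum>i<n. ereal (dist (g (t i)) (g (t (Suc i))))))"

definition length_space :: "'a::metric_space itself \<Rightarrow> bool" where
  "length_space _ \<longleftrightarrow> (\<forall>x y::'a. ereal (dist x y) =
     (INF g \<in> {g. continuous_on {0..1} g \<and> g 0 = x \<and> g 1 = y}. curve_length g))"

definition geodesic_on :: "real \<Rightarrow> real \<Rightarrow> (real \<Rightarrow> 'a::metric_space) \<Rightarrow> bool" where
  "geodesic_on a b z \<longleftrightarrow> a < b \<and>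
     (\<forall>s\<in>{a..b}. \<forall>t\<in>{a..b}. dist (z s) (z t) = \<bar>t - s\<bar> / (b - a) * dist (z a) (z b))"

definition non_branching :: "'a::metric_space itself \<Rightarrow> bool" where
  "non_branching _ \<longleftrightarrow> (\<forall>a b c e (z::real \<Rightarrow> 'a) z'.
     geodesic_on a b z \<and> geodesic_on a b z' \<and> a \<le> c \<and> c < e \<and> e \<le> b \<and>
     (\<forall>t\<in>{c..e}. z t = z' t) \<longrightarrow> (\<forall>t\<in>{a..b}. z t = z' t))"

definition Pp :: "real \<Rightarrow> 'a::metric_space measure set" where
  "Pp p = {M. prob_space M \<and> sets M = sets borel \<and>
     (\<exists>x0. (\<integral>\<^sup>+ x. ennreal (dist x0 x powr p) \<partial>M) < \<infinity>)}"

definition couplings :: "'a::metric_space measure \<Rightarrow> 'a measure \<Rightarrow> ('a \<times> 'a) measure set" where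
  "couplings \<mu> \<nu> = {\<pi>. prob_space \<pi> \<and> sets \<pi> = sets borel \<and>
     distr \<pi> borel fst = \<mu> \<and> distr \<pi> borel snd = \<nu>}"

definition wass :: "real \<Rightarrow> 'a::metric_space measure \<Rightarrow> 'a measure \<Rightarrow> real" where
  "wass p \<mu> \<nu> = (enn2real (INF \<pi> \<in> couplings \<mu> \<nu>.
       \<integral>\<^sup>+ xy. ennreal (dist (fst xy) (snd xy) powr p) \<partial>\<pi>)) powr (1 / p)"

definition wray :: "real \<Rightarrow> (real \<Rightarrow> 'a::metric_space measure) \<Rightarrow> bool" where
  "wray p \<gamma> \<longleftrightarrow> (\<forall>t\<ge>0. \<gamma> t \<in> Pp p) \<and>
     (\<forall>t\<ge>0. \<forall>\<epsilon>>0. \<exists>\<delta>>0. \<forall>s\<ge>0. \<bar>s - t\<bar> < \<delta> \<longrightarrow> wass p (\<gamma> s) (\<gamma> t) < \<epsilon>) \<and>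
     (\<forall>s\<ge>0. \<forall>t\<ge>0. wass p (\<gamma> s) (\<gamma> t) = \<bar>s - t\<bar> * wass p (\<gamma> 0) (\<gamma> 1))"

definition unit_wray :: "real \<Rightarrow> (real \<Rightarrow> 'a::metric_space measure) \<Rightarrow> bool" where
  "unit_wray p \<gamma> \<longleftrightarrow> wray p \<gamma> \<and> wass p (\<gamma> 0) (\<gamma> 1) = 1"

definition wgeods :: "real \<Rightarrow> 'a::metric_space measure \<Rightarrow> 'a measure \<Rightarrow> (real \<Rightarrow> 'a measure) set" where
  "wgeods p \<mu> \<nu> = {\<gamma>. (\<forall>t\<in>{0..wass p \<mu> \<nu>}. \<gamma> t \<in> Pp p) \<and>
     \<gamma> 0 = \<mu> \<and> \<gamma> (wass p \<mu> \<nu>) = \<nu> \<and>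
     (\<forall>s\<in>{0..wass p \<mu> \<nu>}. \<forall>t\<in>{0..wass p \<mu> \<nu>}. wass p (\<gamma> s) (\<gamma> t) = \<bar>s - t\<bar>)}"

definition coray :: "real \<Rightarrow> (real \<Rightarrow> 'a::metric_space measure) \<Rightarrow> 'a measure \<Rightarrow> (real \<Rightarrow> 'a measure) \<Rightarrow> bool" where
  "coray p \<mu> \<nu>0 \<nu> \<longleftrightarrow> wray p \<nu> \<and> \<nu> 0 = \<nu>0 \<and>
     (\<exists>(tn::nat \<Rightarrow> real) (\<nu>0n::nat \<Rightarrow> 'a measure) (\<nu>n::nat \<Rightarrow> real \<Rightarrow> 'a measure).
        filterlim tn at_top sequentially \<and>
        (\<forall>n. \<nu>0n n \<in> Pp p) \<and>
        ((\<lambda>n. wass p (\<nu>0n n) \<nu>0) \<longlonglongrightarrow> 0) \<and>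
        (\<forall>n. \<nu>n n \<in> wgeods p (\<nu>0n n) (\<mu> (tn n))) \<and>
        (\<forall>t\<ge>0. (\<lambda>n. wass p (\<nu>n n t) (\<nu> t)) \<longlonglongrightarrow> 0))"

end

(*
  By Hopf-Rinow the space is proper and geodesic.  Properness makes sequences of laws with bounded
  p-th moments realisable, after extraction, by almost surely convergent random variables; optimal
  couplings, gluings and Wasserstein geodesics are all obtained from this compactness.

  (i) Take geodesics from the initial measure to points far out on the ray.  Equality in Minkowski's
  inequality (p > 1) forces optimal transport along a Wasserstein geodesic to move almost every point
  along a segment in constant proportion.  Hence the displacement along the ray, divided by time, has
  a law that may be chosen independent of time, which bounds the p-th moment tails of the
  geodesics at each fixed time uniformly.  They are therefore relatively compact in the Wasserstein
  distance, and Arzela-Ascoli gives a co-ray.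

  (ii) The Busemann function of the ray is 1-Lipschitz and decreases at unit rate along every co-ray.
  So a co-ray up to time tau followed by any co-ray from there is again a geodesic.  Gluing the optimal
  couplings for two such continuations over the measure at time tau, almost every pair of end
  points prolongs the same segment by the same length, and non-branching makes them coincide.
*)

theory Submission
  imports Defs "HOL-Library.Diagonal_Subsequence"
begin

subsection \<open>Proper length spaces\<close>

text \<open>Weak limits alone do not give Wasserstein limits, since p-th moments may escape to
  infinity, and those of \<open>\<mu> t\<close> themselves grow like t^p. A rescaling saves the
  limit: at time s on a geodesic of length L a point has covered the fraction s/L of its
  displacement, and L is comparable to the time t of the target. Hence only the tails of dist(a,
  y)/t under \<open>\<mu> t\<close> matter, and one fixed optimal coupling of \<open>\<mu> 0\<close>
  and \<open>\<mu> 1\<close> controls them for all t > 1 at once. For uniqueness, two co-rays may be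
  limits of geodesics to different targets, so their approximations cannot be joined. The Busemann
  function depends on the ray alone and therefore compares them. The condition tau > 0 supplies the
  incoming segment on which non-branching acts. The random variables live on a real probability
  space because almost sure representation is applied on the line, to real codes of the
  points.\<close>

definition proper_space :: "'a::metric_space itself \<Rightarrow> bool" where
  "proper_space _ \<longleftrightarrow> (\<forall>(x::'a) r. compact (cball x r))"

text \<open>The inequality suffices: a curve from x to y with Lipschitz constant
  \<open>dist x y\<close> leaves no slack in the triangle inequality. The unit interval as domain
  covers x = y as well.\<close>

definition geodesic_space :: "'a::metric_space itself \<Rightarrow> bool" where
  "geodesic_space _ \<longleftrightarrow> (\<forall>x y::'a. \<exists>c::real \<Rightarrow> 'a. c 0 = x \<and> c 1 = y \<and>
     (\<forall>s\<in>{0..1}. \<forall>t\<in>{0..1}. dist (c s) (c t) \<le> \<bar>s - t\<bar> * dist x y))"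

text \<open>Couplings and gluings are laws on products; this lets the compactness theorem for laws
  apply to them.\<close>

lemma proper_space_prod:
  assumes "proper_space TYPE('a::metric_space)" "proper_space TYPE('b::metric_space)"
  shows "proper_space TYPE('a \<times> 'b)"
  unfolding proper_space_def
proof (intro allI)
  fix z :: "'a \<times> 'b" and r :: real
  have "compact (cball (fst z) r \<times> cball (snd z) r)"
    using assms by (intro compact_Times) (auto simp: proper_space_def)
  moreover have "cball z r \<subseteq> cball (fst z) r \<times> cball (snd z) r"
  proof
    fix w assume "w \<in> cball z r"
    thus "w \<in> cball (fst z) r \<times> cball (snd z) r"
      using dist_fst_le[of z w] dist_snd_le[of z w] by (cases w) auto
  qed
  ultimately show "compact (cball z r)"
    by (metis closed_cball compact_Int_closed inf.absorb2)
qed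

text \<open>A curve of length below \<open>dist x y + e\<close> meets the sphere of radius a about x
  by the intermediate value theorem; cutting it there bounds the remaining distance.\<close>

lemma length_space_approx_intermediate:
  fixes x y :: "'a::metric_space"
  assumes "length_space TYPE('a)" and e: "e > 0" and a: "0 \<le> a" "a \<le> dist x y"
  shows "\<exists>z. dist x z = a \<and> dist z y \<le> dist x y - a + e"
proof -
  have "(INF g \<in> {g. continuous_on {0..1} g \<and> g 0 = x \<and> g 1 = y}. curve_length g) < ereal (dist x y + e)"
    using assms(1) e unfolding length_space_def by (metis ereal_less(2) ereal_less_eq(3) less_add_same_cancel1 linorder_not_less)
  then obtain g where g: "continuous_on {0..1} g" "g 0 = x" "g 1 = y"
    and len: "curve_length g < ereal (dist x y + e)"
    unfolding INF_less_iff by auto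
  have cont: "continuous_on {0..1} (\<lambda>u. dist x (g u))"
    by (intro continuous_intros g)
  then obtain u where u: "0 \<le> u" "u \<le> 1" "dist x (g u) = a"
    using IVT'[of "\<lambda>u. dist x (g u)" 0 a 1] g a by auto
  \<comment> \<open>The partition 0, u, 1, continued by 1 because partitions are sequences on all of
    nat.\<close>
  define t :: "nat \<Rightarrow> real" where "t i = (if i = 0 then 0 else if i = 1 then u else 1)" for i
  have "(\<Sum>i<2. ereal (dist (g (t i)) (g (t (Suc i))))) \<le> curve_length g"
    unfolding curve_length_def
    by (rule SUP_upper2[where i="(2, t)"]) (use u in \<open>auto simp: t_def less_2_cases_iff\<close>)
  hence "ereal (dist x (g u) + dist (g u) y) \<le> curve_length g"
    using g by (simp add: t_def numeral_2_eq_2)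
  hence "ereal (dist x (g u) + dist (g u) y) < ereal (dist x y + e)"
    using len by (rule le_less_trans)
  thus ?thesis using u by (intro exI[of _ "g u"]) auto
qed

text \<open>Hopf--Rinow--Cohn-Vossen: the supremum of the radii of compact balls about a point is infinite.\<close>

lemma hopf_rinow_compact_at_sup:
  fixes x :: "'a::complete_space"
  assumes len: "length_space TYPE('a)" and R: "R > 0"
    and cpt: "\<And>r. r < R \<Longrightarrow> compact (cball x r)"
  shows "compact (cball x R)"
  unfolding compact_eq_totally_bounded
proof (intro conjI allI impI, goal_cases)
  case 1
  show ?case by (simp add: complete_eq_closed)
next
  case (2 e)
  hence e: "e > 0" .
  \<comment> \<open>A point of the R-ball is within 2d of the ball of radius R - d: one d from the
    radii, one from the error of the intermediate point. With a net of mesh e/4 this stays below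
    e.\<close>
  define d where "d = min (e/4) (R/2)"
  have d: "0 < d" "d \<le> e/4" "d < R" using e R by (auto simp: d_def)
  have "compact (cball x (R - d))" using cpt d by auto
  then obtain k where k: "finite k" "cball x (R - d) \<subseteq> (\<Union>y\<in>k. ball y (e/4))"
    using compact_eq_totally_bounded[of "cball x (R - d)"] e by (meson divide_pos_pos zero_less_numeral)
  show "\<exists>k. finite k \<and> cball x R \<subseteq> (\<Union>y\<in>k. ball y e)"
  proof (intro exI[of _ k] conjI k(1) subsetI)
    fix z assume z: "z \<in> cball x R"
    show "z \<in> (\<Union>y\<in>k. ball y e)"
    proof (cases "dist x z \<le> R - d")
      case True
      then obtain y where "y \<in> k" "dist y z < e/4" using k(2) by (auto simp: subset_iff)
      thus ?thesis using e by (auto intro!: bexI[of _ y])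
    next
      case False
      have "0 \<le> R - d" "R - d \<le> dist x z" using d False by auto
      from length_space_approx_intermediate[OF len d(1) this]
      obtain w where w: "dist x w = R - d" "dist w z \<le> dist x z - (R - d) + d" by auto
      have "w \<in> cball x (R - d)" using w by auto
      then obtain y where y: "y \<in> k" "dist y w < e/4" using k(2) unfolding subset_iff by fastforce
      have "dist y z \<le> dist y w + dist w z" by (rule dist_triangle)
      also have "\<dots> < e" using w y z d by auto
      finally show ?thesis using y by auto
    qed
  qed
qed

text \<open>Finitely many compact neighbourhoods cover the ball. Their open parts form V, and e is a
  Lebesgue number of the cover by V alone. Every point of the ball enlarged by e/4 is within e/2 of
  the old ball, so the enlarged ball is a closed part of a compact set.\<close>

lemma hopf_rinow_step:
  fixes x :: "'a::complete_space"
  assumes len: "length_space TYPE('a)" and loc: "locally_compact_space (euclidean :: 'a topology)"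
    and R: "R \<ge> 0" and cpt: "compact (cball x R)"
  shows "\<exists>d>0. compact (cball x (R + d))"
proof -
  have "\<forall>y::'a. \<exists>U K. open U \<and> compact K \<and> y \<in> U \<and> U \<subseteq> K"
    using loc by (auto simp: locally_compact_space_def)
  then obtain U K where UK: "\<And>y. open (U y)" "\<And>y. compact (K y)" "\<And>y::'a. y \<in> U y" "\<And>y. U y \<subseteq> K y"
    by metis
  have "cball x R \<subseteq> (\<Union>y\<in>cball x R. U y)" using UK by auto
  then obtain C where C: "C \<subseteq> cball x R" "finite C" "cball x R \<subseteq> (\<Union>y\<in>C. U y)"
    using compactE_image[OF cpt, of "cball x R" U] UK by metis
  define V where "V = (\<Union>y\<in>C. U y)"
  have "open V" unfolding V_def using UK by auto
  have "compact (\<Union>y\<in>C. K y)" using C UK by (intro compact_UN) auto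
  have VK: "V \<subseteq> (\<Union>y\<in>C. K y)" unfolding V_def by (intro UN_mono order_refl UK)
  obtain e where e: "e > 0" "\<And>y z. y \<in> cball x R \<Longrightarrow> dist y z < e \<Longrightarrow> z \<in> V"
  proof -
    have "cball x R \<subseteq> \<Union>{V}" using C(3) by (simp add: V_def)
    then obtain e where "e > 0" "\<And>y. y \<in> cball x R \<Longrightarrow> \<exists>G\<in>{V}. ball y e \<subseteq> G"
      using Heine_Borel_lemma[OF cpt, of "{V}"] \<open>open V\<close> by (metis singletonD)
    hence "z \<in> V" if "y \<in> cball x R" "dist y z < e" for y z
      using that by (metis mem_ball singletonD subsetD)
    with \<open>e > 0\<close> show ?thesis by (rule that)
  qed
  have "cball x (R + e/4) \<subseteq> V"
  proof
    fix z assume z: "z \<in> cball x (R + e/4)"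
    show "z \<in> V"
    proof (cases "dist x z \<le> R")
      case True thus ?thesis using C V_def by auto
    next
      case False
      have "e/4 > 0" using e by auto
      from length_space_approx_intermediate[OF len this R, of x z] False
      obtain w where w: "dist x w = R" "dist w z \<le> dist x z - R + e/4" by auto
      have "dist w z < e" using w z e by auto
      thus ?thesis using e(2)[of w z] w by auto
    qed
  qed
  hence "cball x (R + e/4) \<subseteq> (\<Union>y\<in>C. K y)" using VK by auto
  hence "compact (cball x (R + e/4))"
    using \<open>compact (\<Union>y\<in>C. K y)\<close> by (metis closed_cball compact_Int_closed inf.absorb2)
  thus ?thesis using e by (intro exI[of _ "e/4"]) auto
qed

text \<open>A bounded set of such radii would have a positive supremum, by one step from radius 0;
  it would be attained, and a further step would exceed it.\<close>

theorem hopf_rinow_proper: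
  assumes len: "length_space TYPE('a::complete_space)"
    and loc: "locally_compact_space (euclidean :: 'a topology)"
  shows "proper_space TYPE('a)"
  unfolding proper_space_def
proof (rule ccontr)
  assume "\<not> (\<forall>(x::'a) r. compact (cball x r))"
  then obtain x :: 'a and r0 where r0: "\<not> compact (cball x r0)" by auto
  define A where "A = {r. 0 \<le> r \<and> compact (cball x r)}"
  have sub: "compact (cball x s)" if "compact (cball x r)" "s \<le> r" for r s
    using that by (metis closed_cball compact_Int_closed inf.absorb2 subset_cball)
  have bdd: "r \<le> r0" if "r \<in> A" for r
    using that sub[of r r0] r0 by (cases "r \<le> r0") (auto simp: A_def)
  have 0: "0 \<in> A" by (auto simp: A_def)
  have bA: "bdd_above A" using bdd by (auto simp: bdd_above_def)
  define R where "R = Sup A"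
  have up: "r \<le> R" if "r \<in> A" for r unfolding R_def using that bA by (rule cSup_upper)
  obtain d where "d > 0" "compact (cball x (0 + d))"
    using hopf_rinow_step[OF len loc, of 0 x] 0 by (auto simp: A_def)
  hence "d \<le> R" using up by (auto simp: A_def)
  hence R: "R > 0" using \<open>d > 0\<close> by auto
  have "compact (cball x r)" if "r < R" for r
  proof -
    obtain s where "s \<in> A" "r < s" using \<open>r < R\<close> less_cSup_iff[of A r] 0 bA unfolding R_def by blast
    thus ?thesis using sub by (auto simp: A_def)
  qed
  hence "compact (cball x R)" by (rule hopf_rinow_compact_at_sup[OF len R])
  then obtain d where "d > 0" "compact (cball x (R + d))"
    using hopf_rinow_step[OF len loc, of R x] R by auto
  hence "R + d \<in> A" using R by (auto simp: A_def)
  thus False using up \<open>d > 0\<close> by fastforce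
qed

text \<open>D stands for both \<open>dist\<close> and \<open>wass\<close>, and the latter obeys the
  triangle inequality only on \<open>Pp p\<close>, hence the set S. The error \<open>e n\<close>
  admits curves that are Lipschitz only up to a vanishing mesh. Compactness of values replaces
  completeness: diagonal extraction settles rational times, and nearby rationals settle the
  others.\<close>

lemma arzela_ascoli_pointwise:
  fixes D :: "'b \<Rightarrow> 'b \<Rightarrow> real" and f :: "nat \<Rightarrow> real \<Rightarrow> 'b"
  assumes D0: "\<And>x y. D x y \<ge> 0" and sym: "\<And>x y. D x y = D y x"
    and tri: "\<And>x y z. x \<in> S \<Longrightarrow> y \<in> S \<Longrightarrow> z \<in> S \<Longrightarrow> D x z \<le> D x y + D y z"
    and S: "\<And>n t. f n t \<in> S"
    and lip: "\<And>n s t. D (f n s) (f n t) \<le> K * \<bar>s - t\<bar> + e n" and e: "e \<longlonglongrightarrow> 0"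
    and cpt: "\<And>t r. strict_mono r \<Longrightarrow>
       \<exists>r'. strict_mono (r' :: nat \<Rightarrow> nat) \<and> (\<exists>l\<in>S. (\<lambda>n. D (f (r (r' n)) t) l) \<longlonglongrightarrow> 0)"
  shows "\<exists>r. strict_mono (r :: nat \<Rightarrow> nat) \<and> (\<forall>t. \<exists>l\<in>S. (\<lambda>n. D (f (r n) t) l) \<longlonglongrightarrow> 0)"
proof -
  \<comment> \<open>An enumeration of the rationals.\<close>
  define q :: "nat \<Rightarrow> real" where "q n = real_of_rat (from_nat n)" for n
  interpret subseqs "\<lambda>n s. \<exists>l\<in>S. (\<lambda>k. D (f (s k) (q n)) l) \<longlonglongrightarrow> 0"
    using cpt by unfold_locales (auto simp: o_def)
  define r where "r = diagseq"
  have r: "strict_mono r" unfolding r_def by (rule subseq_diagseq)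
  have "\<exists>l\<in>S. (\<lambda>k. D (f ((diagseq \<circ> ((+) (Suc n))) k) (q n)) l) \<longlonglongrightarrow> 0" for n
  proof (rule diagseq_holds)
    fix r s n assume "strict_mono (r :: nat \<Rightarrow> nat)" "\<exists>l\<in>S. (\<lambda>k. D (f (s k) (q n)) l) \<longlonglongrightarrow> 0"
    thus "\<exists>l\<in>S. (\<lambda>k. D (f ((s \<circ> r) k) (q n)) l) \<longlonglongrightarrow> 0"
      using LIMSEQ_subseq_LIMSEQ[OF _ \<open>strict_mono r\<close>] unfolding o_def by blast
  qed
  hence "\<exists>l\<in>S. (\<lambda>k. D (f (r (k + Suc n)) (q n)) l) \<longlonglongrightarrow> 0" for n
    unfolding r_def o_def by (subst add.commute)
  hence "\<exists>l\<in>S. (\<lambda>k. D (f (r k) (q n)) l) \<longlonglongrightarrow> 0" for n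
    by (blast intro: LIMSEQ_offset)
  then obtain l where l: "\<And>n. l n \<in> S" "\<And>n. (\<lambda>k. D (f (r k) (q n)) (l n)) \<longlonglongrightarrow> 0"
    by metis
  have "\<exists>l\<in>S. (\<lambda>n. D (f (r n) t) l) \<longlonglongrightarrow> 0" for t
  proof -
    \<comment> \<open>A limit m along a further subsequence is enough: it is close to the limits at
      nearby rationals, and these attract the whole diagonal sequence.\<close>
    obtain r' m where r': "strict_mono r'" and m: "m \<in> S" "(\<lambda>n. D (f (r (r' n)) t) m) \<longlonglongrightarrow> 0"
      using cpt[OF r] by blast
    have "(\<lambda>n. D (f (r n) t) m) \<longlonglongrightarrow> 0"
    proof (rule LIMSEQ_I)
      fix ep :: real assume ep: "ep > 0"
      \<comment> \<open>Moving from t to a rational within h costs at most ep/8;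
        \<open>\<bar>K\<bar> + 1\<close> is positive whatever K is.\<close>
      define h where "h = ep / (8 * (\<bar>K\<bar> + 1))"
      have h: "h > 0" using ep by (auto simp: h_def)
      obtain n where n: "\<bar>t - q n\<bar> < h"
      proof -
        obtain z :: rat where "t < of_rat z" "of_rat z < t + h" using of_rat_dense[of t "t+h"] h by auto
        thus ?thesis using that[of "to_nat z"] by (auto simp: q_def)
      qed
      have "K * \<bar>t - q n\<bar> \<le> (\<bar>K\<bar> + 1) * h" using n by (intro mult_mono) auto
      also have "\<dots> = ep / 8"
      proof -
        have "8 * (\<bar>K\<bar> + 1) > 0" by (simp add: add_nonneg_pos)
        thus ?thesis unfolding h_def by (simp add: field_simps)
      qed
      finally have K: "K * \<bar>t - q n\<bar> \<le> ep/8" .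
      have L: "\<forall>\<^sub>F k in sequentially. D (f (r k) (q n)) (l n) < ep/8"
        using order_tendstoD(2)[OF l(2)[of n], of "ep/8"] ep by auto
      have E: "\<forall>\<^sub>F k in sequentially. e (r k) < ep/8"
        using order_tendstoD(2)[OF LIMSEQ_subseq_LIMSEQ[OF e r], of "ep/8"] ep by (auto simp: o_def)
      have M: "\<forall>\<^sub>F k in sequentially. D (f (r (r' k)) t) m < ep/8"
        using order_tendstoD(2)[OF m(2), of "ep/8"] ep by auto
      have G: "\<forall>\<^sub>F k in sequentially. D (f (r k) t) (l n) < 3 * ep/8"
        using L E
      proof eventually_elim
        case (elim k)
        have "D (f (r k) t) (l n) \<le> D (f (r k) t) (f (r k) (q n)) + D (f (r k) (q n)) (l n)"
          using S l by (intro tri) auto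
        also have "\<dots> < 3 * ep/8" using lip[of "r k" t "q n"] K elim by linarith
        finally show ?case .
      qed
      have "\<forall>\<^sub>F k in sequentially. D (f (r (r' k)) t) (l n) < 3 * ep/8"
        using eventually_subseq[OF r' G] .
      with M have "\<forall>\<^sub>F k in sequentially. D (l n) m < ep/2"
      proof eventually_elim
        case (elim k)
        have "D (l n) m \<le> D (l n) (f (r (r' k)) t) + D (f (r (r' k)) t) m"
          using S l m by (intro tri) auto
        thus ?case using elim sym[of "l n" "f (r (r' k)) t"] by linarith
      qed
      \<comment> \<open>Neither point depends on k, so the eventual bound holds outright.\<close>
      hence lm: "D (l n) m < ep/2" by simp
      have "\<forall>\<^sub>F k in sequentially. norm (D (f (r k) t) m - 0) < ep"
        using G
      proof eventually_elim
        case (elim k)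
        have "D (f (r k) t) m \<le> D (f (r k) t) (l n) + D (l n) m"
          using S l m by (intro tri) auto
        thus ?case using elim lm D0[of "f (r k) t" m] by simp
      qed
      thus "\<exists>no. \<forall>n\<ge>no. norm (D (f (r n) t) m - 0) < ep" by (simp add: eventually_sequentially)
    qed
    thus ?thesis using m by blast
  qed
  thus ?thesis using r by blast
qed

section \<open>Geodesics in proper length spaces\<close>

lemma exact_intermediate_point:
  fixes x y :: "'a::metric_space"
  assumes len: "length_space TYPE('a)" and pr: "proper_space TYPE('a)"
    and a: "0 \<le> a" "a \<le> dist x y"
  shows "\<exists>z. dist x z = a \<and> dist z y = dist x y - a"
proof -
  have "\<exists>z. dist x z = a \<and> dist z y \<le> dist x y - a + inverse (Suc n)" for n
    by (rule length_space_approx_intermediate[OF len _ a]) auto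
  then obtain z where z: "\<And>n. dist x (z n) = a" "\<And>n. dist (z n) y \<le> dist x y - a + inverse (real (Suc n))"
    by metis
  have "compact (cball x a)" using pr by (auto simp: proper_space_def)
  hence "seq_compact (cball x a)" using compact_imp_seq_compact by blast
  then obtain l r where lr: "l \<in> cball x a" "strict_mono (r::nat\<Rightarrow>nat)" "(z \<circ> r) \<longlonglongrightarrow> l"
    using z by (auto elim!: seq_compactE[where f=z])
  have "dist x l \<le> a" using lr by auto
  moreover have "dist l y \<le> dist x y - a + 0"
  proof (rule LIMSEQ_le)
    show "(\<lambda>n. dist (z (r n)) y) \<longlonglongrightarrow> dist l y" using lr(3) by (intro tendsto_intros) (simp add: o_def)
    show "(\<lambda>n. dist x y - a + inverse (real (Suc (r n)))) \<longlonglongrightarrow> dist x y - a + 0"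
      using LIMSEQ_subseq_LIMSEQ[OF LIMSEQ_inverse_real_of_nat lr(2)] by (intro tendsto_intros) (simp add: o_def)
  qed (use z in auto)
  ultimately have "dist x l = a \<and> dist l y = dist x y - a" using dist_triangle[of x y l] by linarith
  thus ?thesis by blast
qed

text \<open>Cut off one share of the distance at an exact intermediate point; the rest splits into
  the remaining number of steps of the same size. The constructed chain stays at y after its last
  index, so the step bound holds for all i.\<close>

lemma ex_equidistant_chain:
  fixes x y :: "'a::metric_space"
  assumes len: "length_space TYPE('a)" and pr: "proper_space TYPE('a)"
  shows "\<exists>c::nat \<Rightarrow> 'a. c 0 = x \<and> c (Suc n) = y \<and> (\<forall>i. dist (c i) (c (Suc i)) \<le> dist x y / Suc n)"
proof (induction n arbitrary: x)
  case 0
  show ?case by (intro exI[of _ "\<lambda>i. if i = 0 then x else y"]) auto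
next
  case (Suc n)
  have "dist x y / real (Suc (Suc n)) \<le> dist x y"
    by (simp add: divide_le_eq mult_le_cancel_left1)
  then obtain z where z: "dist x z = dist x y / Suc (Suc n)" "dist z y = dist x y - dist x y / Suc (Suc n)"
    using exact_intermediate_point[OF len pr, of "dist x y / Suc (Suc n)" x y] by auto
  obtain c where c: "c 0 = z" "c (Suc n) = y" "\<And>i. dist (c i) (c (Suc i)) \<le> dist z y / Suc n"
    using Suc by blast
  have "dist z y / Suc n = dist x y / Suc (Suc n)" unfolding z by (simp add: divide_simps) (simp add: algebra_simps)
  thus ?case using c z
    by (intro exI[of _ "case_nat x c"]) (auto split: nat.split)
qed

text \<open>Step functions through finer and finer equidistant chains are Lipschitz up to one link
  and stay in a compact ball at each time, so Arzela-Ascoli gives a Lipschitz limit, which is all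
  that \<open>geodesic_space\<close> asks for.\<close>

theorem length_proper_imp_geodesic_space:
  assumes len: "length_space TYPE('a::metric_space)" and pr: "proper_space TYPE('a)"
  shows "geodesic_space TYPE('a)"
  unfolding geodesic_space_def
proof (intro allI)
  fix x y :: 'a
  define L where "L = dist x y"
  obtain c :: "nat \<Rightarrow> nat \<Rightarrow> 'a" where c: "\<And>n. c n 0 = x" "\<And>n. c n (Suc n) = y" "\<And>n i. dist (c n i) (c n (Suc i)) \<le> L / Suc n"
    using ex_equidistant_chain[OF len pr, where x=x and y=y] unfolding L_def by metis
  have chain: "dist (c n i) (c n (i + k)) \<le> k * (L / Suc n)" for n i k
  proof (induction k)
    case (Suc k)
    have "dist (c n i) (c n (i + Suc k)) \<le> dist (c n i) (c n (i + k)) + dist (c n (i+k)) (c n (Suc (i + k)))"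
      using dist_triangle by auto
    also have "\<dots> \<le> k * (L / Suc n) + L / Suc n" using Suc c by (intro add_mono) auto
    finally show ?case by (simp add: distrib_right add_divide_distrib algebra_simps)
  qed auto
  \<comment> \<open>Clamping to [0, 1] defines the curves at every real time, as
    \<open>arzela_ascoli_pointwise\<close> requires.\<close>
  define h where "h t = max 0 (min 1 t)" for t :: real
  \<comment> \<open>The chain index at time t; rounding down costs at most one link, whence the
    error \<open>L / Suc n\<close>.\<close>
  define j where "j n t = nat \<lfloor>h t * Suc n\<rfloor>" for n and t :: real
  define f where "f n t = c n (j n t)" for n t
  have lip1: "dist (f n s) (f n t) \<le> L * \<bar>s - t\<bar> + L / Suc n" if "s \<le> t" for n s t
  proof -
    have hst: "h s \<le> h t" "h t - h s \<le> t - s" "h s \<ge> 0" using that by (auto simp: h_def)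
    have "h s * Suc n \<le> h t * Suc n" using hst by (intro mult_right_mono) auto
    hence jj: "j n s \<le> j n t" unfolding j_def by (intro nat_mono floor_mono)
    have "real (j n t) \<le> h t * Suc n" using hst by (simp add: j_def)
    moreover have "real (j n s) \<ge> h s * Suc n - 1" using hst unfolding j_def
      by (smt (verit, ccfv_SIG) of_nat_0_le_iff of_nat_nat real_of_int_floor_ge_diff_one mult_nonneg_nonneg zero_le_floor)
    ultimately have "real (j n t - j n s) \<le> (h t - h s) * Suc n + 1" using jj by (simp add: algebra_simps of_nat_diff)
    also have "\<dots> \<le> \<bar>s - t\<bar> * Suc n + 1" using hst that by (intro add_mono mult_right_mono) auto
    finally have *: "real (j n t - j n s) \<le> \<bar>s - t\<bar> * Suc n + 1" .
    have "dist (f n s) (f n t) \<le> real (j n t - j n s) * (L / Suc n)"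
      using chain[of n "j n s" "j n t - j n s"] jj by (simp add: f_def)
    also have "\<dots> \<le> (\<bar>s - t\<bar> * Suc n + 1) * (L / Suc n)" by (rule mult_right_mono[OF *]) (simp add: L_def)
    also have "\<dots> = L * \<bar>s - t\<bar> + L / Suc n" by (simp add: field_simps)
    finally show ?thesis .
  qed
  have lip: "dist (f n s) (f n t) \<le> L * \<bar>s - t\<bar> + L / Suc n" for n s t
    using lip1[of s t n] lip1[of t s n] by (cases "s \<le> t") (auto simp: dist_commute abs_minus_commute)
  have f0: "f n 0 = x" for n by (simp add: f_def j_def h_def c)
  have f1: "f n 1 = y" for n by (simp add: f_def j_def h_def c nat_add_distrib flip: of_nat_Suc)
  have Ln: "(\<lambda>n. L / Suc n) \<longlonglongrightarrow> 0" by (rule LIMSEQ_Suc[OF lim_const_over_n])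
  have cpt: "\<exists>r'. strict_mono (r' :: nat \<Rightarrow> nat) \<and> (\<exists>l\<in>UNIV. (\<lambda>n. dist (f (r (r' n)) t) l) \<longlonglongrightarrow> 0)" for t :: real and r :: "nat \<Rightarrow> nat"
  proof -
    have "f n t \<in> cball x (L * \<bar>0 - t\<bar> + L)" for n
    proof -
      have "dist x (f n t) \<le> L * \<bar>0 - t\<bar> + L / Suc n" using lip[of n 0 t] f0 by simp
      also have "L / Suc n \<le> L" by (simp add: L_def divide_le_eq mult_le_cancel_left1)
      finally show ?thesis by simp
    qed
    moreover have "seq_compact (cball x (L * \<bar>0 - t\<bar> + L))"
      using pr compact_imp_seq_compact by (auto simp: proper_space_def)
    ultimately obtain l r' where "strict_mono (r'::nat\<Rightarrow>nat)" "((\<lambda>n. f (r n) t) \<circ> r') \<longlonglongrightarrow> l"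
      by (auto elim!: seq_compactE[where f="\<lambda>n. f (r n) t"])
    thus ?thesis by (intro exI[of _ r'] conjI bexI[of _ l]) (simp_all add: o_def flip: tendsto_dist_iff)
  qed
  have "\<exists>r. strict_mono (r :: nat \<Rightarrow> nat) \<and> (\<forall>t. \<exists>l\<in>UNIV. (\<lambda>n. dist (f (r n) t) l) \<longlonglongrightarrow> 0)"
    by (rule arzela_ascoli_pointwise[where K=L and e="\<lambda>n. L / Suc n"])
      (use lip Ln cpt in \<open>auto simp: dist_commute dist_triangle\<close>)
  then obtain r g where r: "strict_mono (r::nat\<Rightarrow>nat)" and g: "\<And>t. (\<lambda>n. dist (f (r n) t) (g t)) \<longlonglongrightarrow> 0"
    by metis
  have g': "(\<lambda>n. f (r n) t) \<longlonglongrightarrow> g t" for t using g by (simp add: tendsto_dist_iff[of "\<lambda>n. f (r n) t"])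
  have "g 0 = x" using g'[of 0] f0 by (simp add: LIMSEQ_const_iff)
  moreover have "g 1 = y" using g'[of 1] f1 by (simp add: LIMSEQ_const_iff)
  moreover have "dist (g s) (g t) \<le> \<bar>s - t\<bar> * L" for s t
  proof -
    have "dist (g s) (g t) \<le> L * \<bar>s - t\<bar> + 0"
    proof (rule LIMSEQ_le)
      show "(\<lambda>n. dist (f (r n) s) (f (r n) t)) \<longlonglongrightarrow> dist (g s) (g t)" using g' by (intro tendsto_intros)
      show "(\<lambda>n. L * \<bar>s - t\<bar> + L / Suc (r n)) \<longlonglongrightarrow> L * \<bar>s - t\<bar> + 0"
        using LIMSEQ_subseq_LIMSEQ[OF Ln r] by (intro tendsto_intros) (simp add: o_def)
    qed (use lip in auto)
    thus ?thesis by (simp add: mult.commute)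
  qed
  ultimately show "\<exists>c. c 0 = x \<and> c 1 = y \<and>
     (\<forall>s\<in>{0..1}. \<forall>t\<in>{0..1}. dist (c s) (c t) \<le> \<bar>s - t\<bar> * dist x y)" unfolding L_def by blast
qed

section \<open>Geodesics through a common segment\<close>

lemma geodesic_onI:
  fixes z :: "real \<Rightarrow> 'a::metric_space"
  assumes "l > 0" and lip: "\<And>s t. 0 \<le> s \<Longrightarrow> s \<le> t \<Longrightarrow> t \<le> l \<Longrightarrow> dist (z s) (z t) \<le> t - s"
    and e: "dist (z 0) (z l) = l"
  shows "geodesic_on 0 l z"
proof -
  have *: "dist (z s) (z t) = t - s" if "0 \<le> s" "s \<le> t" "t \<le> l" for s t
  proof -
    \<comment> \<open>The three upper bounds s, t - s and l - t already add up to l, so none of them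
      is strict.\<close>
    have "l \<le> dist (z 0) (z s) + dist (z s) (z t) + dist (z t) (z l)"
      using dist_triangle[of "z 0" "z l" "z s"] dist_triangle[of "z s" "z l" "z t"] e by linarith
    thus ?thesis using lip[of 0 s] lip[of s t] lip[of t l] that by linarith
  qed
  have "dist (z s) (z t) = \<bar>t - s\<bar>" if "s \<in> {0..l}" "t \<in> {0..l}" for s t
    using *[of s t] *[of t s] that by (cases "s \<le> t") (auto simp: dist_commute)
  thus ?thesis using assms unfolding geodesic_on_def by auto
qed

text \<open>One and the same segment from x to y is continued to z and to z'. Additivity of
  distances makes both concatenations geodesics, of equal length, and they agree on an interval that
  is nontrivial because x and y differ.\<close>

lemma non_branching_endpoint:
  fixes x y z z' :: "'a::metric_space"
  assumes geo: "geodesic_space TYPE('a)" and nb: "non_branching TYPE('a)"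
    and xy: "x \<noteq> y" and e: "dist y z = dist y z'"
    and z: "dist x z = dist x y + dist y z" and z': "dist x z' = dist x y + dist y z'"
  shows "z = z'"
proof (cases "y = z")
  case True
  thus ?thesis using e by auto
next
  case False
  define a where "a = dist x y"
  define b where "b = dist y z"
  have ab: "a > 0" "b > 0" using xy False by (auto simp: a_def b_def)
  have dz: "dist x z = a + b" and dz': "dist x z' = a + b" using z z' e by (auto simp: a_def b_def)
  obtain c where c: "c 0 = x" "c 1 = y"
    "\<And>s t. s \<in> {0..1} \<Longrightarrow> t \<in> {0..1} \<Longrightarrow> dist (c s) (c t) \<le> \<bar>s - t\<bar> * a"
    using geo unfolding geodesic_space_def a_def by metis
  have cl: "dist (c (s/a)) (c (t/a)) \<le> t - s" if "0 \<le> s" "s \<le> t" "t \<le> a" for s t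
  proof -
    have "dist (c (s/a)) (c (t/a)) \<le> \<bar>s/a - t/a\<bar> * a" using that ab by (intro c) auto
    also have "\<dots> = t - s" using that ab by (simp add: diff_divide_distrib[symmetric] abs_divide)
    finally show ?thesis .
  qed
  have ext: "\<exists>g. geodesic_on 0 (a+b) g \<and> (\<forall>t\<le>a. g t = c (t/a)) \<and> g (a+b) = w"
    if "dist y w = b" "dist x w = a + b" for w
  proof -
    obtain d where d: "d 0 = y" "d 1 = w"
      "\<And>s t. s \<in> {0..1} \<Longrightarrow> t \<in> {0..1} \<Longrightarrow> dist (d s) (d t) \<le> \<bar>s - t\<bar> * b"
      using geo \<open>dist y w = b\<close> unfolding geodesic_space_def by metis
    have dl: "dist (d ((s-a)/b)) (d ((t-a)/b)) \<le> t - s" if "a \<le> s" "s \<le> t" "t \<le> a+b" for s t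
    proof -
      have "dist (d ((s-a)/b)) (d ((t-a)/b)) \<le> \<bar>(s-a)/b - (t-a)/b\<bar> * b" using that ab by (intro d) auto
      also have "\<dots> = t - s" using that ab by (simp add: diff_divide_distrib[symmetric] abs_divide)
      finally show ?thesis .
    qed
    define g where "g t = (if t \<le> a then c (t/a) else d ((t-a)/b))" for t
    have "geodesic_on 0 (a+b) g"
    proof (rule geodesic_onI)
      fix s t assume st: "0 \<le> s" "s \<le> t" "t \<le> a + b"
      show "dist (g s) (g t) \<le> t - s"
      proof (cases "t \<le> a \<or> s > a")
        case True thus ?thesis using cl[of s t] dl[of s t] st by (auto simp: g_def)
      next
        case False
        have "dist (g s) (g t) \<le> dist (c (s/a)) (c 1) + dist (d 0) (d ((t-a)/b))"
          using False c d dist_triangle[of "c (s/a)" "d ((t-a)/b)" y] by (auto simp: g_def)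
        thus ?thesis using cl[of s a] dl[of a t] st False ab by auto
      qed
    qed (use ab c d that in \<open>auto simp: g_def\<close>)
    thus ?thesis using ab d by (intro exI[of _ g]) (auto simp: g_def)
  qed
  obtain g where g: "geodesic_on 0 (a+b) g" "\<forall>t\<le>a. g t = c (t/a)" "g (a+b) = z"
    using ext[of z] dz b_def by auto
  obtain g' where g': "geodesic_on 0 (a+b) g'" "\<forall>t\<le>a. g' t = c (t/a)" "g' (a+b) = z'"
    using ext[of z'] dz' b_def e by auto
  have "\<forall>t\<in>{0..a+b}. g t = g' t"
    using nb[unfolded non_branching_def, rule_format, of 0 "a+b" g g' 0 a] g g' ab by auto
  thus ?thesis using g g' ab by force
qed

subsection \<open>Coding points by real numbers\<close>

text \<open>Base 3 with digits 0 and 1, as in a Cantor set: all later digits together weigh at most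
  half of the current one, so digits can be read off robustly, which base 2 would not allow.\<close>

definition ternary_code :: "(nat \<Rightarrow> 'a set) \<Rightarrow> 'a \<Rightarrow> real" where
  "ternary_code U x = (\<Sum>i. indicator (U i) x * (1/3) ^ Suc i)"

lemma ternary_code_summable: "summable (\<lambda>i. indicator (U i) x * (1/3::real) ^ Suc i)"
  by (rule summable_comparison_test'[where g="\<lambda>i. (1/3::real) ^ Suc i" and N=0])
    (auto simp: indicator_def intro!: summable_mult summable_geometric)

lemma ternary_tail:
  "summable (\<lambda>i. (1/3::real) ^ Suc (i + n))" "(\<Sum>i. (1/3::real) ^ Suc (i + n)) = (1/3) ^ n / 2"
proof -
  have "(\<lambda>i. (1/3::real) ^ i) sums (1 / (1 - 1/3))" by (rule geometric_sums) auto
  from sums_mult[OF this, of "(1/3) ^ Suc n"]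
  have "(\<lambda>i. (1/3::real) ^ Suc (i + n)) sums ((1/3) ^ n / 2)" by (simp add: power_add mult_ac)
  thus "summable (\<lambda>i. (1/3::real) ^ Suc (i + n))" "(\<Sum>i. (1/3::real) ^ Suc (i + n)) = (1/3) ^ n / 2"
    by (auto simp: sums_iff)
qed

lemma ternary_code_bounds: "0 \<le> ternary_code U x" "ternary_code U x \<le> 1"
proof -
  show "0 \<le> ternary_code U x" unfolding ternary_code_def
    by (intro suminf_nonneg ternary_code_summable) auto
  have "ternary_code U x \<le> (\<Sum>i. (1/3::real) ^ Suc (i + 0))" unfolding ternary_code_def
    by (intro suminf_le ternary_code_summable ternary_tail) (auto simp: indicator_def)
  thus "ternary_code U x \<le> 1" unfolding ternary_tail by simp
qed

text \<open>At the first differing digit j the codes differ by 3^-(j+1) and later digits undo at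
  most half of it. If the k-th digits differ, then j is at most k.\<close>

lemma ternary_code_separates:
  assumes "\<bar>ternary_code U x - ternary_code U y\<bar> < (1/3) ^ Suc k / 2"
  shows "x \<in> U k \<longleftrightarrow> y \<in> U k"
proof (rule ccontr)
  assume nk: "\<not> (x \<in> U k \<longleftrightarrow> y \<in> U k)"
  hence ex: "\<exists>i. (x \<in> U i) \<noteq> (y \<in> U i)" by auto
  define j where "j = (LEAST i. (x \<in> U i) \<noteq> (y \<in> U i))"
  have j: "(x \<in> U j) \<noteq> (y \<in> U j)" unfolding j_def by (rule LeastI_ex[OF ex])
  have lj: "(x \<in> U i) = (y \<in> U i)" if "i < j" for i using not_less_Least that unfolding j_def by blast
  have jk: "j \<le> k" unfolding j_def by (rule Least_le) (use nk in auto)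
  define d where "d i = (indicator (U i) x - indicator (U i) y) * (1/3::real) ^ Suc i" for i
  have sd: "summable d" unfolding d_def left_diff_distrib
    by (intro summable_diff ternary_code_summable)
  have eq: "ternary_code U x - ternary_code U y = suminf d"
    unfolding ternary_code_def d_def left_diff_distrib
    by (intro suminf_diff ternary_code_summable)
  have "(\<Sum>i<Suc j. d i) = d j" using lj by (simp add: d_def indicator_def)
  hence s: "suminf d = (\<Sum>i. d (i + Suc j)) + d j" using suminf_split_initial_segment[OF sd, of "Suc j"] by simp
  have "norm (\<Sum>i. d (i + Suc j)) \<le> (\<Sum>i. (1/3::real) ^ Suc (i + Suc j))"
    by (intro norm_suminf_le ternary_tail) (auto simp: d_def indicator_def)
  hence a: "\<bar>\<Sum>i. d (i + Suc j)\<bar> \<le> (1/3) ^ Suc j / 2" unfolding ternary_tail by simp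
  have b: "\<bar>d j\<bar> = (1/3) ^ Suc j" using j by (auto simp: d_def indicator_def)
  have "(1/3::real) ^ Suc k \<le> (1/3) ^ Suc j" using jk by (intro power_decreasing) auto
  thus False using a b s eq assms by linarith
qed

lemma ternary_code_measurable:
  assumes "\<And>i. U i \<in> sets M"
  shows "ternary_code U \<in> borel_measurable M"
proof -
  have [measurable]: "U i \<in> sets M" for i by fact
  show ?thesis unfolding ternary_code_def
    by (rule borel_measurable_suminf) measurable
qed

text \<open>A closure is Borel whatever the image under the code looks like, so digits can be read
  off measurably; the gap between codes keeps the closure away from codes of points outside
  \<open>U k\<close>.\<close>

lemma ternary_code_decodes:
  "ternary_code U x \<in> closure (ternary_code U ` U k) \<longleftrightarrow> x \<in> U k"
proof
  assume "ternary_code U x \<in> closure (ternary_code U ` U k)"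
  then obtain y where "y \<in> U k" "dist (ternary_code U y) (ternary_code U x) < (1/3) ^ Suc k / 2"
    unfolding closure_approachable by (force elim!: allE[of _ "(1/3) ^ Suc k / 2"])
  thus "x \<in> U k" using ternary_code_separates[of U y x k] by (simp add: dist_real_def)
next
  assume "x \<in> U k"
  thus "ternary_code U x \<in> closure (ternary_code U ` U k)" by (meson closure_subset imageI subsetD)
qed

lemma dense_sequence:
  "\<exists>e :: nat \<Rightarrow> 'a::{metric_space,second_countable_topology}. \<forall>x ep. ep > 0 \<longrightarrow> (\<exists>j. dist (e j) x < ep)"
proof -
  obtain D :: "'a set" where D: "countable D" "\<And>X. open X \<Longrightarrow> X \<noteq> {} \<Longrightarrow> \<exists>d\<in>D. d \<in> X"
    using countable_dense_setE by blast
  have "\<exists>j. dist (from_nat_into D j) x < ep" if "ep > 0" for x ep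
  proof -
    obtain d where "d \<in> D" "d \<in> ball x ep" using D(2)[of "ball x ep"] \<open>ep > 0\<close> by auto
    moreover obtain j where "from_nat_into D j = d" using \<open>d \<in> D\<close> D(1) from_nat_into_surj by metis
    ultimately show ?thesis by (auto simp: dist_commute)
  qed
  thus ?thesis by blast
qed

text \<open>J takes countably many values, so every function of it is measurable; choosing the least
  index makes J itself measurable.\<close>

lemma countable_quantizer:
  fixes ep :: real
  assumes "ep > 0"
  shows "\<exists>(e::nat \<Rightarrow> 'a::{metric_space,second_countable_topology}) J. J \<in> borel \<rightarrow>\<^sub>M count_space UNIV \<and> (\<forall>x. dist (e (J x)) x < ep)"
proof -
  obtain e :: "nat \<Rightarrow> 'a" where dense: "\<And>x. \<exists>j. dist (e j) x < ep"
    using dense_sequence assms by metis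
  define J where "J x = (LEAST j. dist (e j) x < ep)" for x
  have "dist (e (J x)) x < ep" for x unfolding J_def by (rule LeastI_ex[OF dense])
  moreover have "J \<in> borel \<rightarrow>\<^sub>M count_space UNIV" unfolding J_def by measurable
  ultimately show ?thesis by blast
qed

text \<open>Every bit of the code stabilises along a sequence whose codes converge, so the sequence is
  Cauchy as soon as it meets a compact ball infinitely often.\<close>

lemma ex_real_coding:
  assumes pr: "proper_space TYPE('a::{complete_space,second_countable_topology})"
  shows "\<exists>(s::'a \<Rightarrow> real) g. s \<in> borel_measurable borel \<and> g \<in> borel_measurable borel \<and>
    (\<forall>x. g (s x) = x) \<and> (\<forall>x. 0 \<le> s x \<and> s x \<le> 1) \<and>
    (\<forall>x a. convergent (\<lambda>n. s (x n)) \<longrightarrow> \<not> filterlim (\<lambda>n. dist a (x n)) at_top sequentially \<longrightarrow> convergent x)"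
proof -
  obtain e :: "nat \<Rightarrow> 'a" where dense: "\<And>x ep. ep > 0 \<Longrightarrow> \<exists>j. dist (e j) x < ep"
    using dense_sequence by metis
  \<comment> \<open>All balls about the dense points with radii 1/(k+1), enumerated through pairs
    (j, k).\<close>
  define U where "U i = ball (e (fst (prod_decode i))) (1 / Suc (snd (prod_decode i)))" for i
  have U: "U (prod_encode (j, k)) = ball (e j) (1 / Suc k)" for j k by (simp add: U_def)
  define s where "s = ternary_code U"
  have s[measurable]: "s \<in> borel_measurable borel"
    unfolding s_def by (rule ternary_code_measurable) (simp add: U_def)
  define F where "F i = closure (s ` U i)" for i
  have F: "s x \<in> F i \<longleftrightarrow> x \<in> U i" for x i unfolding F_def s_def by (rule ternary_code_decodes)
  have [measurable]: "F i \<in> sets borel" for i unfolding F_def by simp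
  \<comment> \<open>Decodes up to 1/(k+1): the centre of the first ball of that radius whose digit
    in r is set.\<close>
  define h where "h k r = e (LEAST j. r \<in> F (prod_encode (j, k)))" for k r
  have h[measurable]: "h k \<in> borel_measurable borel" for k
  proof -
    have "(\<lambda>r. LEAST j. r \<in> F (prod_encode (j, k))) \<in> borel \<rightarrow>\<^sub>M count_space UNIV" by measurable
    thus ?thesis unfolding h_def by (rule measurable_compose) simp
  qed
  have hs: "(\<lambda>k. h k (s x)) \<longlonglongrightarrow> x" for x
  proof -
    have "dist (h k (s x)) x < 1 / Suc k" for k
    proof -
      have "\<exists>j. dist (e j) x < 1 / Suc k" by (rule dense) simp
      hence "\<exists>j. s x \<in> F (prod_encode (j, k))" by (simp add: F U)
      hence "s x \<in> F (prod_encode (LEAST j. s x \<in> F (prod_encode (j, k)), k))" by (rule LeastI_ex)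
      thus ?thesis by (simp add: F U h_def)
    qed
    hence near: "dist (h k (s x)) x < 1 / Suc k" for k .
    show ?thesis
    proof (rule metric_LIMSEQ_I)
      fix ep :: real assume "ep > 0"
      then obtain N where N: "1 / Suc N < ep" using nat_approx_posE by blast
      have "dist (h k (s x)) x < ep" if "k \<ge> N" for k
      proof -
        have "1 / real (Suc k) \<le> 1 / Suc N" using that by (intro divide_left_mono) auto
        thus ?thesis using near[of k] N by linarith
      qed
      thus "\<exists>N. \<forall>k\<ge>N. dist (h k (s x)) x < ep" by blast
    qed
  qed
  define h' where "h' k r = (if Cauchy (\<lambda>k. h k r) then h k r else e 0)" for k r
  \<comment> \<open>With the default \<open>e 0\<close> where decoding diverges, g is the limit of
    the measurable \<open>h' k\<close> at every real, codes or not.\<close>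
  define g where "g r = (if Cauchy (\<lambda>k. h k r) then lim (\<lambda>k. h k r) else e 0)" for r
  have [measurable]: "h' k \<in> borel_measurable borel" for k unfolding h'_def by measurable
  have g: "g \<in> borel_measurable borel"
  proof (rule borel_measurable_LIMSEQ_metric)
    show "(\<lambda>k. h' k r) \<longlonglongrightarrow> g r" for r
      unfolding h'_def g_def
      by (auto simp: Cauchy_convergent_iff convergent_LIMSEQ_iff)
  qed measurable
  have gs: "g (s x) = x" for x
    using hs[of x] by (auto simp: g_def limI convergent_Cauchy convergentI)
  have cnv: "convergent x" if conv: "convergent (\<lambda>n. s (x n))"
    and ninf: "\<not> filterlim (\<lambda>n. dist a (x n)) at_top sequentially" for x :: "nat \<Rightarrow> 'a" and a
  proof -
    have bit: "(\<forall>\<^sub>F n in sequentially. x n \<in> U i) \<or> (\<forall>\<^sub>F n in sequentially. x n \<notin> U i)" for i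
    proof -
      have "Cauchy (\<lambda>n. s (x n))" using conv by (rule convergent_Cauchy)
      then obtain N where N: "\<And>m n. m \<ge> N \<Longrightarrow> n \<ge> N \<Longrightarrow> dist (s (x m)) (s (x n)) < (1/3) ^ Suc i / 2"
        unfolding Cauchy_def by (force elim!: allE[of _ "(1/3) ^ Suc i / 2"])
      have "x n \<in> U i \<longleftrightarrow> x N \<in> U i" if "n \<ge> N" for n
        using N[of n N] that ternary_code_separates[of U "x n" "x N" i] by (auto simp: s_def dist_real_def)
      thus ?thesis unfolding eventually_sequentially by blast
    qed
    obtain Z where Z: "\<not> (\<forall>\<^sub>F n in sequentially. Z \<le> dist a (x n))"
      using ninf unfolding filterlim_at_top by auto
    \<comment> \<open>Otherwise the sequence eventually leaves each ball of this radius. Finitely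
      many of them cover \<open>cball a Z\<close>, so the distances would eventually be at least Z,
      against the choice of Z.\<close>
    have near: "\<exists>j. \<forall>\<^sub>F n in sequentially. x n \<in> ball (e j) (1 / Suc k)" for k
    proof (rule ccontr)
      assume "\<not> ?thesis"
      hence out: "\<forall>\<^sub>F n in sequentially. x n \<notin> ball (e j) (1 / Suc k)" for j
        using bit[of "prod_encode (j, k)"] U by auto
      have "compact (cball a Z)" using pr by (simp add: proper_space_def)
      moreover have "cball a Z \<subseteq> (\<Union>j\<in>UNIV. ball (e j) (1 / Suc k))"
      proof
        fix w assume "w \<in> cball a Z"
        obtain j where "dist (e j) w < 1 / Suc k" using dense[of "1 / Suc k" w] by auto
        thus "w \<in> (\<Union>j\<in>UNIV. ball (e j) (1 / Suc k))" by auto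
      qed
      ultimately obtain J where J: "finite J" "cball a Z \<subseteq> (\<Union>j\<in>J. ball (e j) (1 / Suc k))"
        using compactE_image[of "cball a Z" UNIV "\<lambda>j. ball (e j) (1 / Suc k)"] by (metis open_ball)
      have "\<forall>\<^sub>F n in sequentially. \<forall>j\<in>J. x n \<notin> ball (e j) (1 / Suc k)"
        using J(1) out by (simp add: eventually_ball_finite)
      hence "\<forall>\<^sub>F n in sequentially. Z \<le> dist a (x n)"
      proof eventually_elim
        case (elim n)
        hence "x n \<notin> cball a Z" using J by blast
        thus ?case by simp
      qed
      thus False using Z by simp
    qed
    have "Cauchy x"
    proof (rule metric_CauchyI)
      fix ep :: real assume "ep > 0"
      then obtain k where k: "1 / Suc k < ep/2" using nat_approx_posE[of "ep/2"] by auto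
      obtain j where "\<forall>\<^sub>F n in sequentially. x n \<in> ball (e j) (1 / Suc k)" using near by blast
      then obtain N where N: "\<And>n. n \<ge> N \<Longrightarrow> dist (e j) (x n) < 1 / Suc k"
        unfolding eventually_sequentially by auto
      have "dist (x m) (x n) < ep" if "m \<ge> N" "n \<ge> N" for m n
        using dist_triangle[of "x m" "x n" "e j"] N[OF that(1)] N[OF that(2)] k by (simp add: dist_commute)
      thus "\<exists>M. \<forall>m\<ge>M. \<forall>n\<ge>M. dist (x m) (x n) < ep" by blast
    qed
    thus ?thesis by (rule Cauchy_convergent)
  qed
  show ?thesis
  proof (intro exI[of _ s] exI[of _ g] conjI allI impI)
    fix x :: "nat \<Rightarrow> 'a" and a
    assume "convergent (\<lambda>n. s (x n))" "\<not> filterlim (\<lambda>n. dist a (x n)) at_top sequentially"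
    thus "convergent x" by (rule cnv)
  qed (simp_all add: s g gs ternary_code_bounds[of U, folded s_def])
qed

subsection \<open>Prokhorov's theorem in Skorohod form\<close>

text \<open>Codes lie in [0, 1], so their laws are tight for free and have an almost surely
  convergent representation. The moment bound serves to decode: it prevents sequences from running
  off to infinity, the one case in which convergent codes do not give convergent points.\<close>

theorem prokhorov_skorohod:
  fixes M :: "nat \<Rightarrow> 'a::{complete_space,second_countable_topology} measure"
  assumes pr: "proper_space TYPE('a)"
    and M: "\<And>n. prob_space (M n)" "\<And>n. sets (M n) = sets borel"
    and p: "p > 0" and C: "C < \<infinity>" "\<And>n. (\<integral>\<^sup>+x. ennreal (dist a x powr p) \<partial>M n) \<le> C"
  obtains r and \<Omega> :: "real measure" and X Y where "strict_mono (r::nat\<Rightarrow>nat)" "prob_space \<Omega>"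
    "\<And>n. X n \<in> \<Omega> \<rightarrow>\<^sub>M borel" "\<And>n. distr \<Omega> borel (X n) = M (r n)" "Y \<in> \<Omega> \<rightarrow>\<^sub>M borel"
    "AE \<omega> in \<Omega>. (\<lambda>n. X n \<omega>) \<longlonglongrightarrow> Y \<omega>"
proof -
  obtain s :: "'a \<Rightarrow> real" and g where s[measurable]: "s \<in> borel_measurable borel"
    and g[measurable]: "g \<in> borel_measurable borel" and gs: "\<And>x. g (s x) = x"
    and s01: "\<And>x. 0 \<le> s x" "\<And>x. s x \<le> 1"
    and conv: "\<And>x a. convergent (\<lambda>n. s (x n)) \<Longrightarrow> \<not> filterlim (\<lambda>n. dist a (x n)) at_top sequentially \<Longrightarrow> convergent x"
    using ex_real_coding[OF pr] by metis
  have [measurable_cong]: "sets (M n) = sets borel" for n by fact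
  define \<mu> where "\<mu> n = distr (M n) borel s" for n
  have rd: "real_distribution (\<mu> n)" for n
    unfolding \<mu>_def by (rule prob_space.real_distribution_distr[OF M(1)]) measurable
  have "tight \<mu>"
    unfolding tight_def
  proof (intro conjI allI impI rd)
    fix e :: real assume e: "e > 0"
    have "measure (\<mu> n) {-1<..1} > 1 - e" for n
    proof -
      interpret prob_space "M n" by fact
      have "s -` {-1<..1} \<inter> space (M n) = space (M n)"
      proof -
        have "-1 < s x \<and> s x \<le> 1" for x using s01[of x] by linarith
        thus ?thesis by auto
      qed
      hence "measure (\<mu> n) {-1<..1} = 1" unfolding \<mu>_def by (simp add: measure_distr prob_space)
      thus ?thesis using e by simp
    qed
    thus "\<exists>a b. a < b \<and> (\<forall>n. measure (\<mu> n) {a<..b} > 1 - e)"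
      by (intro exI[of _ "-1"] exI[of _ 1]) auto
  qed
  then obtain r L where r: "strict_mono (r::nat\<Rightarrow>nat)" and L: "real_distribution L" "weak_conv_m (\<mu> \<circ> id \<circ> r) L"
    using tight_imp_convergent_subsubsequence[of \<mu> id] by (auto simp: strict_mono_id)
  have rd': "real_distribution ((\<mu> \<circ> id \<circ> r) n)" for n by (simp add: rd)
  have "\<exists>(\<Omega>::real measure) W Z. prob_space \<Omega> \<and> (\<forall>n. W n \<in> \<Omega> \<rightarrow>\<^sub>M borel) \<and>
      (\<forall>n. distr \<Omega> borel (W n) = \<mu> (r n)) \<and> (\<forall>x\<in>space \<Omega>. (\<lambda>n. W n x) \<longlonglongrightarrow> Z x)"
    using Skorohod[OF rd' L] unfolding o_def id_apply by blast
  then obtain \<Omega> :: "real measure" and W Z where "prob_space \<Omega>"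
    and W[measurable]: "\<And>n. W n \<in> \<Omega> \<rightarrow>\<^sub>M borel"
    and dW: "\<And>n. distr \<Omega> borel (W n) = \<mu> (r n)"
    and WZ: "\<And>x. x \<in> space \<Omega> \<Longrightarrow> (\<lambda>n. W n x) \<longlonglongrightarrow> Z x"
    by blast
  interpret prob_space \<Omega> by fact
  define X where "X n \<omega> = g (W n \<omega>)" for n \<omega>
  have X[measurable]: "X n \<in> \<Omega> \<rightarrow>\<^sub>M borel" for n unfolding X_def by measurable
  have dX: "distr \<Omega> borel (X n) = M (r n)" for n
  proof -
    have "distr \<Omega> borel (X n) = distr (distr \<Omega> borel (W n)) borel g"
      by (subst distr_distr) (auto simp: X_def[abs_def] comp_def)
    also have "\<dots> = distr (M (r n)) borel (\<lambda>x. x)"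
      unfolding dW \<mu>_def by (subst distr_distr) (auto simp: comp_def gs)
    also have "\<dots> = M (r n)" by (rule distr_id2) (simp add: M)
    finally show ?thesis .
  qed
  \<comment> \<open>\<open>W n\<close> may take values that code no point, but its law is carried by
    codes, so decoding loses nothing almost surely.\<close>
  have "AE \<omega> in \<Omega>. s (X n \<omega>) = W n \<omega>" for n
  proof -
    have "AE y in distr \<Omega> borel (W n). s (g y) = y"
      unfolding dW \<mu>_def by (subst AE_distr_iff) (auto simp: gs)
    thus ?thesis by (subst (asm) AE_distr_iff) (auto simp: X_def)
  qed
  hence sX: "AE \<omega> in \<Omega>. \<forall>n. s (X n \<omega>) = W n \<omega>" by (simp add: AE_all_countable)
  \<comment> \<open>By Fatou the lower limit of the p-th powers is almost surely finite, which
    excludes divergence of the distances to infinity.\<close>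
  have "(\<integral>\<^sup>+\<omega>. liminf (\<lambda>n. ennreal (dist a (X n \<omega>) powr p)) \<partial>\<Omega>)
        \<le> liminf (\<lambda>n. \<integral>\<^sup>+\<omega>. ennreal (dist a (X n \<omega>) powr p) \<partial>\<Omega>)"
    by (rule nn_integral_liminf) measurable
  also have "\<dots> = liminf (\<lambda>n. \<integral>\<^sup>+x. ennreal (dist a x powr p) \<partial>M (r n))"
    by (simp add: dX[symmetric] nn_integral_distr)
  also have "\<dots> \<le> C"
    by (rule order_trans[OF Liminf_le_Limsup]) (simp_all add: C Limsup_bounded)
  finally have "(\<integral>\<^sup>+\<omega>. liminf (\<lambda>n. ennreal (dist a (X n \<omega>) powr p)) \<partial>\<Omega>) \<noteq> \<infinity>"
    using C by (auto simp: top_unique)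
  hence "AE \<omega> in \<Omega>. liminf (\<lambda>n. ennreal (dist a (X n \<omega>) powr p)) \<noteq> \<infinity>"
    by (intro nn_integral_PInf_AE) measurable
  hence AEc: "AE \<omega> in \<Omega>. convergent (\<lambda>n. X n \<omega>)"
    using sX AE_space
  proof eventually_elim
    case (elim \<omega>)
    have "convergent (\<lambda>n. s (X n \<omega>))" using elim WZ[of \<omega>] by (auto simp: convergent_def)
    moreover have "\<not> filterlim (\<lambda>n. dist a (X n \<omega>)) at_top sequentially"
    proof
      assume lim: "filterlim (\<lambda>n. dist a (X n \<omega>)) at_top sequentially"
      have "\<infinity> \<le> liminf (\<lambda>n. ennreal (dist a (X n \<omega>) powr p))"
        unfolding le_Liminf_iff
      proof (intro allI impI)
        fix y :: ennreal assume "y < \<infinity>"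
        then obtain b where b: "0 \<le> b" "y = ennreal b" by (cases y) auto
        have "\<forall>\<^sub>F n in sequentially. (b + 1) powr (1/p) \<le> dist a (X n \<omega>)"
          using lim unfolding filterlim_at_top by blast
        thus "\<forall>\<^sub>F n in sequentially. y < ennreal (dist a (X n \<omega>) powr p)"
        proof eventually_elim
          case (elim n)
          have "((b + 1) powr (1/p)) powr p \<le> dist a (X n \<omega>) powr p"
            using elim p by (intro powr_mono2) auto
          thus ?case using b p by (simp add: powr_powr ennreal_less_iff)
        qed
      qed
      hence "liminf (\<lambda>n. ennreal (dist a (X n \<omega>) powr p)) = \<infinity>" by (simp add: top_unique)
      thus False using elim by simp
    qed
    ultimately show ?case by (rule conv)
  qed
  \<comment> \<open>Both are set to a off the convergence set, so that Y is a pointwise limit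
    everywhere and hence measurable.\<close>
  define X' where "X' n \<omega> = (if Cauchy (\<lambda>n. X n \<omega>) then X n \<omega> else a)" for n \<omega>
  define Y where "Y \<omega> = (if Cauchy (\<lambda>n. X n \<omega>) then lim (\<lambda>n. X n \<omega>) else a)" for \<omega>
  have [measurable]: "X' n \<in> borel_measurable \<Omega>" for n unfolding X'_def by measurable
  have "Y \<in> borel_measurable \<Omega>"
  proof (rule borel_measurable_LIMSEQ_metric)
    show "(\<lambda>k. X' k r) \<longlonglongrightarrow> Y r" for r
      unfolding X'_def Y_def
      by (auto simp: Cauchy_convergent_iff convergent_LIMSEQ_iff)
  qed measurable
  moreover have "AE \<omega> in \<Omega>. (\<lambda>n. X n \<omega>) \<longlonglongrightarrow> Y \<omega>"
    using AEc by eventually_elim (auto simp: Y_def Cauchy_convergent_iff convergent_LIMSEQ_iff)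
  ultimately show ?thesis using that r X dX \<open>prob_space \<Omega>\<close> by blast
qed

text \<open>This carries marginals through limits of couplings and gluings. Closed sets determine a
  law; their indicators are limits of the bounded continuous functions
  \<open>max 0 (1 - k * infdist x F)\<close>, whose integrals pass to the limit by dominated
  convergence.\<close>

lemma distr_AE_limit_const:
  fixes Y :: "'b \<Rightarrow> 'a::{metric_space,second_countable_topology}"
  assumes "prob_space \<Omega>" and X[measurable]: "\<And>n. X n \<in> \<Omega> \<rightarrow>\<^sub>M borel"
    and Y[measurable]: "Y \<in> \<Omega> \<rightarrow>\<^sub>M borel"
    and lim: "AE \<omega> in \<Omega>. (\<lambda>n. X n \<omega>) \<longlonglongrightarrow> Y \<omega>" and d: "\<And>n. distr \<Omega> borel (X n) = M"
  shows "distr \<Omega> borel Y = M"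
proof -
  interpret prob_space \<Omega> by fact
  have sM[measurable_cong]: "sets M = sets borel" using d[of 0] by (metis sets_distr)
  interpret M: prob_space M using prob_space_distr[OF X[of 0]] d[of 0] by simp
  interpret N: prob_space "distr \<Omega> borel Y" by (rule prob_space_distr) measurable
  have eq: "emeasure (distr \<Omega> borel Y) F = emeasure M F" if F: "closed F" for F
  \<comment> \<open>\<open>infdist x {}\<close> is 0, so the approximation below would fail for the
    empty set.\<close>
  proof (cases "F = {}")
    case False
    define f where "f k x = max 0 (1 - real k * infdist x F)" for k x
    have cf: "continuous_on UNIV (f k)" for k unfolding f_def by (intro continuous_intros)
    have [measurable]: "f k \<in> borel_measurable borel" for k by (rule borel_measurable_continuous_onI[OF cf])
    have f1: "f k x \<le> 1" for k x by (auto simp: f_def infdist_nonneg)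
    have int: "(\<integral>\<^sup>+x. ennreal (f k x) \<partial>distr \<Omega> borel Y) = (\<integral>\<^sup>+x. ennreal (f k x) \<partial>M)" for k
    proof -
      have "(\<lambda>n. \<integral>\<^sup>+\<omega>. ennreal (f k (X n \<omega>)) \<partial>\<Omega>) \<longlonglongrightarrow> (\<integral>\<^sup>+\<omega>. ennreal (f k (Y \<omega>)) \<partial>\<Omega>)"
      proof (rule nn_integral_dominated_convergence[where w="\<lambda>_. 1"])
        show "AE \<omega> in \<Omega>. (\<lambda>n. ennreal (f k (X n \<omega>))) \<longlonglongrightarrow> ennreal (f k (Y \<omega>))"
          using lim
        proof eventually_elim
          case (elim \<omega>)
          have "isCont (f k) (Y \<omega>)" using cf by (simp add: continuous_on_eq_continuous_at)
          from isCont_tendsto_compose[OF this elim] show ?case by (rule tendsto_ennrealI)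
        qed
      qed (measurable, simp_all add: f1 ennreal_le_1 emeasure_space_1)
      moreover have "(\<integral>\<^sup>+\<omega>. ennreal (f k (X n \<omega>)) \<partial>\<Omega>) = (\<integral>\<^sup>+x. ennreal (f k x) \<partial>M)" for n
        unfolding d[of n, symmetric] by (subst nn_integral_distr) auto
      ultimately show ?thesis by (subst nn_integral_distr) (auto simp: LIMSEQ_const_iff)
    qed
    have limf: "(\<lambda>k. ennreal (f k x)) \<longlonglongrightarrow> indicator F x" for x
    proof (cases "x \<in> F")
      case True thus ?thesis by (simp add: f_def)
    next
      case False
      hence "infdist x F > 0" using F \<open>F \<noteq> {}\<close> by (simp add: infdist_pos_not_in_closed)
      then obtain K where K: "real K * infdist x F > 1" using reals_Archimedean3 by blast
      have "f k x = 0" if "k \<ge> K" for k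
      proof -
        have "real K * infdist x F \<le> real k * infdist x F" using that by (intro mult_right_mono) (auto simp: infdist_nonneg)
        thus ?thesis using K by (simp add: f_def)
      qed
      hence "\<forall>\<^sub>F k in sequentially. ennreal (f k x) = indicator F x"
        using False by (auto simp: eventually_sequentially intro!: exI[of _ K])
      thus ?thesis by (rule tendsto_eventually)
    qed
    have conv: "(\<lambda>k. \<integral>\<^sup>+x. ennreal (f k x) \<partial>Q) \<longlonglongrightarrow> emeasure Q F"
      if Q: "prob_space Q" "sets Q = sets borel" for Q
    proof -
      interpret Q: prob_space Q by fact
      have [measurable_cong]: "sets Q = sets borel" by fact
      have [measurable]: "F \<in> sets borel" using F by simp
      have FQ: "F \<in> sets Q" using F Q by auto
      have "(\<lambda>k. \<integral>\<^sup>+x. ennreal (f k x) \<partial>Q) \<longlonglongrightarrow> (\<integral>\<^sup>+x. indicator F x \<partial>Q)"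
        by (rule nn_integral_dominated_convergence[where w="\<lambda>_. 1"])
          (use limf F f1 in \<open>auto simp: Q.emeasure_space_1\<close>)
      thus ?thesis using FQ by simp
    qed
    show ?thesis
      using conv[of M] conv[of "distr \<Omega> borel Y"] sM M.prob_space_axioms N.prob_space_axioms
      unfolding int by (auto intro: LIMSEQ_unique)
  qed simp
  show ?thesis
  proof (rule measure_eqI_generator_eq[where E="Collect closed" and \<Omega>=UNIV and A="\<lambda>_. UNIV"])
    show "Int_stable (Collect (closed :: 'a set \<Rightarrow> bool))" by (auto simp: Int_stable_def)
  qed (use eq sM N.emeasure_space_1 in \<open>auto simp: borel_eq_closed\<close>)
qed

subsection \<open>Strict convexity of powers\<close>

text \<open>With t = x/m the claim reads 1 + p(t - 1) < t^p. It follows from t^(p-1) >= 1 + (p-1) ln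
  t, which is the exponential inequality, and ln t > 1 - 1/t. At x = 0 there is no logarithm and the
  claim is checked directly.\<close>

lemma powr_tangent_strict:
  fixes x m p :: real
  assumes p: "p > 1" and x: "x \<ge> 0" and m: "m > 0" and ne: "x \<noteq> m"
  shows "m powr p + p * m powr (p - 1) * (x - m) < x powr p"
proof (cases "x = 0")
  case True
  have "m powr (p - 1) * m = m powr p" using m powr_mult_base[of m "p - 1"] by (simp add: mult.commute)
  hence "p * m powr (p - 1) * m = p * m powr p" by simp
  moreover have "1 * m powr p < p * m powr p" using p m by (intro mult_strict_right_mono) auto
  ultimately show ?thesis using True p by (simp add: mult.assoc)
next
  case False
  define t where "t = x / m"
  have t: "t > 0" "t \<noteq> 1" "x = m * t" using False x m ne by (auto simp: t_def)
  have "ln (1/t) \<le> 1/t - 1" "ln (1/t) \<noteq> 1/t - 1"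
    using ln_le_minus_one[of "1/t"] ln_eq_minus_one[of "1/t"] t by auto
  hence ln: "1 - 1/t < ln t" using t by (simp add: ln_div)
  have "1 + (p - 1) * ln t \<le> exp ((p - 1) * ln t)" by (rule exp_ge_add_one_self)
  hence "1 + (p - 1) * ln t \<le> t powr (p - 1)" using t by (simp add: powr_def)
  moreover have "(p - 1) * (1 - 1/t) < (p - 1) * ln t" using ln p by simp
  ultimately have "1 + (p - 1) * (1 - 1/t) < t powr (p - 1)" by linarith
  hence "t * (1 + (p - 1) * (1 - 1/t)) < t * t powr (p - 1)" using t by simp
  also have "t * t powr (p - 1) = t powr p" using t by (simp add: powr_mult_base)
  also have "t * (1 + (p - 1) * (1 - 1/t)) = 1 + p * (t - 1)" using t by (simp add: field_simps)
  finally have "m powr p * (1 + p * (t - 1)) < m powr p * t powr p" using m by simp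
  moreover have "m powr p * t powr p = x powr p" using t m by (simp add: powr_mult)
  moreover have "m powr (p - 1) * m = m powr p" using m powr_mult_base[of m "p - 1"] by (simp add: mult.commute)
  hence "m powr p * (1 + p * (t - 1)) = m powr p + p * m powr (p - 1) * (x - m)"
    by (simp add: t(3) algebra_simps)
  ultimately show ?thesis by simp
qed

text \<open>With these weights the mean of u/a and v/b is (u+v)/(a+b). The tangent of the power
  function at the mean lies below it and touches it only there, so equality forces u/a =
  v/b.\<close>

lemma powr_convex_combination:
  fixes u v a b p :: real
  assumes p: "p > 1" and u: "u \<ge> 0" and v: "v \<ge> 0" and a: "a > 0" and b: "b > 0"
  defines "l \<equiv> a / (a + b)"
  shows "((u + v) / (a + b)) powr p \<le> l * (u / a) powr p + (1 - l) * (v / b) powr p" (is "?L \<le> ?R")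
    and "((u + v) / (a + b)) powr p = l * (u / a) powr p + (1 - l) * (v / b) powr p \<Longrightarrow> b * u = a * v"
proof -
  define m where "m = (u + v) / (a + b)"
  have l: "0 < l" "l < 1" using a b by (auto simp: l_def)
  have l1: "1 - l = b / (a + b)" using a b by (simp add: l_def field_simps)
  have comb: "l * (u/a) + (1 - l) * (v/b) = m"
    unfolding l1 using a b by (simp add: l_def m_def add_divide_distrib)
  have "m \<ge> 0" using u v a b by (simp add: m_def)
  have "?L \<le> ?R \<and> (?L = ?R \<longrightarrow> u / a = v / b)"
  proof (cases "m = 0")
    case True
    hence "u = 0" "v = 0" using u v a b by (auto simp: m_def)
    thus ?thesis by simp
  next
    case False
    hence m: "m > 0" using \<open>m \<ge> 0\<close> by simp
    define T where "T x = m powr p + p * m powr (p - 1) * (x - m)" for x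
    have T: "T x \<le> x powr p" "T x = x powr p \<Longrightarrow> x = m" if "x \<ge> 0" for x
      using powr_tangent_strict[OF p that m] by (cases "x = m"; force simp: T_def)+
    have "l * T (u/a) + (1 - l) * T (v/b) = m powr p + p * m powr (p - 1) * (l * (u/a) + (1 - l) * (v/b) - m)"
      by (simp add: T_def algebra_simps)
    hence eq: "l * T (u/a) + (1 - l) * T (v/b) = ?L" unfolding comb by (simp add: m_def)
    have Tu: "T (u/a) \<le> (u/a) powr p" and Tv: "T (v/b) \<le> (v/b) powr p" using T u v a b by auto
    have i: "l * T (u/a) \<le> l * (u/a) powr p" "(1 - l) * T (v/b) \<le> (1 - l) * (v/b) powr p"
      using Tu Tv l by (auto intro!: mult_left_mono)
    moreover have "u/a = v/b" if "?L = ?R"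
    proof -
      have "l * T (u/a) = l * (u/a) powr p" "(1 - l) * T (v/b) = (1 - l) * (v/b) powr p"
        using that i eq by linarith+
      hence "T (u/a) = (u/a) powr p" "T (v/b) = (v/b) powr p" using l by auto
      thus ?thesis using T(2)[of "u/a"] T(2)[of "v/b"] u v a b by simp
    qed
    ultimately show ?thesis using eq by linarith
  qed
  thus "?L \<le> ?R" "?L = ?R \<Longrightarrow> b * u = a * v" using a b by (auto simp: field_simps)
qed

lemma powr_add_le:
  fixes u v p :: real
  assumes "u \<ge> 0" "v \<ge> 0" "p > 0"
  shows "(u + v) powr p \<le> 2 powr p * (u powr p + v powr p)"
proof -
  have "(u + v) powr p \<le> (2 * max u v) powr p" using assms by (intro powr_mono2) auto
  also have "\<dots> = 2 powr p * (max u v) powr p" using assms by (simp add: powr_mult)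
  also have "\<dots> \<le> 2 powr p * (u powr p + v powr p)" by (intro mult_left_mono) (auto simp: max_def)
  finally show ?thesis .
qed

text \<open>The convexity inequality is integrated pointwise, so that equality of the integrals
  returns equality almost everywhere: both additivity and proportionality. The positive a and b need
  only bound the norms of u and v.\<close>

lemma minkowski_powr:
  fixes u v w :: "'b \<Rightarrow> real"
  assumes [measurable]: "u \<in> borel_measurable M" "v \<in> borel_measurable M" "w \<in> borel_measurable M"
    and nn: "\<And>x. 0 \<le> u x" "\<And>x. 0 \<le> v x" "\<And>x. 0 \<le> w x" and le: "\<And>x. w x \<le> u x + v x"
    and p: "p > 1" and a: "a > 0" and b: "b > 0"
    and iu: "(\<integral>\<^sup>+x. ennreal (u x powr p) \<partial>M) \<le> ennreal (a powr p)"
    and iv: "(\<integral>\<^sup>+x. ennreal (v x powr p) \<partial>M) \<le> ennreal (b powr p)"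
  shows "(\<integral>\<^sup>+x. ennreal (w x powr p) \<partial>M) \<le> ennreal ((a + b) powr p)"
    and "ennreal ((a + b) powr p) \<le> (\<integral>\<^sup>+x. ennreal (w x powr p) \<partial>M) \<Longrightarrow>
      AE x in M. w x = u x + v x \<and> b * u x = a * v x"
proof -
  define l where "l = a / (a + b)"
  have l: "0 < l" "l < 1" using a b by (auto simp: l_def)
  \<comment> \<open>Normalisation: g integrates to at most l + (1 - l) = 1, and h to exactly 1 when
    the norm of w is a + b.\<close>
  define c1 where "c1 = l / a powr p"
  define c2 where "c2 = (1 - l) / b powr p"
  define c3 where "c3 = 1 / (a + b) powr p"
  have c: "c1 > 0" "c2 > 0" "c3 > 0" using l a b by (auto simp: c1_def c2_def c3_def)
  define g where "g x = ennreal c1 * ennreal (u x powr p) + ennreal c2 * ennreal (v x powr p)" for x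
  define h where "h x = ennreal c3 * ennreal (w x powr p)" for x
  have [measurable]: "g \<in> borel_measurable M" "h \<in> borel_measurable M" unfolding g_def h_def by measurable
  have g: "g x = ennreal (l * (u x / a) powr p + (1 - l) * (v x / b) powr p)" for x
    unfolding g_def c1_def c2_def using nn[of x] a b l
    by (simp add: powr_divide flip: ennreal_mult ennreal_plus)
  have h: "h x = ennreal ((w x / (a + b)) powr p)" for x
    unfolding h_def c3_def using nn[of x] a b by (simp add: powr_divide flip: ennreal_mult)
  have mono: "(w x / (a + b)) powr p \<le> ((u x + v x) / (a + b)) powr p" for x
    using nn[of x] le[of x] a b p by (intro powr_mono2 divide_right_mono) auto
  have conv: "((u x + v x) / (a + b)) powr p \<le> l * (u x / a) powr p + (1 - l) * (v x / b) powr p" for x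
    unfolding l_def by (rule powr_convex_combination(1)) (use p nn a b in auto)
  have hg: "h x \<le> g x" for x unfolding h g by (intro ennreal_leI order_trans[OF mono conv])
  have "(\<integral>\<^sup>+x. g x \<partial>M) = ennreal c1 * (\<integral>\<^sup>+x. ennreal (u x powr p) \<partial>M) + ennreal c2 * (\<integral>\<^sup>+x. ennreal (v x powr p) \<partial>M)"
    unfolding g_def by (subst nn_integral_add) (auto simp: nn_integral_cmult)
  also have "\<dots> \<le> ennreal c1 * ennreal (a powr p) + ennreal c2 * ennreal (b powr p)"
    by (intro add_mono mult_left_mono iu iv) auto
  also have "\<dots> = 1" using c a b l
    by (simp add: c1_def c2_def flip: ennreal_mult ennreal_plus)
  finally have ig: "(\<integral>\<^sup>+x. g x \<partial>M) \<le> 1" .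
  have ih: "(\<integral>\<^sup>+x. h x \<partial>M) = ennreal c3 * (\<integral>\<^sup>+x. ennreal (w x powr p) \<partial>M)"
    unfolding h_def by (simp add: nn_integral_cmult)
  have "(\<integral>\<^sup>+x. h x \<partial>M) \<le> 1" by (rule order_trans[OF nn_integral_mono ig]) (rule hg)
  have resc: "ennreal ((a + b) powr p) * (\<integral>\<^sup>+x. h x \<partial>M) = (\<integral>\<^sup>+x. ennreal (w x powr p) \<partial>M)"
    unfolding ih c3_def using a b by (simp add: mult.assoc[symmetric] flip: ennreal_mult)
  have "ennreal ((a + b) powr p) * (\<integral>\<^sup>+x. h x \<partial>M) \<le> ennreal ((a + b) powr p) * 1"
    by (intro mult_left_mono \<open>(\<integral>\<^sup>+x. h x \<partial>M) \<le> 1\<close>) auto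
  thus "(\<integral>\<^sup>+x. ennreal (w x powr p) \<partial>M) \<le> ennreal ((a + b) powr p)" unfolding resc by simp
  assume ge: "ennreal ((a + b) powr p) \<le> (\<integral>\<^sup>+x. ennreal (w x powr p) \<partial>M)"
  have "1 = ennreal c3 * ennreal ((a + b) powr p)" using a b by (simp add: c3_def flip: ennreal_mult)
  also have "\<dots> \<le> (\<integral>\<^sup>+x. h x \<partial>M)" unfolding ih by (intro mult_left_mono ge) auto
  finally have h1: "(\<integral>\<^sup>+x. h x \<partial>M) = 1" using \<open>(\<integral>\<^sup>+x. h x \<partial>M) \<le> 1\<close> by simp
  have "(\<integral>\<^sup>+x. g x - h x \<partial>M) = (\<integral>\<^sup>+x. g x \<partial>M) - (\<integral>\<^sup>+x. h x \<partial>M)"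
    by (rule nn_integral_diff) (auto simp: h1 hg)
  also have "(\<integral>\<^sup>+x. g x \<partial>M) = 1"
    using ig nn_integral_mono[of M h g] hg unfolding h1 by (intro antisym) auto
  also have "1 - (\<integral>\<^sup>+x. h x \<partial>M) = 0" unfolding h1 by simp
  finally have "AE x in M. g x - h x = 0" by (subst (asm) nn_integral_0_iff_AE) auto
  thus "AE x in M. w x = u x + v x \<and> b * u x = a * v x"
  proof eventually_elim
    case (elim x)
    have fin: "g x \<noteq> \<infinity>" unfolding g by simp
    have "g x \<le> h x" using elim by (simp add: diff_eq_0_iff_ennreal fin)
    hence "g x = h x" using hg[of x] by simp
    moreover have "0 \<le> l * (u x / a) powr p + (1 - l) * (v x / b) powr p" using l by simp
    ultimately have e: "(w x / (a + b)) powr p = l * (u x / a) powr p + (1 - l) * (v x / b) powr p"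
      unfolding g h by simp
    have e1: "((u x + v x) / (a + b)) powr p = l * (u x / a) powr p + (1 - l) * (v x / b) powr p"
      using e mono[of x] conv[of x] by linarith
    hence "b * u x = a * v x" unfolding l_def
      by (intro powr_convex_combination(2)[of p]) (use p nn a b in auto)
    moreover have "w x = u x + v x"
    proof (rule ccontr)
      assume "w x \<noteq> u x + v x"
      hence "w x / (a + b) < (u x + v x) / (a + b)" using le[of x] a b by (simp add: divide_strict_right_mono)
      hence "(w x / (a + b)) powr p < ((u x + v x) / (a + b)) powr p"
        using nn[of x] a b p by (intro powr_less_mono2) auto
      thus False using e e1 by simp
    qed
    ultimately show ?case by simp
  qed
qed

subsection \<open>Couplings\<close>

lemma borel_measurable_fst_prod [measurable]:
  "fst \<in> (borel :: ('a::topological_space \<times> 'b::topological_space) measure) \<rightarrow>\<^sub>M borel"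
  by (intro borel_measurable_continuous_onI continuous_intros)

lemma borel_measurable_snd_prod [measurable]:
  "snd \<in> (borel :: ('a::topological_space \<times> 'b::topological_space) measure) \<rightarrow>\<^sub>M borel"
  by (intro borel_measurable_continuous_onI continuous_intros)

definition cost :: "real \<Rightarrow> ('a::metric_space \<times> 'a) measure \<Rightarrow> ennreal" where
  "cost p \<pi> = (\<integral>\<^sup>+ xy. ennreal (dist (fst xy) (snd xy) powr p) \<partial>\<pi>)"

lemma wass_nonneg: "wass p \<mu> \<nu> \<ge> 0" by (simp add: wass_def)

lemma couplings_pair:
  fixes X Y :: "'b \<Rightarrow> 'a::{metric_space,second_countable_topology}"
  assumes "prob_space N" and [measurable]: "X \<in> N \<rightarrow>\<^sub>M borel" "Y \<in> N \<rightarrow>\<^sub>M borel"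
  shows "distr N borel (\<lambda>w. (X w, Y w)) \<in> couplings (distr N borel X) (distr N borel Y)"
  unfolding couplings_def using assms(1)
  by (auto simp: distr_distr comp_def intro!: prob_space.prob_space_distr)

lemma cost_pair:
  fixes X Y :: "'b \<Rightarrow> 'a::{metric_space,second_countable_topology}"
  assumes [measurable]: "X \<in> N \<rightarrow>\<^sub>M borel" "Y \<in> N \<rightarrow>\<^sub>M borel"
  shows "cost p (distr N borel (\<lambda>w. (X w, Y w))) = (\<integral>\<^sup>+w. ennreal (dist (X w) (Y w) powr p) \<partial>N)"
  unfolding cost_def by (subst nn_integral_distr) auto

lemma wass_le_cost:
  assumes "\<pi> \<in> couplings \<mu> \<nu>" "cost p \<pi> \<le> ennreal (c powr p)" "c \<ge> 0" "p > 0"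
  shows "wass p \<mu> \<nu> \<le> c"
proof -
  have "(INF \<pi> \<in> couplings \<mu> \<nu>. cost p \<pi>) \<le> ennreal (c powr p)"
    using assms by (intro INF_lower2[where i=\<pi>]) auto
  hence "enn2real (INF \<pi> \<in> couplings \<mu> \<nu>. cost p \<pi>) \<le> enn2real (ennreal (c powr p))"
    by (intro enn2real_mono) auto
  hence "(enn2real (INF \<pi> \<in> couplings \<mu> \<nu>. cost p \<pi>)) powr (1/p) \<le> (c powr p) powr (1/p)"
    using assms by (intro powr_mono2) auto
  thus ?thesis using assms unfolding wass_def cost_def by (simp add: powr_powr)
qed

lemma wass_le_rv:
  fixes X Y :: "'b \<Rightarrow> 'a::{metric_space,second_countable_topology}"
  assumes "prob_space N" "X \<in> N \<rightarrow>\<^sub>M borel" "Y \<in> N \<rightarrow>\<^sub>M borel"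
    and "(\<integral>\<^sup>+w. ennreal (dist (X w) (Y w) powr p) \<partial>N) \<le> ennreal (c powr p)" "c \<ge> 0" "p > 0"
  shows "wass p (distr N borel X) (distr N borel Y) \<le> c"
  using wass_le_cost[OF couplings_pair[OF assms(1-3)]] cost_pair[OF assms(2,3)] assms(4-6) by simp

lemma couplings_swap:
  fixes \<mu> \<nu> :: "'a::{metric_space,second_countable_topology} measure"
  assumes "\<pi> \<in> couplings \<mu> \<nu>"
  shows "distr \<pi> borel (\<lambda>z. (snd z, fst z)) \<in> couplings \<nu> \<mu>"
    and "cost p (distr \<pi> borel (\<lambda>z. (snd z, fst z))) = cost p \<pi>"
proof -
  have [measurable_cong]: "sets \<pi> = sets borel" and "prob_space \<pi>" using assms by (auto simp: couplings_def)
  show "distr \<pi> borel (\<lambda>z. (snd z, fst z)) \<in> couplings \<nu> \<mu>"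
    using couplings_pair[OF \<open>prob_space \<pi>\<close>, of snd fst] assms by (simp add: couplings_def)
  show "cost p (distr \<pi> borel (\<lambda>z. (snd z, fst z))) = cost p \<pi>"
    by (subst cost_pair) (auto simp: cost_def dist_commute)
qed

lemma wass_commute:
  fixes \<mu> \<nu> :: "'a::{metric_space,second_countable_topology} measure"
  shows "wass p \<mu> \<nu> = wass p \<nu> \<mu>"
proof -
  have "(INF \<pi> \<in> couplings \<mu> \<nu>. cost p \<pi>) \<le> (INF \<pi> \<in> couplings \<nu> \<mu>. cost p \<pi>)" for \<mu> \<nu> :: "'a measure"
    by (intro INF_greatest INF_lower2[OF couplings_swap(1)]) (auto simp: couplings_swap(2))
  from antisym[OF this this] show ?thesis unfolding wass_def cost_def by simp
qed

lemma Pp_D: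
  assumes "\<mu> \<in> Pp p"
  shows "prob_space \<mu>" "sets \<mu> = sets borel"
  using assms by (auto simp: Pp_def)

section \<open>Moments of measures and of their couplings\<close>

lemma nn_integral_powr_add_le:
  fixes u v :: "'b \<Rightarrow> real"
  assumes [measurable]: "u \<in> borel_measurable M" "v \<in> borel_measurable M" "w \<in> borel_measurable M"
    and "\<And>x. 0 \<le> u x" "\<And>x. 0 \<le> v x" "\<And>x. 0 \<le> w x" "\<And>x. w x \<le> u x + v x" "p > 0"
  shows "(\<integral>\<^sup>+x. ennreal (w x powr p) \<partial>M) \<le>
    ennreal (2 powr p) * ((\<integral>\<^sup>+x. ennreal (u x powr p) \<partial>M) + (\<integral>\<^sup>+x. ennreal (v x powr p) \<partial>M))"
proof -
  have "ennreal (w x powr p) \<le> ennreal (2 powr p) * (ennreal (u x powr p) + ennreal (v x powr p))" for x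
  proof -
    have "w x powr p \<le> (u x + v x) powr p" using assms by (intro powr_mono2) auto
    also have "\<dots> \<le> 2 powr p * (u x powr p + v x powr p)" by (rule powr_add_le) (use assms in auto)
    finally have "ennreal (w x powr p) \<le> ennreal (2 powr p * (u x powr p + v x powr p))" by (rule ennreal_leI)
    thus ?thesis by (simp add: ennreal_mult)
  qed
  hence "(\<integral>\<^sup>+x. ennreal (w x powr p) \<partial>M) \<le> (\<integral>\<^sup>+x. ennreal (2 powr p) * (ennreal (u x powr p) + ennreal (v x powr p)) \<partial>M)"
    by (rule nn_integral_mono)
  thus ?thesis by (simp add: nn_integral_cmult nn_integral_add)
qed

lemma Pp_moment:
  fixes \<mu> :: "'a::{metric_space,second_countable_topology} measure"
  assumes "\<mu> \<in> Pp p" "p > 0"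
  shows "(\<integral>\<^sup>+ x. ennreal (dist a x powr p) \<partial>\<mu>) < \<infinity>"
proof -
  obtain x0 where x0: "(\<integral>\<^sup>+ x. ennreal (dist x0 x powr p) \<partial>\<mu>) < \<infinity>" using assms by (auto simp: Pp_def)
  interpret prob_space \<mu> using Pp_D[OF assms(1)] by simp
  have [measurable_cong]: "sets \<mu> = sets borel" using Pp_D[OF assms(1)] by simp
  have "(\<integral>\<^sup>+ x. ennreal (dist a x powr p) \<partial>\<mu>) \<le> ennreal (2 powr p) * ((\<integral>\<^sup>+x. ennreal (dist a x0 powr p) \<partial>\<mu>) + (\<integral>\<^sup>+x. ennreal (dist x0 x powr p) \<partial>\<mu>))"
    by (rule nn_integral_powr_add_le) (use assms in \<open>auto simp: dist_triangle\<close>)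
  also have "\<dots> < \<infinity>" using x0 by (simp add: emeasure_space_1 ennreal_mult_less_top)
  finally show ?thesis .
qed

lemma PpI:
  assumes "prob_space \<mu>" "sets \<mu> = sets borel" "(\<integral>\<^sup>+ x. ennreal (dist a x powr p) \<partial>\<mu>) < \<infinity>"
  shows "\<mu> \<in> Pp p"
  using assms by (auto simp: Pp_def)

lemma prod_moment:
  fixes \<pi> :: "('a::{metric_space,second_countable_topology} \<times> 'b::{metric_space,second_countable_topology}) measure"
  assumes [measurable_cong]: "sets \<pi> = sets borel" and p: "p > 0"
  shows "(\<integral>\<^sup>+ z. ennreal (dist (a, b) z powr p) \<partial>\<pi>) \<le> ennreal (2 powr p) *
    ((\<integral>\<^sup>+ x. ennreal (dist a x powr p) \<partial>distr \<pi> borel fst) + (\<integral>\<^sup>+ x. ennreal (dist b x powr p) \<partial>distr \<pi> borel snd))"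
proof -
  have d: "dist (a, b) z \<le> dist a (fst z) + dist b (snd z)" for z
    unfolding dist_prod_def by (simp add: sqrt_sum_squares_le_sum)
  have "(\<integral>\<^sup>+ z. ennreal (dist (a, b) z powr p) \<partial>\<pi>) \<le> ennreal (2 powr p) *
    ((\<integral>\<^sup>+ z. ennreal (dist a (fst z) powr p) \<partial>\<pi>) + (\<integral>\<^sup>+ z. ennreal (dist b (snd z) powr p) \<partial>\<pi>))"
    by (rule nn_integral_powr_add_le) (use p d in auto)
  thus ?thesis by (simp add: nn_integral_distr)
qed

lemma coupling_moment:
  fixes \<mu> \<nu> :: "'a::{metric_space,second_countable_topology} measure"
  assumes "\<mu> \<in> Pp p" "\<nu> \<in> Pp p" "p > 0"
  shows "\<exists>C<\<infinity>. \<forall>\<pi>\<in>couplings \<mu> \<nu>. (\<integral>\<^sup>+ z. ennreal (dist (a, a) z powr p) \<partial>\<pi>) \<le> C"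
proof (intro exI conjI ballI)
  let ?C = "ennreal (2 powr p) * ((\<integral>\<^sup>+ x. ennreal (dist a x powr p) \<partial>\<mu>) + (\<integral>\<^sup>+ x. ennreal (dist a x powr p) \<partial>\<nu>))"
  show "?C < \<infinity>" using Pp_moment[OF assms(1,3)] Pp_moment[OF assms(2,3)] by (simp add: ennreal_mult_less_top)
  fix \<pi> assume "\<pi> \<in> couplings \<mu> \<nu>"
  thus "(\<integral>\<^sup>+ z. ennreal (dist (a, a) z powr p) \<partial>\<pi>) \<le> ?C"
    using prod_moment[of \<pi> p a a] assms(3) by (simp add: couplings_def)
qed

lemma coupling_cost_finite:
  fixes \<mu> \<nu> :: "'a::{metric_space,second_countable_topology} measure"
  assumes \<mu>: "\<mu> \<in> Pp p" and \<nu>: "\<nu> \<in> Pp p" and p: "p > 0" and \<pi>: "\<pi> \<in> couplings \<mu> \<nu>"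
  shows "cost p \<pi> < \<infinity>"
proof -
  obtain a :: 'a where True by simp
  have [measurable_cong]: "sets \<pi> = sets borel" and m: "distr \<pi> borel fst = \<mu>" "distr \<pi> borel snd = \<nu>"
    using \<pi> by (auto simp: couplings_def)
  have "cost p \<pi> \<le> ennreal (2 powr p) * ((\<integral>\<^sup>+ z. ennreal (dist a (fst z) powr p) \<partial>\<pi>) + (\<integral>\<^sup>+ z. ennreal (dist a (snd z) powr p) \<partial>\<pi>))"
    unfolding cost_def by (rule nn_integral_powr_add_le) (use p in \<open>auto simp: dist_triangle3 dist_commute\<close>)
  also have "(\<integral>\<^sup>+ z. ennreal (dist a (fst z) powr p) \<partial>\<pi>) = (\<integral>\<^sup>+ x. ennreal (dist a x powr p) \<partial>\<mu>)"
    unfolding m(1)[symmetric] by (simp add: nn_integral_distr)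
  also have "(\<integral>\<^sup>+ z. ennreal (dist a (snd z) powr p) \<partial>\<pi>) = (\<integral>\<^sup>+ x. ennreal (dist a x powr p) \<partial>\<nu>)"
    unfolding m(2)[symmetric] by (simp add: nn_integral_distr)
  also have "ennreal (2 powr p) * ((\<integral>\<^sup>+ x. ennreal (dist a x powr p) \<partial>\<mu>) + (\<integral>\<^sup>+ x. ennreal (dist a x powr p) \<partial>\<nu>)) < \<infinity>"
    using Pp_moment[OF \<mu> p] Pp_moment[OF \<nu> p] by (simp add: ennreal_mult_less_top)
  finally show ?thesis .
qed

lemma couplings_nonempty:
  fixes \<mu> \<nu> :: "'a::{metric_space,second_countable_topology} measure"
  assumes "prob_space \<mu>" "prob_space \<nu>" "sets \<mu> = sets borel" "sets \<nu> = sets borel"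
  shows "couplings \<mu> \<nu> \<noteq> {}"
proof -
  interpret m: prob_space \<mu> by fact
  interpret n: prob_space \<nu> by fact
  interpret pair_prob_space \<mu> \<nu> ..
  have [measurable_cong]: "sets \<mu> = sets borel" "sets \<nu> = sets borel" by fact+
  have "distr (\<mu> \<Otimes>\<^sub>M \<nu>) borel (\<lambda>w. (fst w, snd w)) \<in> couplings (distr (\<mu> \<Otimes>\<^sub>M \<nu>) borel fst) (distr (\<mu> \<Otimes>\<^sub>M \<nu>) borel snd)"
    by (rule couplings_pair[OF prob_space_axioms]) measurable
  moreover have "distr (\<mu> \<Otimes>\<^sub>M \<nu>) borel fst = \<mu>"
  proof -
    have "distr (\<mu> \<Otimes>\<^sub>M \<nu>) borel fst = distr (\<mu> \<Otimes>\<^sub>M \<nu>) \<mu> fst" by (rule distr_cong) (simp_all add: assms)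
    thus ?thesis by (simp add: n.distr_pair_fst)
  qed
  moreover have "distr (\<mu> \<Otimes>\<^sub>M \<nu>) borel snd = \<nu>"
  proof (rule measure_eqI)
    fix A assume "A \<in> sets (distr (\<mu> \<Otimes>\<^sub>M \<nu>) borel snd)"
    hence [measurable]: "A \<in> sets borel" by simp
    have "emeasure (distr (\<mu> \<Otimes>\<^sub>M \<nu>) borel snd) A = emeasure (\<mu> \<Otimes>\<^sub>M \<nu>) (space \<mu> \<times> A)"
      using sets.sets_into_space[of A \<nu>] assms sets_eq_imp_space_eq[OF assms(4)]
      by (subst emeasure_distr) (auto simp: space_pair_measure intro!: arg_cong[where f="emeasure _"])
    also have "\<dots> = emeasure \<nu> A" using assms by (subst n.emeasure_pair_measure_Times) (auto simp: m.emeasure_space_1)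
    finally show "emeasure (distr (\<mu> \<Otimes>\<^sub>M \<nu>) borel snd) A = emeasure \<nu> A" .
  qed (simp add: assms)
  ultimately show ?thesis by auto
qed

lemma distr_of_pair:
  fixes X :: "'w \<Rightarrow> 'a::{metric_space,second_countable_topology}" and Y :: "'w \<Rightarrow> 'b::{metric_space,second_countable_topology}"
  assumes [measurable]: "X \<in> N \<rightarrow>\<^sub>M borel" "Y \<in> N \<rightarrow>\<^sub>M borel"
    and eq: "distr N borel (\<lambda>w. (X w, Y w)) = \<pi>"
  shows "distr N borel X = distr \<pi> borel fst" "distr N borel Y = distr \<pi> borel snd"
  unfolding eq[symmetric] by (subst distr_distr; simp add: comp_def)+

subsection \<open>Optimal couplings\<close>

text \<open>The direct method: the marginals bound the moments of every coupling, so a minimising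
  sequence has an almost surely convergent representation. Its limit keeps the marginals, and Fatou
  gives lower semicontinuity of the cost.\<close>

theorem optimal_coupling_exists:
  fixes \<mu> \<nu> :: "'a::{complete_space,second_countable_topology} measure"
  assumes pr: "proper_space TYPE('a)" and \<mu>: "\<mu> \<in> Pp p" and \<nu>: "\<nu> \<in> Pp p" and p: "p > 0"
  shows "\<exists>\<pi>\<in>couplings \<mu> \<nu>. cost p \<pi> = ennreal (wass p \<mu> \<nu> powr p)"
proof -
  obtain a :: 'a where True by simp
  define I where "I = (INF \<pi> \<in> couplings \<mu> \<nu>. cost p \<pi>)"
  have ne: "couplings \<mu> \<nu> \<noteq> {}" using couplings_nonempty Pp_D[OF \<mu>] Pp_D[OF \<nu>] by blast
  then obtain \<pi>0 where \<pi>0: "\<pi>0 \<in> couplings \<mu> \<nu>" by auto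
  have "I \<le> cost p \<pi>0" unfolding I_def by (rule INF_lower) fact
  \<comment> \<open>\<open>wass\<close> passes through \<open>enn2real\<close>, from which only a
    finite infimum can be recovered.\<close>
  hence fin: "I < \<infinity>" using coupling_cost_finite[OF \<mu> \<nu> p \<pi>0] by (rule le_less_trans)
  hence IW: "I = ennreal (wass p \<mu> \<nu> powr p)"
    using p unfolding wass_def I_def[unfolded cost_def, symmetric]
    by (cases I) (auto simp: powr_powr)
  obtain s where s: "range s \<subseteq> cost p ` couplings \<mu> \<nu>" "s \<longlonglongrightarrow> I"
    unfolding I_def using Inf_as_limit[of "cost p ` couplings \<mu> \<nu>"] ne by auto
  hence "\<forall>n. \<exists>\<pi>\<in>couplings \<mu> \<nu>. s n = cost p \<pi>" by auto
  then obtain P where P: "\<And>n. P n \<in> couplings \<mu> \<nu>" "\<And>n. s n = cost p (P n)" by metis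
  have PP: "prob_space (P n)" "sets (P n) = sets borel" for n using P(1)[of n] by (auto simp: couplings_def)
  obtain C where C: "C < \<infinity>" "\<And>\<pi>. \<pi> \<in> couplings \<mu> \<nu> \<Longrightarrow> (\<integral>\<^sup>+ z. ennreal (dist (a, a) z powr p) \<partial>\<pi>) \<le> C"
    using coupling_moment[OF \<mu> \<nu> p, of a] by blast
  obtain r and \<Omega> :: "real measure" and X Y where r: "strict_mono (r::nat\<Rightarrow>nat)" and \<Omega>: "prob_space \<Omega>"
     and [measurable]: "\<And>n. X n \<in> \<Omega> \<rightarrow>\<^sub>M borel" and X: "\<And>n. distr \<Omega> borel (X n) = P (r n)"
     and [measurable]: "Y \<in> \<Omega> \<rightarrow>\<^sub>M borel" and lim: "AE \<omega> in \<Omega>. (\<lambda>n. X n \<omega>) \<longlonglongrightarrow> Y \<omega>"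
    by (rule prokhorov_skorohod[where M=P, OF proper_space_prod[OF pr pr] PP p C(1) C(2)[OF P(1)]]) blast
  have flim: "AE w in \<Omega>. (\<lambda>n. fst (X n w)) \<longlonglongrightarrow> fst (Y w)"
    using lim by eventually_elim (rule tendsto_fst)
  have slim: "AE w in \<Omega>. (\<lambda>n. snd (X n w)) \<longlonglongrightarrow> snd (Y w)"
    using lim by eventually_elim (rule tendsto_snd)
  have "distr \<Omega> borel (\<lambda>w. fst (X n w)) = \<mu>" for n
  proof -
    have "distr \<Omega> borel (\<lambda>w. fst (X n w)) = distr (P (r n)) borel fst"
      unfolding X[symmetric] by (subst distr_distr) (auto simp: comp_def)
    thus ?thesis using P(1)[of "r n"] by (simp add: couplings_def)
  qed
  hence fY: "distr \<Omega> borel (\<lambda>w. fst (Y w)) = \<mu>"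
    by (intro distr_AE_limit_const[OF \<Omega> _ _ flim]) simp_all
  have "distr \<Omega> borel (\<lambda>w. snd (X n w)) = \<nu>" for n
  proof -
    have "distr \<Omega> borel (\<lambda>w. snd (X n w)) = distr (P (r n)) borel snd"
      unfolding X[symmetric] by (subst distr_distr) (auto simp: comp_def)
    thus ?thesis using P(1)[of "r n"] by (simp add: couplings_def)
  qed
  hence sY: "distr \<Omega> borel (\<lambda>w. snd (Y w)) = \<nu>"
    by (intro distr_AE_limit_const[OF \<Omega> _ _ slim]) simp_all
  define \<pi> where "\<pi> = distr \<Omega> borel (\<lambda>w. (fst (Y w), snd (Y w)))"
  have \<pi>: "\<pi> \<in> couplings \<mu> \<nu>"
    using couplings_pair[OF \<Omega>, of "\<lambda>w. fst (Y w)" "\<lambda>w. snd (Y w)"] by (simp add: \<pi>_def fY sY)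
  have "cost p \<pi> = (\<integral>\<^sup>+w. ennreal (dist (fst (Y w)) (snd (Y w)) powr p) \<partial>\<Omega>)"
    unfolding \<pi>_def by (rule cost_pair) measurable
  also have "\<dots> = (\<integral>\<^sup>+w. liminf (\<lambda>n. ennreal (dist (fst (X n w)) (snd (X n w)) powr p)) \<partial>\<Omega>)"
  proof (rule nn_integral_cong_AE)
    show "AE w in \<Omega>. ennreal (dist (fst (Y w)) (snd (Y w)) powr p) = liminf (\<lambda>n. ennreal (dist (fst (X n w)) (snd (X n w)) powr p))"
      using lim
    proof eventually_elim
      case (elim w)
      have "(\<lambda>n. ennreal (dist (fst (X n w)) (snd (X n w)) powr p)) \<longlonglongrightarrow> ennreal (dist (fst (Y w)) (snd (Y w)) powr p)"
        using elim p by (intro tendsto_ennrealI tendsto_powr' tendsto_dist tendsto_fst tendsto_snd tendsto_const) auto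
      thus ?case by (intro lim_imp_Liminf[symmetric]) auto
    qed
  qed
  also have "\<dots> \<le> liminf (\<lambda>n. \<integral>\<^sup>+w. ennreal (dist (fst (X n w)) (snd (X n w)) powr p) \<partial>\<Omega>)"
    by (rule nn_integral_liminf) measurable
  also have "\<dots> = liminf (\<lambda>n. s (r n))"
    unfolding P cost_def X[symmetric] by (subst nn_integral_distr) auto
  also have "\<dots> = I"
    using LIMSEQ_subseq_LIMSEQ[OF s(2) r] by (intro lim_imp_Liminf) (auto simp: comp_def)
  finally have "cost p \<pi> \<le> I" .
  moreover have "I \<le> cost p \<pi>" unfolding I_def by (rule INF_lower) fact
  ultimately have "cost p \<pi> = I" by simp
  thus ?thesis using \<pi> IW by auto
qed

lemma coupling_cost_ge:
  fixes \<mu> \<nu> :: "'a::{metric_space,second_countable_topology} measure"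
  assumes \<mu>: "\<mu> \<in> Pp p" and \<nu>: "\<nu> \<in> Pp p" and p: "p > 0" and \<pi>: "\<pi> \<in> couplings \<mu> \<nu>"
  shows "ennreal (wass p \<mu> \<nu> powr p) \<le> cost p \<pi>"
proof -
  have fin: "cost p \<pi> < \<infinity>" by (rule coupling_cost_finite[OF assms])
  define c where "c = enn2real (cost p \<pi>) powr (1/p)"
  have c: "c \<ge> 0" "ennreal (c powr p) = cost p \<pi>" using fin p by (auto simp: c_def powr_powr)
  have "wass p \<mu> \<nu> \<le> c" by (rule wass_le_cost[OF \<pi>]) (use c p in auto)
  hence "ennreal (wass p \<mu> \<nu> powr p) \<le> ennreal (c powr p)"
    using p wass_nonneg by (intro ennreal_leI powr_mono2) auto
  thus ?thesis using c by simp
qed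

subsection \<open>Gluing\<close>

text \<open>In place of a disintegration, the couplings are glued independently given the cell of a fine
  partition that contains the middle coordinate; compactness then identifies the two middle coordinates.\<close>

lemma approximate_gluing:
  fixes \<pi>1 :: "('a::{metric_space,second_countable_topology} \<times> 'b::{metric_space,second_countable_topology}) measure"
    and \<pi>2 :: "('b \<times> 'c::{metric_space,second_countable_topology}) measure"
  assumes p1: "prob_space \<pi>1" "sets \<pi>1 = sets borel" and p2: "prob_space \<pi>2" "sets \<pi>2 = sets borel"
    and marg: "distr \<pi>1 borel snd = distr \<pi>2 borel fst" and ep: "ep > 0"
  shows "\<exists>\<Gamma>. prob_space \<Gamma> \<and> sets \<Gamma> = sets borel \<and> distr \<Gamma> borel fst = \<pi>1 \<and> distr \<Gamma> borel snd = \<pi>2 \<and>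
    (AE z in \<Gamma>. dist (snd (fst z)) (fst (snd z)) < ep)"
proof -
  obtain e :: "nat \<Rightarrow> 'b" and J where J_meas [measurable]: "J \<in> borel \<rightarrow>\<^sub>M count_space UNIV"
    and J: "\<And>x. dist (e (J x)) x < ep/2"
    using countable_quantizer[of "ep/2"] ep by (metis half_gt_zero)
  have [measurable]: "J -` {i} \<in> sets borel" for i using measurable_sets[OF J_meas, of "{i}"] by simp
  interpret \<pi>1: prob_space \<pi>1 by fact
  interpret \<pi>2: prob_space \<pi>2 by fact
  interpret P: pair_prob_space \<pi>1 \<pi>2 ..
  have s1[measurable_cong]: "sets \<pi>1 = sets borel" and s2[measurable_cong]: "sets \<pi>2 = sets borel" by fact+
  have sp: "sets (\<pi>1 \<Otimes>\<^sub>M \<pi>2) = sets borel"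
    using sets_pair_measure_cong[OF s1 s2] unfolding borel_prod .
  \<comment> \<open>The mass of cell i, common to both couplings because they share the middle
    marginal.\<close>
  define m where "m i = emeasure \<pi>1 {w\<in>space \<pi>1. J (snd w) = i}" for i
  have "emeasure (distr \<pi>1 borel snd) (J -` {i}) = m i" for i
    unfolding m_def by (subst emeasure_distr) (auto intro!: arg_cong[where f="emeasure _"])
  moreover have "emeasure (distr \<pi>2 borel fst) (J -` {i}) = emeasure \<pi>2 {w\<in>space \<pi>2. J (fst w) = i}" for i
    by (subst emeasure_distr) (auto intro!: arg_cong[where f="emeasure _"])
  ultimately have m2: "m i = emeasure \<pi>2 {w\<in>space \<pi>2. J (fst w) = i}" for i
    unfolding marg by metis
  have mfin: "m i \<noteq> \<infinity>" for i by (simp add: m_def)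
  have inv: "m i * inverse (m i) = 1" if "m i \<noteq> 0" for i
    using ennreal_divide_self[of "m i"] that mfin[of i] by (simp add: divide_ennreal_def less_top)
  have AE1: "AE w in \<pi>1. m (J (snd w)) \<noteq> 0"
  proof -
    have "AE w in \<pi>1. J (snd w) = i \<longrightarrow> m i \<noteq> 0" for i
    proof (cases "m i = 0")
      case True
      thus ?thesis unfolding m_def by (intro AE_I[where N="{w\<in>space \<pi>1. J (snd w) = i}"]) auto
    qed simp
    hence "AE w in \<pi>1. \<forall>i. J (snd w) = i \<longrightarrow> m i \<noteq> 0" unfolding AE_all_countable ..
    thus ?thesis by eventually_elim simp
  qed
  have AE2: "AE w in \<pi>2. m (J (fst w)) \<noteq> 0"
  proof -
    have "AE w in \<pi>2. J (fst w) = i \<longrightarrow> m i \<noteq> 0" for i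
    proof (cases "m i = 0")
      case True
      thus ?thesis unfolding m2 by (intro AE_I[where N="{w\<in>space \<pi>2. J (fst w) = i}"]) auto
    qed simp
    hence "AE w in \<pi>2. \<forall>i. J (fst w) = i \<longrightarrow> m i \<noteq> 0" unfolding AE_all_countable ..
    thus ?thesis by eventually_elim simp
  qed
  \<comment> \<open>Density of the gluing that is independent within each cell, normalised by the
    mass of the cell. On null cells \<open>inverse\<close> gives infinity; \<open>AE1\<close> and
    \<open>AE2\<close> discard them.\<close>
  define k where "k z = (if J (snd (fst z)) = J (fst (snd z)) then inverse (m (J (snd (fst z)))) else 0)"
    for z :: "('a \<times> 'b) \<times> ('b \<times> 'c)"
  have comb: "(\<lambda>z. if A z = B z then inverse (m (A z)) else 0) \<in> borel_measurable N"
    if [measurable]: "A \<in> N \<rightarrow>\<^sub>M count_space UNIV" "B \<in> N \<rightarrow>\<^sub>M count_space UNIV"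
    for A B and N :: "(('a \<times> 'b) \<times> ('b \<times> 'c)) measure"
  proof (rule measurable_If)
    show "(\<lambda>z. inverse (m (A z))) \<in> borel_measurable N" by (rule measurable_compose[OF that(1)]) simp
    have "{z \<in> space N. \<exists>i. B z = i \<and> A z = i} \<in> sets N" by measurable
    thus "{z \<in> space N. A z = B z} \<in> sets N" by simp
  qed simp
  have "k \<in> borel_measurable borel" unfolding k_def
    by (intro comb measurable_compose[OF _ J_meas] borel_measurable_continuous_onI continuous_intros)
  hence [measurable]: "k \<in> borel_measurable (\<pi>1 \<Otimes>\<^sub>M \<pi>2)" using measurable_cong_sets[OF sp refl] by blast
  define \<Gamma> where "\<Gamma> = density (\<pi>1 \<Otimes>\<^sub>M \<pi>2) k"
  have s\<Gamma>[measurable_cong]: "sets \<Gamma> = sets borel" by (simp add: \<Gamma>_def sp)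
  have fst1: "distr \<Gamma> borel fst = \<pi>1"
  proof (rule measure_eqI)
    fix E assume "E \<in> sets (distr \<Gamma> borel fst)"
    hence [measurable]: "E \<in> sets borel" by simp
    have "emeasure (distr \<Gamma> borel fst) E = (\<integral>\<^sup>+z. indicator E (fst z) \<partial>\<Gamma>)"
      by (subst nn_integral_indicator[symmetric], simp, subst nn_integral_distr) auto
    also have "\<dots> = (\<integral>\<^sup>+z. k z * indicator E (fst z) \<partial>(\<pi>1 \<Otimes>\<^sub>M \<pi>2))"
      unfolding \<Gamma>_def by (subst nn_integral_density) auto
    also have "\<dots> = (\<integral>\<^sup>+w. \<integral>\<^sup>+w'. k (w, w') * indicator E w \<partial>\<pi>2 \<partial>\<pi>1)"
      by (subst \<pi>2.nn_integral_fst[symmetric]) auto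
    also have "\<dots> = (\<integral>\<^sup>+w. indicator E w \<partial>\<pi>1)"
    proof (rule nn_integral_cong_AE, use AE1 in eventually_elim)
      case (elim w)
      have "(\<integral>\<^sup>+w'. k (w, w') * indicator E w \<partial>\<pi>2) =
        (\<integral>\<^sup>+w'. inverse (m (J (snd w))) * indicator E w * indicator {w'\<in>space \<pi>2. J (fst w') = J (snd w)} w' \<partial>\<pi>2)"
        by (intro nn_integral_cong) (auto simp: k_def indicator_def)
      also have "\<dots> = inverse (m (J (snd w))) * indicator E w * m (J (snd w))"
        by (subst nn_integral_cmult_indicator) (auto simp: m2)
      also have "\<dots> = indicator E w" using inv[OF elim] by (simp add: mult_ac)
      finally show ?case .
    qed
    also have "\<dots> = emeasure \<pi>1 E" by simp
    finally show "emeasure (distr \<Gamma> borel fst) E = emeasure \<pi>1 E" .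
  qed (simp add: s1)
  have snd2: "distr \<Gamma> borel snd = \<pi>2"
  proof (rule measure_eqI)
    fix E assume "E \<in> sets (distr \<Gamma> borel snd)"
    hence [measurable]: "E \<in> sets borel" by simp
    have "emeasure (distr \<Gamma> borel snd) E = (\<integral>\<^sup>+z. indicator E (snd z) \<partial>\<Gamma>)"
      by (subst nn_integral_indicator[symmetric], simp, subst nn_integral_distr) auto
    also have "\<dots> = (\<integral>\<^sup>+z. k z * indicator E (snd z) \<partial>(\<pi>1 \<Otimes>\<^sub>M \<pi>2))"
      unfolding \<Gamma>_def by (subst nn_integral_density) auto
    also have "\<dots> = (\<integral>\<^sup>+w'. \<integral>\<^sup>+w. k (w, w') * indicator E w' \<partial>\<pi>1 \<partial>\<pi>2)"
      by (subst P.nn_integral_snd[symmetric]) auto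
    also have "\<dots> = (\<integral>\<^sup>+w'. indicator E w' \<partial>\<pi>2)"
    proof (rule nn_integral_cong_AE, use AE2 in eventually_elim)
      case (elim w')
      have "(\<integral>\<^sup>+w. k (w, w') * indicator E w' \<partial>\<pi>1) =
        (\<integral>\<^sup>+w. inverse (m (J (fst w'))) * indicator E w' * indicator {w\<in>space \<pi>1. J (snd w) = J (fst w')} w \<partial>\<pi>1)"
        by (intro nn_integral_cong) (auto simp: k_def indicator_def)
      also have "\<dots> = inverse (m (J (fst w'))) * indicator E w' * m (J (fst w'))"
        by (subst nn_integral_cmult_indicator) (auto simp: m_def)
      also have "\<dots> = indicator E w'" using inv[OF elim] by (simp add: mult_ac)
      finally show ?case .
    qed
    also have "\<dots> = emeasure \<pi>2 E" by simp
    finally show "emeasure (distr \<Gamma> borel snd) E = emeasure \<pi>2 E" .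
  qed (simp add: s2)
  have "prob_space \<Gamma>"
  proof (rule prob_spaceI)
    have "emeasure (distr \<Gamma> borel fst) UNIV = 1" unfolding fst1 using \<pi>1.emeasure_space_1 sets_eq_imp_space_eq[OF s1] by simp
    thus "emeasure \<Gamma> (space \<Gamma>) = 1" by (subst (asm) emeasure_distr) auto
  qed
  moreover have "AE z in \<Gamma>. dist (snd (fst z)) (fst (snd z)) < ep"
    unfolding \<Gamma>_def
  proof (subst AE_density)
    have "dist (snd (fst z)) (fst (snd z)) < ep" if "k z > 0" for z
    proof -
      have "J (snd (fst z)) = J (fst (snd z))" using that by (auto simp: k_def split: if_splits)
      thus ?thesis using J[of "snd (fst z)"] J[of "fst (snd z)"]
        dist_triangle3[of "snd (fst z)" "fst (snd z)" "e (J (snd (fst z)))"] by simp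
    qed
    thus "AE z in \<pi>1 \<Otimes>\<^sub>M \<pi>2. 0 < k z \<longrightarrow> dist (snd (fst z)) (fst (snd z)) < ep" by simp
  qed simp
  ultimately show ?thesis using s\<Gamma> fst1 snd2 by blast
qed

theorem gluing:
  fixes \<pi>1 :: "('a::{complete_space,second_countable_topology} \<times> 'b::{complete_space,second_countable_topology}) measure"
    and \<pi>2 :: "('b \<times> 'c::{complete_space,second_countable_topology}) measure"
  assumes pr: "proper_space TYPE('a)" "proper_space TYPE('b)" "proper_space TYPE('c)"
    and p1: "prob_space \<pi>1" "sets \<pi>1 = sets borel" and p2: "prob_space \<pi>2" "sets \<pi>2 = sets borel"
    and marg: "distr \<pi>1 borel snd = distr \<pi>2 borel fst" and p: "p > 0"
    and m1: "(\<integral>\<^sup>+z. ennreal (dist z1 z powr p) \<partial>\<pi>1) < \<infinity>" and m2: "(\<integral>\<^sup>+z. ennreal (dist z2 z powr p) \<partial>\<pi>2) < \<infinity>"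
  shows "\<exists>(\<Omega>::real measure) X Y Z. prob_space \<Omega> \<and> X \<in> \<Omega> \<rightarrow>\<^sub>M borel \<and> Y \<in> \<Omega> \<rightarrow>\<^sub>M borel \<and> Z \<in> \<Omega> \<rightarrow>\<^sub>M borel \<and>
    distr \<Omega> borel (\<lambda>w. (X w, Y w)) = \<pi>1 \<and> distr \<Omega> borel (\<lambda>w. (Y w, Z w)) = \<pi>2"
proof -
  define Q where "Q n \<Gamma> \<longleftrightarrow> prob_space \<Gamma> \<and> sets \<Gamma> = sets borel \<and> distr \<Gamma> borel fst = \<pi>1 \<and> distr \<Gamma> borel snd = \<pi>2 \<and>
    (AE z in \<Gamma>. dist (snd (fst z)) (fst (snd z)) < inverse (real (Suc n)))" for n \<Gamma>
  have "\<exists>\<Gamma>. Q n \<Gamma>" for n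
    unfolding Q_def by (rule approximate_gluing[OF p1 p2 marg]) simp
  then obtain G where "\<And>n. Q n (G n)" by metis
  hence G: "\<And>n. prob_space (G n)" "\<And>n. sets (G n) = sets borel"
    "\<And>n. distr (G n) borel fst = \<pi>1" "\<And>n. distr (G n) borel snd = \<pi>2"
    "\<And>n. AE z in G n. dist (snd (fst z)) (fst (snd z)) < inverse (real (Suc n))"
    unfolding Q_def by auto
  let ?C = "ennreal (2 powr p) * ((\<integral>\<^sup>+z. ennreal (dist z1 z powr p) \<partial>\<pi>1) + (\<integral>\<^sup>+z. ennreal (dist z2 z powr p) \<partial>\<pi>2))"
  have C: "?C < \<infinity>" using m1 m2 by (simp add: ennreal_mult_less_top)
  \<comment> \<open>Uniform in n, since the moment of a gluing is bounded by those of its two fixed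
    marginals.\<close>
  have bd: "(\<integral>\<^sup>+z. ennreal (dist (z1, z2) z powr p) \<partial>G n) \<le> ?C" for n
    using prod_moment[OF G(2)[of n] p, of z1 z2] G(3,4)[of n] by simp
  obtain r and \<Omega> :: "real measure" and X Y where r: "strict_mono (r::nat\<Rightarrow>nat)" and \<Omega>: "prob_space \<Omega>"
     and [measurable]: "\<And>n. X n \<in> \<Omega> \<rightarrow>\<^sub>M borel" and X: "\<And>n. distr \<Omega> borel (X n) = G (r n)"
     and [measurable]: "Y \<in> \<Omega> \<rightarrow>\<^sub>M borel" and lim: "AE \<omega> in \<Omega>. (\<lambda>n. X n \<omega>) \<longlonglongrightarrow> Y \<omega>"
    by (rule prokhorov_skorohod[where M=G, OF proper_space_prod[OF proper_space_prod[OF pr(1,2)] proper_space_prod[OF pr(2,3)]] G(1,2) p C bd]) blast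
  have flim: "AE w in \<Omega>. (\<lambda>n. fst (X n w)) \<longlonglongrightarrow> fst (Y w)"
    using lim by eventually_elim (rule tendsto_fst)
  have slim: "AE w in \<Omega>. (\<lambda>n. snd (X n w)) \<longlonglongrightarrow> snd (Y w)"
    using lim by eventually_elim (rule tendsto_snd)
  have "distr \<Omega> borel (\<lambda>w. fst (X n w)) = \<pi>1" for n
    unfolding G(3)[of "r n", symmetric] X[symmetric] by (subst distr_distr) (auto simp: comp_def)
  hence fY: "distr \<Omega> borel (\<lambda>w. fst (Y w)) = \<pi>1"
    by (intro distr_AE_limit_const[OF \<Omega> _ _ flim]) simp_all
  have "distr \<Omega> borel (\<lambda>w. snd (X n w)) = \<pi>2" for n
    unfolding G(4)[of "r n", symmetric] X[symmetric] by (subst distr_distr) (auto simp: comp_def)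
  hence sY: "distr \<Omega> borel (\<lambda>w. snd (Y w)) = \<pi>2"
    by (intro distr_AE_limit_const[OF \<Omega> _ _ slim]) simp_all
  have "AE w in \<Omega>. dist (snd (fst (X n w))) (fst (snd (X n w))) < inverse (real (Suc (r n)))" for n
    using G(5)[of "r n"] unfolding X[symmetric] by (subst (asm) AE_distr_iff) auto
  hence "AE w in \<Omega>. \<forall>n. dist (snd (fst (X n w))) (fst (snd (X n w))) < inverse (real (Suc (r n)))"
    by (simp add: AE_all_countable)
  hence eq: "AE w in \<Omega>. snd (fst (Y w)) = fst (snd (Y w))"
    using lim
  proof eventually_elim
    case (elim w)
    have "dist (snd (fst (Y w))) (fst (snd (Y w))) \<le> 0"
    proof (rule LIMSEQ_le)
      show "(\<lambda>n. dist (snd (fst (X n w))) (fst (snd (X n w)))) \<longlonglongrightarrow> dist (snd (fst (Y w))) (fst (snd (Y w)))"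
        using elim by (intro tendsto_intros)
      show "(\<lambda>n. inverse (real (Suc (r n)))) \<longlonglongrightarrow> 0"
        using LIMSEQ_subseq_LIMSEQ[OF LIMSEQ_inverse_real_of_nat r] by (simp add: comp_def)
    qed (use elim in \<open>auto intro: less_imp_le\<close>)
    thus ?case by simp
  qed
  \<comment> \<open>The middle coordinate is taken from the first coupling; it almost surely equals
    that of the second, whose law is therefore unchanged.\<close>
  have "distr \<Omega> borel (\<lambda>w. (snd (fst (Y w)), snd (snd (Y w)))) = distr \<Omega> borel (\<lambda>w. snd (Y w))"
    by (rule distr_cong_AE) (use eq in \<open>auto elim!: eventually_mono simp: prod_eq_iff\<close>)
  thus ?thesis using \<Omega> fY sY
    by (intro exI[of _ \<Omega>] exI[of _ "\<lambda>w. fst (fst (Y w))"] exI[of _ "\<lambda>w. snd (fst (Y w))"]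
        exI[of _ "\<lambda>w. snd (snd (Y w))"]) auto
qed

lemma law_of_coupling:
  fixes X Y :: "'w \<Rightarrow> 'a::{metric_space,second_countable_topology}"
  assumes "X \<in> \<Omega> \<rightarrow>\<^sub>M borel" "Y \<in> \<Omega> \<rightarrow>\<^sub>M borel"
    and "distr \<Omega> borel (\<lambda>w. (X w, Y w)) \<in> couplings \<mu> \<nu>"
  shows "distr \<Omega> borel X = \<mu>" "distr \<Omega> borel Y = \<nu>"
  using distr_of_pair[OF assms(1,2) refl] assms(3) by (auto simp: couplings_def)

lemma gluing_couplings:
  fixes \<mu>1 \<mu>2 \<mu>3 :: "'a::{complete_space,second_countable_topology} measure"
  assumes pr: "proper_space TYPE('a)" and p: "p > 0"
    and \<mu>: "\<mu>1 \<in> Pp p" "\<mu>2 \<in> Pp p" "\<mu>3 \<in> Pp p" and \<pi>: "\<pi>1 \<in> couplings \<mu>1 \<mu>2" "\<pi>2 \<in> couplings \<mu>2 \<mu>3"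
  shows "\<exists>(\<Omega>::real measure) X Y Z. prob_space \<Omega> \<and> X \<in> \<Omega> \<rightarrow>\<^sub>M borel \<and> Y \<in> \<Omega> \<rightarrow>\<^sub>M borel \<and> Z \<in> \<Omega> \<rightarrow>\<^sub>M borel \<and>
    distr \<Omega> borel (\<lambda>w. (X w, Y w)) = \<pi>1 \<and> distr \<Omega> borel (\<lambda>w. (Y w, Z w)) = \<pi>2"
proof -
  obtain a :: 'a where True by simp
  have "(\<integral>\<^sup>+z. ennreal (dist (a,a) z powr p) \<partial>\<pi>1) < \<infinity>"
    using coupling_moment[OF \<mu>(1,2) p, of a] \<pi>(1) by (auto intro: le_less_trans)
  moreover have "(\<integral>\<^sup>+z. ennreal (dist (a,a) z powr p) \<partial>\<pi>2) < \<infinity>"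
    using coupling_moment[OF \<mu>(2,3) p, of a] \<pi>(2) by (auto intro: le_less_trans)
  ultimately show ?thesis using \<pi> by (intro gluing[OF pr pr pr _ _ _ _ _ p]) (auto simp: couplings_def)
qed

subsection \<open>The Wasserstein metric\<close>

lemma wass_self:
  fixes \<mu> :: "'a::{metric_space,second_countable_topology} measure"
  assumes "\<mu> \<in> Pp p" "p > 0"
  shows "wass p \<mu> \<mu> = 0"
proof -
  have [measurable_cong]: "sets \<mu> = sets borel" using Pp_D[OF assms(1)] by simp
  have "distr \<mu> borel (\<lambda>x. x) = \<mu>" by (rule distr_id2) (simp add: Pp_D[OF assms(1)])
  hence "wass p \<mu> \<mu> \<le> 0"
    using wass_le_rv[of \<mu> "\<lambda>x. x" "\<lambda>x. x" p 0] Pp_D[OF assms(1)] assms(2) by simp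
  thus ?thesis using wass_nonneg[of p \<mu> \<mu>] by simp
qed

text \<open>An optimal coupling of zero cost lives on the diagonal, where the two projections
  agree.\<close>

lemma wass_eq_0_imp_eq:
  fixes \<mu> \<nu> :: "'a::{complete_space,second_countable_topology} measure"
  assumes pr: "proper_space TYPE('a)" and \<mu>: "\<mu> \<in> Pp p" and \<nu>: "\<nu> \<in> Pp p" and p: "p > 0"
    and 0: "wass p \<mu> \<nu> = 0"
  shows "\<mu> = \<nu>"
proof -
  obtain \<pi> where \<pi>: "\<pi> \<in> couplings \<mu> \<nu>" "cost p \<pi> = ennreal (wass p \<mu> \<nu> powr p)"
    using optimal_coupling_exists[OF pr \<mu> \<nu> p] by blast
  have [measurable_cong]: "sets \<pi> = sets borel" using \<pi> by (simp add: couplings_def)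
  have "cost p \<pi> = 0" using \<pi> 0 by simp
  hence "AE z in \<pi>. ennreal (dist (fst z) (snd z) powr p) = 0"
    unfolding cost_def by (subst (asm) nn_integral_0_iff_AE) auto
  hence "AE z in \<pi>. fst z = snd z" by eventually_elim (auto simp: ennreal_eq_0_iff)
  hence "distr \<pi> borel fst = distr \<pi> borel snd" by (intro distr_cong_AE) auto
  moreover have "distr \<pi> borel fst = \<mu>" "distr \<pi> borel snd = \<nu>" using \<pi> by (simp_all add: couplings_def)
  ultimately show ?thesis by metis
qed

lemma coupling_cost_rv_ge:
  fixes X Y :: "'w \<Rightarrow> 'a::{metric_space,second_countable_topology}"
  assumes "prob_space \<Omega>" "X \<in> \<Omega> \<rightarrow>\<^sub>M borel" "Y \<in> \<Omega> \<rightarrow>\<^sub>M borel"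
    and "distr \<Omega> borel X \<in> Pp p" "distr \<Omega> borel Y \<in> Pp p" "p > 0"
  shows "ennreal (wass p (distr \<Omega> borel X) (distr \<Omega> borel Y) powr p) \<le> (\<integral>\<^sup>+w. ennreal (dist (X w) (Y w) powr p) \<partial>\<Omega>)"
  using coupling_cost_ge[OF assms(4,5,6) couplings_pair[OF assms(1-3)]] cost_pair[OF assms(2,3)] by simp

lemma wass_triangle:
  fixes \<mu>1 \<mu>2 \<mu>3 :: "'a::{complete_space,second_countable_topology} measure"
  assumes pr: "proper_space TYPE('a)" and p: "p > 1"
    and \<mu>: "\<mu>1 \<in> Pp p" "\<mu>2 \<in> Pp p" "\<mu>3 \<in> Pp p"
  shows "wass p \<mu>1 \<mu>3 \<le> wass p \<mu>1 \<mu>2 + wass p \<mu>2 \<mu>3"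
proof (rule field_le_epsilon)
  fix ep :: real assume ep: "ep > 0"
  have p0: "p > 0" using p by simp
  obtain \<pi>1 where \<pi>1: "\<pi>1 \<in> couplings \<mu>1 \<mu>2" "cost p \<pi>1 = ennreal (wass p \<mu>1 \<mu>2 powr p)"
    using optimal_coupling_exists[OF pr \<mu>(1,2) p0] by blast
  obtain \<pi>2 where \<pi>2: "\<pi>2 \<in> couplings \<mu>2 \<mu>3" "cost p \<pi>2 = ennreal (wass p \<mu>2 \<mu>3 powr p)"
    using optimal_coupling_exists[OF pr \<mu>(2,3) p0] by blast
  obtain \<Omega> :: "real measure" and X Y Z where \<Omega>: "prob_space \<Omega>"
    and [measurable]: "X \<in> \<Omega> \<rightarrow>\<^sub>M borel" "Y \<in> \<Omega> \<rightarrow>\<^sub>M borel" "Z \<in> \<Omega> \<rightarrow>\<^sub>M borel"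
    and d: "distr \<Omega> borel (\<lambda>w. (X w, Y w)) = \<pi>1" "distr \<Omega> borel (\<lambda>w. (Y w, Z w)) = \<pi>2"
    using gluing_couplings[OF pr p0 \<mu> \<pi>1(1) \<pi>2(1)] by auto
  have law: "distr \<Omega> borel X = \<mu>1" "distr \<Omega> borel Z = \<mu>3"
    by (rule law_of_coupling(1)[of X \<Omega> Y \<mu>1 \<mu>2], simp_all add: d \<pi>1)
      (rule law_of_coupling(2)[of Y \<Omega> Z \<mu>2 \<mu>3], simp_all add: d \<pi>2)
  \<comment> \<open>The added ep/2 keeps both bounds positive, as \<open>minkowski_powr\<close>
    demands, even when a distance vanishes.\<close>
  define a where "a = wass p \<mu>1 \<mu>2 + ep/2"
  define b where "b = wass p \<mu>2 \<mu>3 + ep/2"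
  have ab: "a > 0" "b > 0" using ep wass_nonneg[of p \<mu>1 \<mu>2] wass_nonneg[of p \<mu>2 \<mu>3] by (auto simp: a_def b_def)
  have "(\<integral>\<^sup>+w. ennreal (dist (X w) (Y w) powr p) \<partial>\<Omega>) = ennreal (wass p \<mu>1 \<mu>2 powr p)"
    using \<pi>1(2) d(1) cost_pair[of X \<Omega> Y p] by simp
  also have "\<dots> \<le> ennreal (a powr p)"
    using p ep wass_nonneg by (intro ennreal_leI powr_mono2) (auto simp: a_def)
  finally have A: "(\<integral>\<^sup>+w. ennreal (dist (X w) (Y w) powr p) \<partial>\<Omega>) \<le> ennreal (a powr p)" .
  have "(\<integral>\<^sup>+w. ennreal (dist (Y w) (Z w) powr p) \<partial>\<Omega>) = ennreal (wass p \<mu>2 \<mu>3 powr p)"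
    using \<pi>2(2) d(2) cost_pair[of Y \<Omega> Z p] by simp
  also have "\<dots> \<le> ennreal (b powr p)"
    using p ep wass_nonneg by (intro ennreal_leI powr_mono2) (auto simp: b_def)
  finally have B: "(\<integral>\<^sup>+w. ennreal (dist (Y w) (Z w) powr p) \<partial>\<Omega>) \<le> ennreal (b powr p)" .
  have "(\<integral>\<^sup>+w. ennreal (dist (X w) (Z w) powr p) \<partial>\<Omega>) \<le> ennreal ((a + b) powr p)"
    by (rule minkowski_powr(1)[OF _ _ _ _ _ _ _ p ab A B]) (auto simp: dist_triangle)
  hence "wass p (distr \<Omega> borel X) (distr \<Omega> borel Z) \<le> a + b"
    using ab p by (intro wass_le_rv[OF \<Omega>]) auto
  thus "wass p \<mu>1 \<mu>3 \<le> wass p \<mu>1 \<mu>2 + wass p \<mu>2 \<mu>3 + ep" unfolding law by (simp add: a_def b_def)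
qed

text \<open>Equality in Minkowski's inequality makes every gluing of optimal couplings along a geodesic
  consist of collinear points, dividing the segment in the same ratio.\<close>

lemma wass_collinear:
  fixes X Y Z :: "'w \<Rightarrow> 'a::{metric_space,second_countable_topology}"
  assumes \<Omega>: "prob_space \<Omega>" and [measurable]: "X \<in> \<Omega> \<rightarrow>\<^sub>M borel" "Y \<in> \<Omega> \<rightarrow>\<^sub>M borel" "Z \<in> \<Omega> \<rightarrow>\<^sub>M borel"
    and P: "distr \<Omega> borel X \<in> Pp p" "distr \<Omega> borel Z \<in> Pp p" and p: "p > 1"
    and a: "a > 0" "(\<integral>\<^sup>+w. ennreal (dist (X w) (Y w) powr p) \<partial>\<Omega>) = ennreal (a powr p)"
    and b: "b > 0" "(\<integral>\<^sup>+w. ennreal (dist (Y w) (Z w) powr p) \<partial>\<Omega>) = ennreal (b powr p)"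
    and ab: "a + b \<le> wass p (distr \<Omega> borel X) (distr \<Omega> borel Z)"
  shows "AE w in \<Omega>. dist (X w) (Z w) = dist (X w) (Y w) + dist (Y w) (Z w) \<and>
    b * dist (X w) (Y w) = a * dist (Y w) (Z w)"
proof (rule minkowski_powr(2)[where p=p and w="\<lambda>w. dist (X w) (Z w)"])
  have "ennreal ((a + b) powr p) \<le> ennreal (wass p (distr \<Omega> borel X) (distr \<Omega> borel Z) powr p)"
    using a b ab p by (intro ennreal_leI powr_mono2) auto
  also have "\<dots> \<le> (\<integral>\<^sup>+w. ennreal (dist (X w) (Z w) powr p) \<partial>\<Omega>)"
    by (rule coupling_cost_rv_ge[OF \<Omega> _ _ P]) (use p in auto)
  finally show "ennreal ((a + b) powr p) \<le> (\<integral>\<^sup>+w. ennreal (dist (X w) (Z w) powr p) \<partial>\<Omega>)" .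
qed (use a b p in \<open>auto simp: dist_triangle\<close>)

lemma wass_tendsto:
  fixes x y :: "nat \<Rightarrow> 'a::{complete_space,second_countable_topology} measure"
  assumes pr: "proper_space TYPE('a)" and p: "p > 1"
    and P: "\<And>n. x n \<in> Pp p" "\<And>n. y n \<in> Pp p" "x' \<in> Pp p" "y' \<in> Pp p"
    and x: "(\<lambda>n. wass p (x n) x') \<longlonglongrightarrow> 0" and y: "(\<lambda>n. wass p (y n) y') \<longlonglongrightarrow> 0"
  shows "(\<lambda>n. wass p (x n) (y n)) \<longlonglongrightarrow> wass p x' y'"
proof (rule Lim_transform_bound[where g="\<lambda>n. wass p (x n) x' + wass p (y n) y'", THEN LIM_zero_cancel])
  show "(\<lambda>n. wass p (x n) x' + wass p (y n) y') \<longlonglongrightarrow> 0" using tendsto_add[OF x y] by simp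
  have bd: "\<bar>wass p (x n) (y n) - wass p x' y'\<bar> \<le> wass p (x n) x' + wass p (y n) y'" for n
    using wass_triangle[OF pr p P(1)[of n] P(3) P(2)[of n]] wass_triangle[OF pr p P(3,4) P(2)[of n]]
      wass_triangle[OF pr p P(3) P(1)[of n] P(4)] wass_triangle[OF pr p P(1)[of n] P(2)[of n] P(4)]
      wass_commute[of p "x n" x'] wass_commute[of p "y n" y'] by linarith
  show "\<forall>\<^sub>F n in sequentially. norm (wass p (x n) (y n) - wass p x' y') \<le> norm (wass p (x n) x' + wass p (y n) y')"
    unfolding real_norm_def by (intro always_eventually allI order_trans[OF bd abs_ge_self])
qed

subsection \<open>Uniform integrability and compactness\<close>

text \<open>The integrand beyond R of the p-th moment: uniformly small integrals of it express
  uniform integrability of the p-th powers.\<close>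

definition tail :: "real \<Rightarrow> real \<Rightarrow> real \<Rightarrow> ennreal" where
  "tail p R v = (if v > R then ennreal (v powr p) else 0)"

lemma tail_measurable [measurable (raw)]:
  assumes [measurable]: "f \<in> borel_measurable M"
  shows "(\<lambda>x. tail p R (f x)) \<in> borel_measurable M"
  unfolding tail_def by measurable

lemma tail_mono: "0 \<le> u \<Longrightarrow> u \<le> v \<Longrightarrow> p > 0 \<Longrightarrow> tail p R u \<le> tail p R v"
  by (auto simp: tail_def intro!: ennreal_leI powr_mono2)

lemma tail_antimono: "R \<le> R' \<Longrightarrow> tail p R' v \<le> tail p R v"
  by (auto simp: tail_def)

lemma powr_le_tail:
  "0 \<le> v \<Longrightarrow> 0 \<le> R \<Longrightarrow> p > 0 \<Longrightarrow> ennreal (v powr p) \<le> ennreal (R powr p) + tail p R v"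
  by (auto simp: tail_def add_increasing intro!: ennreal_leI powr_mono2)

text \<open>If w exceeds 2cR, then the larger of u and v exceeds R, and w is at most 2c times that
  one; so the tail of w is charged to a single tail.\<close>

lemma tail_sum:
  assumes uv: "0 \<le> u" "0 \<le> v" and w: "0 \<le> w" "w \<le> c * (u + v)" and c: "c > 0" and p: "p > 0"
  shows "tail p (2 * c * R) w \<le> ennreal ((2 * c) powr p) * (tail p R u + tail p R v)"
proof (cases "w > 2 * c * R")
  case True
  have "c * (u + v) \<le> c * (2 * max u v)" using c by (intro mult_left_mono) auto
  hence w2: "w \<le> 2 * c * max u v" using w by simp
  hence "2 * c * R < 2 * c * max u v" using True by simp
  hence R: "R < max u v" using c by simp
  have "tail p (2 * c * R) w = ennreal (w powr p)" using True by (simp add: tail_def)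
  also have "\<dots> \<le> ennreal ((2 * c * max u v) powr p)" using w w2 p by (intro ennreal_leI powr_mono2) auto
  also have "\<dots> = ennreal ((2 * c) powr p) * ennreal (max u v powr p)"
    using c uv by (simp add: powr_mult ennreal_mult[symmetric])
  also have "ennreal (max u v powr p) = tail p R (max u v)" using R by (simp add: tail_def)
  also have "\<dots> \<le> tail p R u + tail p R v" by (auto simp: max_def add_increasing add_increasing2)
  finally show ?thesis by (simp add: mult_left_mono)
qed (simp add: tail_def)

lemma tail_integral_small:
  assumes [measurable]: "V \<in> borel_measurable M"
    and fin: "(\<integral>\<^sup>+x. ennreal (V x powr p) \<partial>M) < \<infinity>" and ep: "ep > 0"
  shows "\<exists>R\<ge>0. (\<integral>\<^sup>+x. tail p R (V x) \<partial>M) \<le> ennreal ep"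
proof -
  have "(\<lambda>n. \<integral>\<^sup>+x. tail p (real n) (V x) \<partial>M) \<longlonglongrightarrow> (\<integral>\<^sup>+x. 0 \<partial>M)"
  proof (rule nn_integral_dominated_convergence[where w="\<lambda>x. ennreal (V x powr p)"])
    show "AE x in M. (\<lambda>n. tail p (real n) (V x)) \<longlonglongrightarrow> 0"
    proof (rule AE_I2)
      fix x
      obtain N where "V x \<le> real N" using real_arch_simple by blast
      hence "\<forall>\<^sub>F n in sequentially. tail p (real n) (V x) = 0"
        unfolding eventually_sequentially by (intro exI[of _ N]) (auto simp: tail_def)
      thus "(\<lambda>n. tail p (real n) (V x)) \<longlonglongrightarrow> 0" by (rule tendsto_eventually)
    qed
    show "AE x in M. tail p (real j) (V x) \<le> ennreal (V x powr p)" for j by (auto simp: tail_def)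
  qed (use fin in simp_all)
  hence "\<forall>\<^sub>F n in sequentially. (\<integral>\<^sup>+x. tail p (real n) (V x) \<partial>M) < ennreal ep"
    using ep by (intro order_tendstoD(2)) auto
  then obtain n where "(\<integral>\<^sup>+x. tail p (real n) (V x) \<partial>M) < ennreal ep"
    unfolding eventually_sequentially by blast
  thus ?thesis by (intro exI[of _ "real n"]) auto
qed

text \<open>Points more than 2R apart cannot both be within R of a. The truncated first term is
  bounded, fit for dominated convergence; the rest is tails.\<close>

lemma dist_powr_split:
  fixes x y a :: "'a::metric_space"
  assumes p: "p > 0" and R: "R \<ge> 0"
  shows "ennreal (dist x y powr p) \<le> ennreal (min (dist x y powr p) ((2 * R) powr p)) +
    ennreal (2 powr p) * (tail p R (dist a x) + tail p R (dist a y))"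
proof (cases "dist x y \<le> 2 * R")
  case True
  hence "dist x y powr p \<le> (2 * R) powr p" using p by (intro powr_mono2) auto
  thus ?thesis by (simp add: min_absorb1 add_increasing2)
next
  case False
  have "dist x y \<le> 1 * (dist a x + dist a y)" by (simp add: dist_triangle3 dist_commute)
  hence "tail p (2 * 1 * R) (dist x y) \<le> ennreal ((2 * 1) powr p) * (tail p R (dist a x) + tail p R (dist a y))"
    by (intro tail_sum) (use p in auto)
  moreover have "tail p (2 * 1 * R) (dist x y) = ennreal (dist x y powr p)" using False by (simp add: tail_def)
  ultimately show ?thesis by (simp add: add_increasing)
qed

text \<open>Vitali's argument: for the almost surely convergent representatives, uniform
  integrability upgrades convergence to L^p, and their joint laws are couplings that bound
  \<open>wass\<close>.\<close>

theorem wass_compact: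
  fixes M :: "nat \<Rightarrow> 'a::{complete_space,second_countable_topology} measure"
  assumes pr: "proper_space TYPE('a)" and p: "p > 0"
    and M: "\<And>n. prob_space (M n)" "\<And>n. sets (M n) = sets borel"
    and ui: "\<And>ep. ep > 0 \<Longrightarrow> \<exists>R. \<forall>n. (\<integral>\<^sup>+x. tail p R (dist a x) \<partial>M n) \<le> ennreal ep"
  shows "\<exists>r. strict_mono (r::nat\<Rightarrow>nat) \<and> (\<exists>L\<in>Pp p. (\<lambda>n. wass p (M (r n)) L) \<longlonglongrightarrow> 0)"
proof -
  have [measurable_cong]: "sets (M n) = sets borel" for n by fact
  have ui': "\<exists>R\<ge>0. \<forall>n. (\<integral>\<^sup>+x. tail p R (dist a x) \<partial>M n) \<le> ennreal ep" if ep: "ep > 0" for ep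
  proof -
    obtain R where R: "\<And>n. (\<integral>\<^sup>+x. tail p R (dist a x) \<partial>M n) \<le> ennreal ep" using ui[OF ep] by blast
    have "(\<integral>\<^sup>+x. tail p (max 0 R) (dist a x) \<partial>M n) \<le> ennreal ep" for n
      by (rule order_trans[OF nn_integral_mono R[of n]]) (auto intro: tail_antimono)
    thus ?thesis by (intro exI[of _ "max 0 R"]) auto
  qed
  \<comment> \<open>Tails of size 1 beyond one radius already bound all p-th moments, which is what
    extraction needs.\<close>
  obtain R1 where R1: "R1 \<ge> 0" "\<And>n. (\<integral>\<^sup>+x. tail p R1 (dist a x) \<partial>M n) \<le> ennreal 1" using ui'[of 1] by auto
  define C where "C = ennreal (R1 powr p) + 1"
  have bd: "(\<integral>\<^sup>+x. ennreal (dist a x powr p) \<partial>M n) \<le> C" for n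
  proof -
    interpret prob_space "M n" by fact
    have "(\<integral>\<^sup>+x. ennreal (dist a x powr p) \<partial>M n) \<le> (\<integral>\<^sup>+x. ennreal (R1 powr p) + tail p R1 (dist a x) \<partial>M n)"
      by (intro nn_integral_mono powr_le_tail) (use R1 p in auto)
    also have "\<dots> = ennreal (R1 powr p) + (\<integral>\<^sup>+x. tail p R1 (dist a x) \<partial>M n)"
      by (subst nn_integral_add) (auto simp: emeasure_space_1)
    also have "\<dots> \<le> C" unfolding C_def using R1(2)[of n] by (intro add_left_mono) simp
    finally show ?thesis .
  qed
  have C: "C < \<infinity>" by (simp add: C_def)
  obtain r and \<Omega> :: "real measure" and X Y where r: "strict_mono (r::nat\<Rightarrow>nat)" and \<Omega>: "prob_space \<Omega>"
     and [measurable]: "\<And>n. X n \<in> \<Omega> \<rightarrow>\<^sub>M borel" and X: "\<And>n. distr \<Omega> borel (X n) = M (r n)"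
     and [measurable]: "Y \<in> \<Omega> \<rightarrow>\<^sub>M borel" and lim: "AE \<omega> in \<Omega>. (\<lambda>n. X n \<omega>) \<longlonglongrightarrow> Y \<omega>"
    by (rule prokhorov_skorohod[where M=M, OF pr M p C bd]) blast
  interpret prob_space \<Omega> by fact
  define L where "L = distr \<Omega> borel Y"
  have "(\<integral>\<^sup>+w. ennreal (dist a (Y w) powr p) \<partial>\<Omega>) = (\<integral>\<^sup>+w. liminf (\<lambda>n. ennreal (dist a (X n w) powr p)) \<partial>\<Omega>)"
  proof (rule nn_integral_cong_AE, use lim in eventually_elim)
    case (elim w)
    have "(\<lambda>n. ennreal (dist a (X n w) powr p)) \<longlonglongrightarrow> ennreal (dist a (Y w) powr p)"
      using elim p by (intro tendsto_ennrealI tendsto_powr' tendsto_dist tendsto_const) auto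
    thus ?case by (intro lim_imp_Liminf[symmetric]) auto
  qed
  also have "\<dots> \<le> liminf (\<lambda>n. \<integral>\<^sup>+w. ennreal (dist a (X n w) powr p) \<partial>\<Omega>)"
    by (rule nn_integral_liminf) measurable
  also have "\<dots> = liminf (\<lambda>n. \<integral>\<^sup>+x. ennreal (dist a x powr p) \<partial>M (r n))"
    by (simp add: X[symmetric] nn_integral_distr)
  also have "\<dots> \<le> C"
    by (rule order_trans[OF Liminf_le_Limsup]) (simp_all add: bd Limsup_bounded)
  finally have Ymom: "(\<integral>\<^sup>+w. ennreal (dist a (Y w) powr p) \<partial>\<Omega>) < \<infinity>" using C by (rule le_less_trans)
  have LP: "L \<in> Pp p"
  proof (rule PpI)
    show "(\<integral>\<^sup>+ x. ennreal (dist a x powr p) \<partial>L) < \<infinity>"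
      unfolding L_def using Ymom by (subst nn_integral_distr) auto
  qed (auto simp: L_def prob_space_distr)
  have "(\<lambda>n. wass p (M (r n)) L) \<longlonglongrightarrow> 0"
  proof (rule LIMSEQ_I)
    fix d :: real assume d: "d > 0"
    \<comment> \<open>Solves \<open>ep + 2 powr p * (ep + ep) = (d/2) powr p\<close>: one ep for the
      truncated part and one for each of the two tails. Halving d leaves a strict
      inequality.\<close>
    define ep where "ep = (d/2) powr p / (2 * 2 powr p + 1)"
    have ep: "ep > 0" using d by (simp add: ep_def add_pos_pos)
    have epd: "ep + 2 powr p * (ep + ep) = (d/2) powr p"
    proof -
      have "2 * 2 powr p + 1 \<noteq> (0::real)" using powr_gt_zero[of 2 p] by linarith
      hence "ep * (2 * 2 powr p + 1) = (d/2) powr p" unfolding ep_def by simp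
      thus ?thesis by (simp add: algebra_simps)
    qed
    obtain RM where RM: "\<And>n. (\<integral>\<^sup>+x. tail p RM (dist a x) \<partial>M n) \<le> ennreal ep" using ui'[OF ep] by blast
    obtain RY where RY: "RY \<ge> 0" "(\<integral>\<^sup>+w. tail p RY (dist a (Y w)) \<partial>\<Omega>) \<le> ennreal ep"
      using tail_integral_small[OF _ Ymom ep] by auto
    define R where "R = max RM RY"
    have R: "R \<ge> 0" using RY by (simp add: R_def)
    have tX: "(\<integral>\<^sup>+w. tail p R (dist a (X n w)) \<partial>\<Omega>) \<le> ennreal ep" for n
    proof -
      have "(\<integral>\<^sup>+w. tail p R (dist a (X n w)) \<partial>\<Omega>) \<le> (\<integral>\<^sup>+w. tail p RM (dist a (X n w)) \<partial>\<Omega>)"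
        by (intro nn_integral_mono tail_antimono) (simp add: R_def)
      also have "\<dots> = (\<integral>\<^sup>+x. tail p RM (dist a x) \<partial>M (r n))"
        unfolding X[symmetric] by (subst nn_integral_distr) auto
      finally show ?thesis using RM by (rule order_trans)
    qed
    have tY: "(\<integral>\<^sup>+w. tail p R (dist a (Y w)) \<partial>\<Omega>) \<le> ennreal ep"
      by (rule order_trans[OF nn_integral_mono RY(2)]) (auto simp: R_def intro: tail_antimono)
    have "(\<lambda>n. \<integral>\<^sup>+w. ennreal (min (dist (X n w) (Y w) powr p) ((2 * R) powr p)) \<partial>\<Omega>) \<longlonglongrightarrow> (\<integral>\<^sup>+w. 0 \<partial>\<Omega>)"
    proof (rule nn_integral_dominated_convergence[where w="\<lambda>_. ennreal ((2 * R) powr p)"])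
      show "AE w in \<Omega>. (\<lambda>n. ennreal (min (dist (X n w) (Y w) powr p) ((2 * R) powr p))) \<longlonglongrightarrow> 0"
        using lim
      proof eventually_elim
        case (elim w)
        have "(\<lambda>n. dist (X n w) (Y w) powr p) \<longlonglongrightarrow> dist (Y w) (Y w) powr p"
          using elim p by (intro tendsto_powr' tendsto_dist tendsto_const) auto
        hence "(\<lambda>n. min (dist (X n w) (Y w) powr p) ((2 * R) powr p)) \<longlonglongrightarrow> min 0 ((2 * R) powr p)"
          by (intro tendsto_min tendsto_const) simp
        from tendsto_ennrealI[OF this] show ?case by (simp add: min_absorb1)
      qed
    qed (auto simp: emeasure_space_1 intro!: ennreal_leI)
    hence "\<forall>\<^sub>F n in sequentially. (\<integral>\<^sup>+w. ennreal (min (dist (X n w) (Y w) powr p) ((2 * R) powr p)) \<partial>\<Omega>) < ennreal ep"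
      using ep by (intro order_tendstoD(2)) auto
    hence "\<forall>\<^sub>F n in sequentially. norm (wass p (M (r n)) L - 0) < d"
    proof eventually_elim
      case (elim n)
      have "(\<integral>\<^sup>+w. ennreal (dist (X n w) (Y w) powr p) \<partial>\<Omega>) \<le>
        (\<integral>\<^sup>+w. ennreal (min (dist (X n w) (Y w) powr p) ((2 * R) powr p)) +
          ennreal (2 powr p) * (tail p R (dist a (X n w)) + tail p R (dist a (Y w))) \<partial>\<Omega>)"
        by (intro nn_integral_mono dist_powr_split p R)
      also have "\<dots> = (\<integral>\<^sup>+w. ennreal (min (dist (X n w) (Y w) powr p) ((2 * R) powr p)) \<partial>\<Omega>) +
          ennreal (2 powr p) * ((\<integral>\<^sup>+w. tail p R (dist a (X n w)) \<partial>\<Omega>) + (\<integral>\<^sup>+w. tail p R (dist a (Y w)) \<partial>\<Omega>))"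
        by (simp add: nn_integral_add nn_integral_cmult)
      also have "\<dots> \<le> ennreal ep + ennreal (2 powr p) * (ennreal ep + ennreal ep)"
        using elim tX[of n] tY by (intro add_mono mult_left_mono) auto
      also have "\<dots> = ennreal ((d/2) powr p)"
        using ep by (simp add: epd[symmetric] flip: ennreal_plus ennreal_mult)
      finally have "wass p (distr \<Omega> borel (X n)) (distr \<Omega> borel Y) \<le> d/2"
        using d p by (intro wass_le_rv[OF \<Omega>]) auto
      thus ?case using d wass_nonneg[of p "M (r n)" L] by (simp add: X L_def)
    qed
    thus "\<exists>no. \<forall>n\<ge>no. norm (wass p (M (r n)) L - 0) < d" by (simp add: eventually_sequentially)
  qed
  thus ?thesis using r LP by blast
qed

lemma unif_tail_dominated:
  fixes M :: "nat \<Rightarrow> 'a::{metric_space,second_countable_topology} measure"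
  assumes M: "\<And>n. M n = distr N borel (X n)" and [measurable]: "\<And>n. X n \<in> N \<rightarrow>\<^sub>M borel" "V \<in> borel_measurable N"
    and V: "\<And>n w. dist a (X n w) \<le> V w" and fin: "(\<integral>\<^sup>+w. ennreal (V w powr p) \<partial>N) < \<infinity>" and p: "p > 0" and ep: "ep > 0"
  shows "\<exists>R. \<forall>n. (\<integral>\<^sup>+x. tail p R (dist a x) \<partial>M n) \<le> ennreal ep"
proof -
  obtain R where R: "(\<integral>\<^sup>+w. tail p R (V w) \<partial>N) \<le> ennreal ep"
    using tail_integral_small[OF _ fin ep] by auto
  have "(\<integral>\<^sup>+x. tail p R (dist a x) \<partial>M n) \<le> ennreal ep" for n
  proof -
    have "(\<integral>\<^sup>+x. tail p R (dist a x) \<partial>M n) = (\<integral>\<^sup>+w. tail p R (dist a (X n w)) \<partial>N)"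
      unfolding M by (subst nn_integral_distr) auto
    also have "\<dots> \<le> (\<integral>\<^sup>+w. tail p R (V w) \<partial>N)" by (intro nn_integral_mono tail_mono V) (use p in auto)
    finally show ?thesis using R by (rule order_trans)
  qed
  thus ?thesis by blast
qed

subsection \<open>Existence of Wasserstein geodesics\<close>

text \<open>Choosing geodesics between the representatives of countably many cells avoids any measurable selection;
  the exact geodesic appears in the limit of vanishing cell size.\<close>

lemma approx_displacement:
  fixes \<pi> :: "('a::{complete_space,second_countable_topology} \<times> 'a) measure"
  assumes geo: "geodesic_space TYPE('a)" and \<pi>: "prob_space \<pi>" "sets \<pi> = sets borel" and d: "d > 0"
  shows "\<exists>G :: real \<Rightarrow> 'a \<times> 'a \<Rightarrow> 'a. (\<forall>t. G t \<in> \<pi> \<rightarrow>\<^sub>M borel) \<and>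
    (\<forall>s t z. dist (G s z) (G t z) \<le> min 1 \<bar>s - t\<bar> * (dist (fst z) (snd z) + 2 * d)) \<and>
    (\<forall>z. dist (G 0 z) (fst z) \<le> d) \<and> (\<forall>z. dist (G 1 z) (snd z) \<le> d)"
proof -
  obtain e :: "nat \<Rightarrow> 'a \<times> 'a" and J where J[measurable]: "J \<in> borel \<rightarrow>\<^sub>M count_space UNIV"
    and e: "\<And>z. dist (e (J z)) z < d"
    using countable_quantizer[OF d] by metis
  have [measurable_cong]: "sets \<pi> = sets borel" by fact
  obtain c where c: "\<And>x y::'a. c x y 0 = x" "\<And>x y. c x y 1 = y"
    "\<And>x y s t. s \<in> {0..1} \<Longrightarrow> t \<in> {0..1} \<Longrightarrow> dist (c x y s) (c x y t) \<le> \<bar>s - t\<bar> * dist x y"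
    using geo unfolding geodesic_space_def by metis
  define h where "h t = max 0 (min 1 t)" for t :: real
  have h: "h t \<in> {0..1}" "h 0 = 0" "h 1 = 1" "\<bar>h s - h t\<bar> \<le> min 1 \<bar>s - t\<bar>" for s t by (auto simp: h_def)
  define G where "G t z = c (fst (e (J z))) (snd (e (J z))) (h t)" for t z
  have "G t \<in> \<pi> \<rightarrow>\<^sub>M borel" for t
  proof -
    have "J \<in> \<pi> \<rightarrow>\<^sub>M count_space UNIV" by measurable
    thus ?thesis unfolding G_def by (rule measurable_compose) simp
  qed
  moreover have f: "dist (fst (e (J z))) (fst z) \<le> d" and s: "dist (snd (e (J z))) (snd z) \<le> d" for z
    using e[of z] dist_fst_le[of "e (J z)" z] dist_snd_le[of "e (J z)" z] by linarith+
  moreover have "dist (G s z) (G t z) \<le> min 1 \<bar>s - t\<bar> * (dist (fst z) (snd z) + 2 * d)" for s t z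
  proof -
    have "dist (G s z) (G t z) \<le> \<bar>h s - h t\<bar> * dist (fst (e (J z))) (snd (e (J z)))"
      unfolding G_def by (intro c h)
    also have "\<dots> \<le> min 1 \<bar>s - t\<bar> * (dist (fst z) (snd z) + 2 * d)"
    proof (intro mult_mono h)
      show "dist (fst (e (J z))) (snd (e (J z))) \<le> dist (fst z) (snd z) + 2 * d"
        using f[of z] s[of z] dist_triangle[of "fst (e (J z))" "snd (e (J z))" "fst z"]
          dist_triangle[of "fst z" "snd (e (J z))" "snd z"] by (simp add: dist_commute)
    qed auto
    finally show ?thesis .
  qed
  ultimately show ?thesis by (intro exI[of _ G]) (auto simp: G_def c h)
qed

text \<open>An optimal coupling is transported along the approximate displacements. The curves of
  laws are Lipschitz up to the mesh and dominated by one integrable function, so Arzela-Ascoli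
  applies. The limit has Lipschitz constant L and joins measures at distance L, hence is a geodesic;
  the case L = 0 is split off because time is rescaled by L.\<close>

theorem wgeods_nonempty:
  fixes \<mu> \<nu> :: "'a::{complete_space,second_countable_topology} measure"
  assumes geo: "geodesic_space TYPE('a)" and pr: "proper_space TYPE('a)" and p: "p > 1"
    and \<mu>: "\<mu> \<in> Pp p" and \<nu>: "\<nu> \<in> Pp p"
  shows "\<exists>\<gamma>. \<gamma> \<in> wgeods p \<mu> \<nu>"
proof (cases "wass p \<mu> \<nu> = 0")
  case True
  have p0: "p > 0" using p by simp
  have "\<mu> = \<nu>" by (rule wass_eq_0_imp_eq[OF pr \<mu> \<nu> p0 True])
  thus ?thesis using True wass_self[OF \<mu> p0] \<mu> by (intro exI[of _ "\<lambda>_. \<mu>"]) (auto simp: wgeods_def)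
next
  case False
  define L where "L = wass p \<mu> \<nu>"
  have L: "L > 0" using False wass_nonneg[of p \<mu> \<nu>] by (simp add: L_def)
  have p0: "p > 0" using p by simp
  obtain a :: 'a where True by simp
  obtain \<pi> where \<pi>: "\<pi> \<in> couplings \<mu> \<nu>" "cost p \<pi> = ennreal (L powr p)"
    using optimal_coupling_exists[OF pr \<mu> \<nu> p0] by (auto simp: L_def)
  have s\<pi>[measurable_cong]: "sets \<pi> = sets borel" and P\<pi>: "prob_space \<pi>"
    and marg: "distr \<pi> borel fst = \<mu>" "distr \<pi> borel snd = \<nu>"
    using \<pi> by (auto simp: couplings_def)
  interpret prob_space \<pi> by fact
  define d where "d n = inverse (real (Suc n))" for n
  have d: "d n > 0" "d n \<le> 1" for n by (auto simp: d_def divide_simps)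
  define Q where "Q n G \<longleftrightarrow> (\<forall>t. G t \<in> \<pi> \<rightarrow>\<^sub>M borel) \<and>
    (\<forall>s t z. dist (G s z) (G t z) \<le> min 1 \<bar>s - t\<bar> * (dist (fst z) (snd z) + 2 * d n)) \<and>
    (\<forall>z. dist (G 0 z) (fst z) \<le> d n) \<and> (\<forall>z. dist (G 1 z) (snd z) \<le> d n)" for n and G :: "real \<Rightarrow> 'a \<times> 'a \<Rightarrow> 'a"
  have "\<exists>G. Q n G" for n unfolding Q_def by (rule approx_displacement[OF geo P\<pi> s\<pi> d(1)])
  then obtain G where "\<And>n. Q n (G n)" by metis
  hence G[measurable]: "\<And>n t. G n t \<in> \<pi> \<rightarrow>\<^sub>M borel"
    and Glip: "\<And>n s t z. dist (G n s z) (G n t z) \<le> min 1 \<bar>s - t\<bar> * (dist (fst z) (snd z) + 2 * d n)"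
    and G0: "\<And>n z. dist (G n 0 z) (fst z) \<le> d n" and G1: "\<And>n z. dist (G n 1 z) (snd z) \<le> d n"
    unfolding Q_def by auto
  define f where "f n t = distr \<pi> borel (G n t)" for n t
  have lip: "wass p (f n s) (f n t) \<le> L * \<bar>s - t\<bar> + 2 * d n" for n s t
  proof -
    \<comment> \<open>Capping the factor at 1 keeps the mesh error below \<open>2 * d n\<close> at
      all times; uncapped it would grow with \<open>\<bar>s - t\<bar>\<close>.\<close>
    define k where "k = min 1 \<bar>s - t\<bar>"
    have k: "0 \<le> k" "k \<le> 1" "k \<le> \<bar>s - t\<bar>" by (auto simp: k_def)
    have "(\<integral>\<^sup>+z. ennreal ((dist (fst z) (snd z) + 2 * d n) powr p) \<partial>\<pi>) \<le> ennreal ((L + 2 * d n) powr p)"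
    proof (rule minkowski_powr(1)[where u="\<lambda>z. dist (fst z) (snd z)" and v="\<lambda>_. 2 * d n"])
      show "(\<integral>\<^sup>+z. ennreal (dist (fst z) (snd z) powr p) \<partial>\<pi>) \<le> ennreal (L powr p)"
        using \<pi>(2) by (simp add: cost_def)
    qed (use d[of n] L p in \<open>auto simp: emeasure_space_1 less_imp_le\<close>)
    hence "ennreal (k powr p) * (\<integral>\<^sup>+z. ennreal ((dist (fst z) (snd z) + 2 * d n) powr p) \<partial>\<pi>) \<le> ennreal (k powr p) * ennreal ((L + 2 * d n) powr p)"
      by (intro mult_left_mono) auto
    also have "\<dots> = ennreal ((k * (L + 2 * d n)) powr p)"
      using k L d[of n] by (simp add: powr_mult flip: ennreal_mult)
    also have "ennreal (k powr p) * (\<integral>\<^sup>+z. ennreal ((dist (fst z) (snd z) + 2 * d n) powr p) \<partial>\<pi>) =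
        (\<integral>\<^sup>+z. ennreal ((k * (dist (fst z) (snd z) + 2 * d n)) powr p) \<partial>\<pi>)"
      using k d[of n] by (subst nn_integral_cmult[symmetric]) (auto simp: powr_mult ennreal_mult less_imp_le)
    finally have "(\<integral>\<^sup>+z. ennreal ((k * (dist (fst z) (snd z) + 2 * d n)) powr p) \<partial>\<pi>) \<le> ennreal ((k * (L + 2 * d n)) powr p)" .
    moreover have "(\<integral>\<^sup>+z. ennreal (dist (G n s z) (G n t z) powr p) \<partial>\<pi>) \<le>
        (\<integral>\<^sup>+z. ennreal ((k * (dist (fst z) (snd z) + 2 * d n)) powr p) \<partial>\<pi>)"
      using Glip[of n s _ t] p by (intro nn_integral_mono ennreal_leI powr_mono2) (auto simp: k_def)
    ultimately have "(\<integral>\<^sup>+z. ennreal (dist (G n s z) (G n t z) powr p) \<partial>\<pi>) \<le> ennreal ((k * (L + 2 * d n)) powr p)"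
      by (rule order_trans[rotated])
    hence "wass p (f n s) (f n t) \<le> k * (L + 2 * d n)"
      unfolding f_def using k L d[of n] p by (intro wass_le_rv[OF P\<pi>]) (auto intro: mult_nonneg_nonneg)
    also have "\<dots> \<le> L * \<bar>s - t\<bar> + 2 * d n"
    proof -
      have "k * L \<le> \<bar>s - t\<bar> * L" using k L by (intro mult_right_mono) auto
      moreover have "k * (2 * d n) \<le> 1 * (2 * d n)" using k d[of n] by (intro mult_right_mono) auto
      ultimately show ?thesis by (simp add: algebra_simps)
    qed
    finally show ?thesis .
  qed
  \<comment> \<open>The 3 pays for the start, off by \<open>d n\<close>, and for the excess
    displacement \<open>2 * d n\<close>, as \<open>d n \<le> 1\<close>.\<close>
  define V where "V z = dist a (fst z) + (dist (fst z) (snd z) + 3)" for z :: "'a \<times> 'a"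
  have [measurable]: "V \<in> borel_measurable \<pi>" unfolding V_def by measurable
  have V: "dist a (G n t z) \<le> V z" for n t z
  proof -
    have "dist (G n 0 z) (G n t z) \<le> 1 * (dist (fst z) (snd z) + 2 * d n)"
      by (rule order_trans[OF Glip]) (use d[of n] in \<open>intro mult_right_mono, auto\<close>)
    thus ?thesis using G0[of n z] d[of n] dist_triangle[of a "G n t z" "fst z"]
        dist_triangle[of "fst z" "G n t z" "G n 0 z"] unfolding V_def by (simp add: dist_commute)
  qed
  have Vfin: "(\<integral>\<^sup>+z. ennreal (V z powr p) \<partial>\<pi>) < \<infinity>"
  proof -
    have "(\<integral>\<^sup>+z. ennreal ((dist (fst z) (snd z) + 3) powr p) \<partial>\<pi>) \<le>
       ennreal (2 powr p) * ((\<integral>\<^sup>+z. ennreal (dist (fst z) (snd z) powr p) \<partial>\<pi>) + (\<integral>\<^sup>+z. ennreal (3 powr p) \<partial>\<pi>))"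
      by (rule nn_integral_powr_add_le) (use p in auto)
    also have "\<dots> < \<infinity>" using \<pi>(2) by (simp add: cost_def emeasure_space_1 ennreal_mult_less_top)
    finally have 1: "(\<integral>\<^sup>+z. ennreal ((dist (fst z) (snd z) + 3) powr p) \<partial>\<pi>) < \<infinity>" .
    have "(\<integral>\<^sup>+z. ennreal (dist a (fst z) powr p) \<partial>\<pi>) = (\<integral>\<^sup>+x. ennreal (dist a x powr p) \<partial>\<mu>)"
      unfolding marg(1)[symmetric] by (subst nn_integral_distr) auto
    hence 2: "(\<integral>\<^sup>+z. ennreal (dist a (fst z) powr p) \<partial>\<pi>) < \<infinity>" using Pp_moment[OF \<mu> p0] by simp
    have "(\<integral>\<^sup>+z. ennreal (V z powr p) \<partial>\<pi>) \<le>
       ennreal (2 powr p) * ((\<integral>\<^sup>+z. ennreal (dist a (fst z) powr p) \<partial>\<pi>) + (\<integral>\<^sup>+z. ennreal ((dist (fst z) (snd z) + 3) powr p) \<partial>\<pi>))"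
      by (rule nn_integral_powr_add_le) (use p in \<open>auto simp: V_def\<close>)
    also have "\<dots> < \<infinity>" using 1 2 by (simp add: ennreal_mult_less_top)
    finally show ?thesis .
  qed
  have fP: "f n t \<in> Pp p" for n t
  proof (rule PpI)
    have "(\<integral>\<^sup>+ x. ennreal (dist a x powr p) \<partial>f n t) = (\<integral>\<^sup>+ z. ennreal (dist a (G n t z) powr p) \<partial>\<pi>)"
      unfolding f_def by (subst nn_integral_distr) auto
    also have "\<dots> \<le> (\<integral>\<^sup>+z. ennreal (V z powr p) \<partial>\<pi>)"
      using V p by (intro nn_integral_mono ennreal_leI powr_mono2) auto
    finally show "(\<integral>\<^sup>+ x. ennreal (dist a x powr p) \<partial>f n t) < \<infinity>" using Vfin by (rule le_less_trans)
  qed (auto simp: f_def prob_space_distr)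
  have cpt: "\<exists>r'. strict_mono (r' :: nat \<Rightarrow> nat) \<and> (\<exists>l\<in>Pp p. (\<lambda>n. wass p (f (r (r' n)) t) l) \<longlonglongrightarrow> 0)"
    for t and r :: "nat \<Rightarrow> nat"
  proof (rule wass_compact[OF pr p0])
    fix ep :: real assume "ep > 0"
    thus "\<exists>R. \<forall>n. (\<integral>\<^sup>+x. tail p R (dist a x) \<partial>f (r n) t) \<le> ennreal ep"
      by (intro unif_tail_dominated[where N=\<pi> and X="\<lambda>n. G (r n) t" and V=V]) (use V Vfin p in \<open>auto simp: f_def\<close>)
  qed (use Pp_D[OF fP] in auto)
  have dlim: "d \<longlonglongrightarrow> 0" unfolding d_def by (rule LIMSEQ_inverse_real_of_nat)
  have "\<exists>r. strict_mono (r :: nat \<Rightarrow> nat) \<and> (\<forall>t. \<exists>l\<in>Pp p. (\<lambda>n. wass p (f (r n) t) l) \<longlonglongrightarrow> 0)"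
  proof (rule arzela_ascoli_pointwise[where K=L and e="\<lambda>n. 2 * d n"])
    show "(\<lambda>n. 2 * d n) \<longlonglongrightarrow> 0" using tendsto_mult_right_zero[OF dlim] .
  qed (use lip fP cpt wass_nonneg wass_commute wass_triangle[OF pr p] in auto)
  then obtain r \<rho> where r: "strict_mono (r :: nat \<Rightarrow> nat)" and \<rho>P: "\<And>t. \<rho> t \<in> Pp p"
    and \<rho>: "\<And>t. (\<lambda>n. wass p (f (r n) t) (\<rho> t)) \<longlonglongrightarrow> 0"
    by metis
  have drlim: "(\<lambda>n. d (r n)) \<longlonglongrightarrow> 0" using LIMSEQ_subseq_LIMSEQ[OF dlim r] by (simp add: comp_def)
  have \<rho>lip: "wass p (\<rho> s) (\<rho> t) \<le> L * \<bar>s - t\<bar>" for s t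
  proof -
    have "wass p (\<rho> s) (\<rho> t) \<le> L * \<bar>s - t\<bar> + 2 * 0"
    proof (rule LIMSEQ_le)
      show "(\<lambda>n. wass p (f (r n) s) (f (r n) t)) \<longlonglongrightarrow> wass p (\<rho> s) (\<rho> t)"
        by (rule wass_tendsto[OF pr p fP fP \<rho>P \<rho>P \<rho> \<rho>])
      show "(\<lambda>n. L * \<bar>s - t\<bar> + 2 * d (r n)) \<longlonglongrightarrow> L * \<bar>s - t\<bar> + 2 * 0" by (intro tendsto_intros drlim)
    qed (use lip in auto)
    thus ?thesis by simp
  qed
  have close: "\<rho> t = \<kappa>" if \<kappa>: "\<kappa> \<in> Pp p" "\<And>n. wass p (f n t) \<kappa> \<le> d n" for t \<kappa>
  proof (rule wass_eq_0_imp_eq[OF pr \<rho>P \<kappa>(1) p0])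
    have "(\<lambda>n. wass p (f (r n) t) \<kappa>) \<longlonglongrightarrow> wass p (\<rho> t) \<kappa>"
      by (rule wass_tendsto[OF pr p fP \<kappa>(1) \<rho>P \<kappa>(1) \<rho>]) (simp add: wass_self[OF \<kappa>(1) p0])
    moreover have "(\<lambda>n. wass p (f (r n) t) \<kappa>) \<longlonglongrightarrow> 0"
      by (rule tendsto_sandwich[OF _ _ tendsto_const drlim]) (auto simp: wass_nonneg \<kappa>)
    ultimately show "wass p (\<rho> t) \<kappa> = 0" by (rule LIMSEQ_unique)
  qed
  have const_cost: "(\<integral>\<^sup>+z. ennreal (g z powr p) \<partial>\<pi>) \<le> ennreal (d n powr p)"
    if "\<And>z. 0 \<le> g z" "\<And>z. g z \<le> d n" for g n
  proof -
    have "(\<integral>\<^sup>+z. ennreal (g z powr p) \<partial>\<pi>) \<le> (\<integral>\<^sup>+z. ennreal (d n powr p) \<partial>\<pi>)"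
      using that p by (intro nn_integral_mono ennreal_leI powr_mono2) auto
    thus ?thesis by (simp add: emeasure_space_1)
  qed
  have "wass p (f n 0) \<mu> \<le> d n" for n
    unfolding f_def marg(1)[symmetric]
    by (rule wass_le_rv[OF P\<pi>]) (use const_cost[of "\<lambda>z. dist (G n 0 z) (fst z)" n] G0 d[of n] p in \<open>auto simp: less_imp_le\<close>)
  hence \<rho>0: "\<rho> 0 = \<mu>" by (rule close[OF \<mu>])
  have "wass p (f n 1) \<nu> \<le> d n" for n
    unfolding f_def marg(2)[symmetric]
    by (rule wass_le_rv[OF P\<pi>]) (use const_cost[of "\<lambda>z. dist (G n 1 z) (snd z)" n] G1 d[of n] p in \<open>auto simp: less_imp_le\<close>)
  hence \<rho>1: "\<rho> 1 = \<nu>" by (rule close[OF \<nu>])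
  have eq1: "wass p (\<rho> s) (\<rho> t) = L * (t - s)" if "0 \<le> s" "s \<le> t" "t \<le> 1" for s t
  proof -
    have "L \<le> wass p (\<rho> 0) (\<rho> s) + wass p (\<rho> s) (\<rho> t) + wass p (\<rho> t) (\<rho> 1)"
      using wass_triangle[OF pr p \<rho>P[of 0] \<rho>P[of s] \<rho>P[of 1]] wass_triangle[OF pr p \<rho>P[of s] \<rho>P[of t] \<rho>P[of 1]]
      by (simp add: \<rho>0 \<rho>1 L_def)
    moreover have "L * s + L * (t - s) + L * (1 - t) = L" by (simp add: algebra_simps)
    ultimately show ?thesis using \<rho>lip[of 0 s] \<rho>lip[of s t] \<rho>lip[of t 1] that by simp
  qed
  have eq: "wass p (\<rho> (s / L)) (\<rho> (t / L)) = \<bar>s - t\<bar>" if "s \<in> {0..L}" "t \<in> {0..L}" for s t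
  proof -
    have *: "wass p (\<rho> (s / L)) (\<rho> (t / L)) = t - s" if "0 \<le> s" "s \<le> t" "t \<le> L" for s t
    proof -
      have "wass p (\<rho> (s / L)) (\<rho> (t / L)) = L * (t / L - s / L)"
        using that L by (intro eq1) (auto simp: divide_right_mono)
      thus ?thesis using L by (simp add: right_diff_distrib)
    qed
    show ?thesis using *[of s t] *[of t s] that wass_commute[of p "\<rho> (s/L)" "\<rho> (t/L)"] by (cases "s \<le> t") auto
  qed
  show ?thesis
    by (intro exI[of _ "\<lambda>t. \<rho> (t / L)"]) (use L eq \<rho>P \<rho>0 \<rho>1 in \<open>auto simp: wgeods_def L_def[symmetric]\<close>)
qed

subsection \<open>Existence of co-rays\<close>

text \<open>The first optimal coupling is prescribed, so that one and the same coupling can be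
  continued to many different third measures.\<close>

lemma optimal_gluing:
  fixes \<mu>1 \<mu>2 \<mu>3 :: "'a::{complete_space,second_countable_topology} measure"
  assumes pr: "proper_space TYPE('a)" and p: "p > 0"
    and \<mu>: "\<mu>1 \<in> Pp p" "\<mu>2 \<in> Pp p" "\<mu>3 \<in> Pp p"
    and \<pi>1: "\<pi>1 \<in> couplings \<mu>1 \<mu>2" "cost p \<pi>1 = ennreal (wass p \<mu>1 \<mu>2 powr p)"
  shows "\<exists>(\<Omega>::real measure) X Y Z. prob_space \<Omega> \<and> X \<in> \<Omega> \<rightarrow>\<^sub>M borel \<and> Y \<in> \<Omega> \<rightarrow>\<^sub>M borel \<and> Z \<in> \<Omega> \<rightarrow>\<^sub>M borel \<and>
    distr \<Omega> borel (\<lambda>w. (X w, Y w)) = \<pi>1 \<and>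
    distr \<Omega> borel X = \<mu>1 \<and> distr \<Omega> borel Y = \<mu>2 \<and> distr \<Omega> borel Z = \<mu>3 \<and>
    (\<integral>\<^sup>+w. ennreal (dist (X w) (Y w) powr p) \<partial>\<Omega>) = ennreal (wass p \<mu>1 \<mu>2 powr p) \<and>
    (\<integral>\<^sup>+w. ennreal (dist (Y w) (Z w) powr p) \<partial>\<Omega>) = ennreal (wass p \<mu>2 \<mu>3 powr p)"
proof -
  obtain \<pi>2 where \<pi>2: "\<pi>2 \<in> couplings \<mu>2 \<mu>3" "cost p \<pi>2 = ennreal (wass p \<mu>2 \<mu>3 powr p)"
    using optimal_coupling_exists[OF pr \<mu>(2,3) p] by blast
  obtain \<Omega> :: "real measure" and X Y Z where \<Omega>: "prob_space \<Omega>"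
    and m: "X \<in> \<Omega> \<rightarrow>\<^sub>M borel" "Y \<in> \<Omega> \<rightarrow>\<^sub>M borel" "Z \<in> \<Omega> \<rightarrow>\<^sub>M borel"
    and d: "distr \<Omega> borel (\<lambda>w. (X w, Y w)) = \<pi>1" "distr \<Omega> borel (\<lambda>w. (Y w, Z w)) = \<pi>2"
    using gluing_couplings[OF pr p \<mu> \<pi>1(1) \<pi>2(1)] by auto
  have "distr \<Omega> borel X = \<mu>1" "distr \<Omega> borel Y = \<mu>2"
    using law_of_coupling[OF m(1,2)] d(1) \<pi>1(1) by simp_all
  moreover have "distr \<Omega> borel Z = \<mu>3"
    using law_of_coupling(2)[OF m(2,3)] d(2) \<pi>2(1) by simp
  ultimately show ?thesis
    using \<Omega> m d cost_pair[OF m(1,2), of p] cost_pair[OF m(2,3), of p] \<pi>1(2) \<pi>2(2)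
    by (intro exI[of _ \<Omega>] exI[of _ X] exI[of _ Y] exI[of _ Z]) simp
qed

text \<open>The geodesic passes through \<open>\<gamma> s\<close> without loss of length, so gluing
  optimal couplings there gives collinear points with legs in the ratio s : L - s.\<close>

lemma wgeods_displacement:
  fixes \<mu> \<nu> :: "'a::{complete_space,second_countable_topology} measure"
  assumes pr: "proper_space TYPE('a)" and p: "p > 1" and \<mu>: "\<mu> \<in> Pp p" and \<nu>: "\<nu> \<in> Pp p"
    and \<gamma>: "\<gamma> \<in> wgeods p \<mu> \<nu>" and s: "0 \<le> s" "s \<le> wass p \<mu> \<nu>"
  shows "\<exists>(\<Omega>::real measure) X Z Y. prob_space \<Omega> \<and> X \<in> \<Omega> \<rightarrow>\<^sub>M borel \<and> Z \<in> \<Omega> \<rightarrow>\<^sub>M borel \<and> Y \<in> \<Omega> \<rightarrow>\<^sub>M borel \<and>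
    distr \<Omega> borel X = \<mu> \<and> distr \<Omega> borel Z = \<gamma> s \<and> distr \<Omega> borel Y = \<nu> \<and>
    (AE w in \<Omega>. wass p \<mu> \<nu> * dist (X w) (Z w) = s * dist (X w) (Y w))"
proof -
  define L where "L = wass p \<mu> \<nu>"
  have p0: "p > 0" using p by simp
  have g: "\<gamma> 0 = \<mu>" "\<gamma> L = \<nu>" "\<gamma> s \<in> Pp p"
    and iso: "\<And>s t. s \<in> {0..L} \<Longrightarrow> t \<in> {0..L} \<Longrightarrow> wass p (\<gamma> s) (\<gamma> t) = \<bar>s - t\<bar>"
    using \<gamma> s unfolding wgeods_def L_def[symmetric] by auto
  have w: "wass p \<mu> (\<gamma> s) = s" "wass p (\<gamma> s) \<nu> = L - s"
    using iso[of 0 s] iso[of s L] g s by (auto simp: L_def)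
  obtain \<pi> where \<pi>: "\<pi> \<in> couplings \<mu> (\<gamma> s)" "cost p \<pi> = ennreal (wass p \<mu> (\<gamma> s) powr p)"
    using optimal_coupling_exists[OF pr \<mu> g(3) p0] by blast
  obtain \<Omega> :: "real measure" and X Z Y where \<Omega>: "prob_space \<Omega>"
    and [measurable]: "X \<in> \<Omega> \<rightarrow>\<^sub>M borel" "Z \<in> \<Omega> \<rightarrow>\<^sub>M borel" "Y \<in> \<Omega> \<rightarrow>\<^sub>M borel"
    and law: "distr \<Omega> borel X = \<mu>" "distr \<Omega> borel Z = \<gamma> s" "distr \<Omega> borel Y = \<nu>"
    and c1: "(\<integral>\<^sup>+w. ennreal (dist (X w) (Z w) powr p) \<partial>\<Omega>) = ennreal (s powr p)"
    and c2: "(\<integral>\<^sup>+w. ennreal (dist (Z w) (Y w) powr p) \<partial>\<Omega>) = ennreal ((L - s) powr p)"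
    using optimal_gluing[OF pr p0 \<mu> g(3) \<nu> \<pi>] unfolding w by blast
  have "AE w in \<Omega>. L * dist (X w) (Z w) = s * dist (X w) (Y w)"
  \<comment> \<open>At either end one leg has zero cost, so its end points coincide almost surely;
    \<open>wass_collinear\<close> needs positive legs.\<close>
  proof (cases "s = 0 \<or> s = L")
    case True
    have zero: "AE w in \<Omega>. U w = V w" if [measurable]: "U \<in> \<Omega> \<rightarrow>\<^sub>M borel" "V \<in> \<Omega> \<rightarrow>\<^sub>M borel"
      and "(\<integral>\<^sup>+w. ennreal (dist (U w) (V w) powr p) \<partial>\<Omega>) = 0" for U V :: "real \<Rightarrow> 'a"
    proof -
      have "AE w in \<Omega>. ennreal (dist (U w) (V w) powr p) = 0"
        using that(3) by (subst (asm) nn_integral_0_iff_AE) auto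
      thus ?thesis by eventually_elim (auto simp: ennreal_eq_0_iff)
    qed
    show ?thesis
    proof (cases "s = 0")
      case True
      hence "AE w in \<Omega>. X w = Z w" using c1 by (intro zero) auto
      thus ?thesis by eventually_elim (simp add: True)
    next
      case False
      hence "AE w in \<Omega>. Z w = Y w" using c2 \<open>s = 0 \<or> s = L\<close> by (intro zero) auto
      thus ?thesis by eventually_elim (use False \<open>s = 0 \<or> s = L\<close> in simp)
    qed
  next
    case False
    hence sL: "0 < s" "0 < L - s" using s by (auto simp: L_def)
    have "AE w in \<Omega>. dist (X w) (Y w) = dist (X w) (Z w) + dist (Z w) (Y w) \<and>
        (L - s) * dist (X w) (Z w) = s * dist (Z w) (Y w)"
      by (rule wass_collinear[OF \<Omega> _ _ _ _ _ p sL(1) c1 sL(2) c2]) (simp_all add: law \<mu> \<nu> L_def)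
    thus ?thesis by eventually_elim (simp add: algebra_simps)
  qed
  thus ?thesis using \<Omega> law unfolding L_def[symmetric]
    by (intro exI[of _ \<Omega>] exI[of _ X] exI[of _ Z] exI[of _ Y]) simp
qed

text \<open>The distribution of the displacement from time 0 to time t, divided by t, can be taken independent of t.\<close>

lemma ray_unif_tail:
  fixes \<mu> :: "real \<Rightarrow> 'a::{complete_space,second_countable_topology} measure"
  assumes pr: "proper_space TYPE('a)" and p: "p > 1"
    and \<mu>: "\<And>t. t \<ge> 0 \<Longrightarrow> \<mu> t \<in> Pp p" "\<And>s t. s \<ge> 0 \<Longrightarrow> t \<ge> 0 \<Longrightarrow> wass p (\<mu> s) (\<mu> t) = \<bar>s - t\<bar>"
    and ep: "ep > 0"
  shows "\<exists>R\<ge>0. \<forall>t>1. (\<integral>\<^sup>+y. tail p R (dist a y / t) \<partial>\<mu> t) \<le> ennreal ep"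
proof -
  have p0: "p > 0" using p by simp
  have P01: "\<mu> 0 \<in> Pp p" "\<mu> 1 \<in> Pp p" using \<mu>(1) by auto
  obtain \<pi> where \<pi>: "\<pi> \<in> couplings (\<mu> 0) (\<mu> 1)" "cost p \<pi> = ennreal (wass p (\<mu> 0) (\<mu> 1) powr p)"
    using optimal_coupling_exists[OF pr P01 p0] by blast
  have [measurable_cong]: "sets \<pi> = sets borel" and marg: "distr \<pi> borel fst = \<mu> 0" using \<pi> by (auto simp: couplings_def)
  define V where "V z = dist a (fst z) + dist (fst z) (snd z)" for z :: "'a \<times> 'a"
  have [measurable]: "V \<in> borel_measurable borel" unfolding V_def by measurable
  have "(\<integral>\<^sup>+z. ennreal (V z powr p) \<partial>\<pi>) \<le> ennreal (2 powr p) *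
      ((\<integral>\<^sup>+z. ennreal (dist a (fst z) powr p) \<partial>\<pi>) + (\<integral>\<^sup>+z. ennreal (dist (fst z) (snd z) powr p) \<partial>\<pi>))"
    by (rule nn_integral_powr_add_le) (use p in \<open>auto simp: V_def\<close>)
  also have "(\<integral>\<^sup>+z. ennreal (dist a (fst z) powr p) \<partial>\<pi>) = (\<integral>\<^sup>+x. ennreal (dist a x powr p) \<partial>\<mu> 0)"
    unfolding marg[symmetric] by (subst nn_integral_distr) auto
  also have "ennreal (2 powr p) * (\<dots> + (\<integral>\<^sup>+z. ennreal (dist (fst z) (snd z) powr p) \<partial>\<pi>)) < \<infinity>"
    using Pp_moment[OF P01(1) p0, of a] \<pi>(2) by (simp add: cost_def ennreal_mult_less_top)
  finally have Vfin: "(\<integral>\<^sup>+z. ennreal (V z powr p) \<partial>\<pi>) < \<infinity>" .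
  obtain R where R: "R \<ge> 0" "(\<integral>\<^sup>+z. tail p R (V z) \<partial>\<pi>) \<le> ennreal ep"
    using tail_integral_small[OF _ Vfin ep] by auto
  have "(\<integral>\<^sup>+y. tail p R (dist a y / t) \<partial>\<mu> t) \<le> ennreal ep" if t: "t > 1" for t
  proof -
    have Pt: "\<mu> t \<in> Pp p" using \<mu>(1) t by auto
    have w: "wass p (\<mu> 0) (\<mu> 1) = 1" "wass p (\<mu> 1) (\<mu> t) = t - 1" "wass p (\<mu> 0) (\<mu> t) = t" using \<mu>(2) t by auto
    obtain \<Omega> :: "real measure" and X Y Z where \<Omega>: "prob_space \<Omega>"
      and [measurable]: "X \<in> \<Omega> \<rightarrow>\<^sub>M borel" "Y \<in> \<Omega> \<rightarrow>\<^sub>M borel" "Z \<in> \<Omega> \<rightarrow>\<^sub>M borel"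
      and XY: "distr \<Omega> borel (\<lambda>w. (X w, Y w)) = \<pi>"
      and law: "distr \<Omega> borel X = \<mu> 0" "distr \<Omega> borel Y = \<mu> 1" "distr \<Omega> borel Z = \<mu> t"
      and c1: "(\<integral>\<^sup>+w. ennreal (dist (X w) (Y w) powr p) \<partial>\<Omega>) = ennreal (1 powr p)"
      and c2: "(\<integral>\<^sup>+w. ennreal (dist (Y w) (Z w) powr p) \<partial>\<Omega>) = ennreal ((t - 1) powr p)"
      using optimal_gluing[OF pr p0 P01 Pt \<pi>] unfolding w by blast
    have "AE w in \<Omega>. dist (X w) (Z w) = dist (X w) (Y w) + dist (Y w) (Z w) \<and>
        (t - 1) * dist (X w) (Y w) = 1 * dist (Y w) (Z w)"
      by (rule wass_collinear[OF \<Omega> _ _ _ _ _ p _ c1 _ c2]) (use t in \<open>simp_all add: law P01 Pt w\<close>)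
    hence le: "AE w in \<Omega>. tail p R (dist a (Z w) / t) \<le> tail p R (V (X w, Y w))"
    proof eventually_elim
      case (elim w)
      have xz: "dist (X w) (Z w) = t * dist (X w) (Y w)" using elim by (simp add: algebra_simps)
      have "dist a (Z w) \<le> dist a (X w) + t * dist (X w) (Y w)" using dist_triangle[of a "Z w" "X w"] xz by simp
      \<comment> \<open>After division by t the starting point contributes no more than before,
        because t > 1.\<close>
      also have "dist a (X w) \<le> t * dist a (X w)" using t by (simp add: mult_le_cancel_right1)
      finally have "dist a (Z w) \<le> t * V (X w, Y w)" by (simp add: V_def algebra_simps)
      hence "dist a (Z w) / t \<le> V (X w, Y w)" using t by (simp add: divide_le_eq mult.commute)
      thus ?case using t p by (intro tail_mono) auto
    qed
    have "(\<integral>\<^sup>+y. tail p R (dist a y / t) \<partial>\<mu> t) = (\<integral>\<^sup>+w. tail p R (dist a (Z w) / t) \<partial>\<Omega>)"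
      unfolding law(3)[symmetric] by (subst nn_integral_distr) auto
    also have "\<dots> \<le> (\<integral>\<^sup>+w. tail p R (V (X w, Y w)) \<partial>\<Omega>)" by (rule nn_integral_mono_AE[OF le])
    also have "\<dots> = (\<integral>\<^sup>+z. tail p R (V z) \<partial>\<pi>)"
      unfolding XY[symmetric] by (subst nn_integral_distr) auto
    finally show ?thesis using R(2) by (rule order_trans)
  qed
  thus ?thesis using R(1) by blast
qed

lemma wray_of_isometric:
  assumes "\<And>t. t \<ge> 0 \<Longrightarrow> \<gamma> t \<in> Pp p" "\<And>s t. s \<ge> 0 \<Longrightarrow> t \<ge> 0 \<Longrightarrow> wass p (\<gamma> s) (\<gamma> t) = \<bar>s - t\<bar>"
  shows "wray p \<gamma>"
  unfolding wray_def using assms by auto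

lemma unit_wrayD:
  assumes "unit_wray p \<mu>"
  shows "t \<ge> 0 \<Longrightarrow> \<mu> t \<in> Pp p" "s \<ge> 0 \<Longrightarrow> t \<ge> 0 \<Longrightarrow> wass p (\<mu> s) (\<mu> t) = \<bar>s - t\<bar>"
  using assms unfolding unit_wray_def wray_def by auto

text \<open>Let x and y be the distances of the two end points from a. The displacement at time s is
  at most (s/L)(x + y), which is at most x + 2t(y/l), by s at most L and t, and l at most 2L. Adding
  the x of the starting point gives 2x + 2t(y/l), so c = 2 + 2t works in
  \<open>tail_sum\<close>.\<close>

lemma geodesic_to_ray_tail:
  fixes \<mu> \<nu> :: "'a::{complete_space,second_countable_topology} measure"
  assumes pr: "proper_space TYPE('a)" and p: "p > 1" and \<mu>: "\<mu> \<in> Pp p" and \<nu>: "\<nu> \<in> Pp p"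
    and \<gamma>: "\<gamma> \<in> wgeods p \<nu> \<mu>" and s: "0 \<le> s" "s \<le> wass p \<nu> \<mu>" "s \<le> t"
    and l: "0 < l" "l \<le> 2 * wass p \<nu> \<mu>" and c: "c = 2 + 2 * t"
  shows "(\<integral>\<^sup>+z. tail p (2 * c * R) (dist a z) \<partial>\<gamma> s) \<le>
    ennreal ((2 * c) powr p) * ((\<integral>\<^sup>+x. tail p R (dist a x) \<partial>\<nu>) + (\<integral>\<^sup>+y. tail p R (dist a y / l) \<partial>\<mu>))"
proof -
  define L where "L = wass p \<nu> \<mu>"
  have L: "L > 0" using l by (simp add: L_def)
  obtain \<Omega> :: "real measure" and X Z Y where \<Omega>: "prob_space \<Omega>"
    and [measurable]: "X \<in> \<Omega> \<rightarrow>\<^sub>M borel" "Z \<in> \<Omega> \<rightarrow>\<^sub>M borel" "Y \<in> \<Omega> \<rightarrow>\<^sub>M borel"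
    and law: "distr \<Omega> borel X = \<nu>" "distr \<Omega> borel Z = \<gamma> s" "distr \<Omega> borel Y = \<mu>"
    and disp: "AE w in \<Omega>. L * dist (X w) (Z w) = s * dist (X w) (Y w)"
    using wgeods_displacement[OF pr p \<nu> \<mu> \<gamma> s(1,2)] unfolding L_def by blast
  have le: "AE w in \<Omega>. tail p (2 * c * R) (dist a (Z w)) \<le>
      ennreal ((2 * c) powr p) * (tail p R (dist a (X w)) + tail p R (dist a (Y w) / l))"
    using disp
  proof eventually_elim
    case (elim w)
    define x where "x = dist a (X w)"
    define y where "y = dist a (Y w)"
    have xy: "x \<ge> 0" "y \<ge> 0" by (auto simp: x_def y_def)
    have "L * dist (X w) (Z w) \<le> s * (x + y)"
      unfolding elim x_def y_def using s by (intro mult_left_mono dist_triangle3) 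
    also have "\<dots> = s * x + s * y" by (simp add: algebra_simps)
    also have "\<dots> \<le> L * x + t * y" using s xy by (intro add_mono mult_right_mono) (auto simp: L_def)
    also have "t * y \<le> L * (2 * t * (y / l))"
    proof -
      have "l * (t * y) \<le> 2 * L * (t * y)" using l s xy by (intro mult_right_mono) (auto simp: L_def)
      thus ?thesis using l by (simp add: field_simps)
    qed
    finally have "L * dist (X w) (Z w) \<le> L * (x + 2 * t * (y / l))" by (simp add: algebra_simps)
    hence "dist (X w) (Z w) \<le> x + 2 * t * (y / l)" using L by simp
    hence "dist a (Z w) \<le> 2 * x + 2 * t * (y / l)" using dist_triangle[of a "Z w" "X w"] by (simp add: x_def)
    also have "\<dots> \<le> c * (x + y / l)"
    proof -
      have "0 \<le> 2 * t * x" "0 \<le> 2 * (y / l)" using s l xy by auto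
      thus ?thesis unfolding c by (simp add: algebra_simps)
    qed
    finally show ?case
      using s l p xy by (intro tail_sum) (auto simp: c x_def y_def)
  qed
  have "(\<integral>\<^sup>+z. tail p (2 * c * R) (dist a z) \<partial>\<gamma> s) = (\<integral>\<^sup>+w. tail p (2 * c * R) (dist a (Z w)) \<partial>\<Omega>)"
    unfolding law(2)[symmetric] by (subst nn_integral_distr) auto
  also have "\<dots> \<le> (\<integral>\<^sup>+w. ennreal ((2 * c) powr p) * (tail p R (dist a (X w)) + tail p R (dist a (Y w) / l)) \<partial>\<Omega>)"
    by (rule nn_integral_mono_AE[OF le])
  also have "\<dots> = ennreal ((2 * c) powr p) * ((\<integral>\<^sup>+w. tail p R (dist a (X w)) \<partial>\<Omega>) + (\<integral>\<^sup>+w. tail p R (dist a (Y w) / l) \<partial>\<Omega>))"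
    by (simp add: nn_integral_cmult nn_integral_add)
  also have "(\<integral>\<^sup>+w. tail p R (dist a (X w)) \<partial>\<Omega>) = (\<integral>\<^sup>+x. tail p R (dist a x) \<partial>\<nu>)"
    unfolding law(1)[symmetric] by (subst nn_integral_distr) auto
  also have "(\<integral>\<^sup>+w. tail p R (dist a (Y w) / l) \<partial>\<Omega>) = (\<integral>\<^sup>+y. tail p R (dist a y / l) \<partial>\<mu>)"
    unfolding law(3)[symmetric] by (subst nn_integral_distr) auto
  finally show ?thesis .
qed

theorem coray_exists:
  fixes \<mu> :: "real \<Rightarrow> 'a::{complete_space,second_countable_topology} measure"
  assumes geo: "geodesic_space TYPE('a)" and pr: "proper_space TYPE('a)" and p: "p > 1"
    and ray: "unit_wray p \<mu>" and \<nu>0: "\<nu>0 \<in> Pp p"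
  shows "\<exists>\<nu>. coray p \<mu> \<nu>0 \<nu>"
proof -
  have p0: "p > 0" using p by simp
  note \<mu> = unit_wrayD[OF ray]
  obtain a :: 'a where True by simp
  define W where "W = wass p \<nu>0 (\<mu> 0)"
  have W: "W \<ge> 0" by (simp add: W_def wass_nonneg)
  \<comment> \<open>The summand \<open>2 * W\<close> absorbs the distance to \<open>\<mu> 0\<close>:
    the length \<open>L n\<close> is at least \<open>T n - W\<close>, hence at least both
    \<open>T n / 2\<close> and n. The 2 ensures \<open>T n > 1\<close>.\<close>
  define T where "T n = real n + 2 * W + 2" for n
  have T: "T n > 1" for n using W by (simp add: T_def)
  have TP: "\<mu> (T n) \<in> Pp p" for n using \<mu>(1) T[of n] by simp
  define L where "L n = wass p \<nu>0 (\<mu> (T n))" for n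
  have "T n - W \<le> L n" for n
    using wass_triangle[OF pr p \<mu>(1)[of 0] \<nu>0 TP[of n]] \<mu>(2)[of 0 "T n"] T[of n] wass_commute[of p \<nu>0 "\<mu> 0"]
    by (simp add: W_def L_def)
  hence LT: "T n \<le> 2 * L n" "real n \<le> L n" "L n > 0" for n
    using W by (force simp: T_def dest: spec[of _ n])+
  have "\<exists>g. g \<in> wgeods p \<nu>0 (\<mu> (T n))" for n by (rule wgeods_nonempty[OF geo pr p \<nu>0 TP])
  then obtain g where g: "\<And>n. g n \<in> wgeods p \<nu>0 (\<mu> (T n))" by metis
  have gP: "g n t \<in> Pp p" and giso: "wass p (g n s) (g n t) = \<bar>s - t\<bar>" if "s \<in> {0..L n}" "t \<in> {0..L n}" for n s t
    using g[of n] that unfolding wgeods_def L_def by auto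
  have g0: "g n 0 = \<nu>0" for n using g[of n] by (simp add: wgeods_def)
  \<comment> \<open>Geodesics are constrained only up to their length; clamping freezes them at the
    ends and gives curves on all reals.\<close>
  define h where "h n t = max 0 (min t (L n))" for n t
  have h: "h n t \<in> {0..L n}" "\<bar>h n s - h n t\<bar> \<le> \<bar>s - t\<bar>" for n s t using LT[of n] by (auto simp: h_def)
  define f where "f n t = g n (h n t)" for n t
  have fP: "f n t \<in> Pp p" for n t unfolding f_def by (rule gP[OF h(1) h(1)])
  have lip: "wass p (f n s) (f n t) \<le> 1 * \<bar>s - t\<bar> + 0" for n s t
    unfolding f_def giso[OF h(1) h(1)] using h(2) by simp
  have cpt: "\<exists>r'. strict_mono (r' :: nat \<Rightarrow> nat) \<and> (\<exists>l\<in>Pp p. (\<lambda>n. wass p (f (r (r' n)) t) l) \<longlonglongrightarrow> 0)"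
    for t and r :: "nat \<Rightarrow> nat"
  proof (rule wass_compact[OF pr p0])
    fix ep :: real assume ep: "ep > 0"
    \<comment> \<open>The constant of \<open>geodesic_to_ray_tail\<close> for times up to
      \<open>\<bar>t\<bar>\<close>; e makes its two tails add up to ep after the factor
      (2c)^p.\<close>
    define c where "c = 2 + 2 * \<bar>t\<bar>"
    define e where "e = ep / (2 * (2 * c) powr p)"
    have cp: "(2 * c) powr p > 0" by (simp add: c_def)
    hence e: "e > 0" using ep by (simp add: e_def)
    obtain R1 where R1: "(\<integral>\<^sup>+x. tail p R1 (dist a x) \<partial>\<nu>0) \<le> ennreal e"
    proof -
      have [measurable_cong]: "sets \<nu>0 = sets borel" using Pp_D[OF \<nu>0] by simp
      show ?thesis using tail_integral_small[OF _ Pp_moment[OF \<nu>0 p0, of a] e] that by auto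
    qed
    obtain R2 where R2: "\<And>l. l > 1 \<Longrightarrow> (\<integral>\<^sup>+y. tail p R2 (dist a y / l) \<partial>\<mu> l) \<le> ennreal e"
      using ray_unif_tail[OF pr p \<mu> e] by blast
    define R where "R = max R1 R2"
    have R1': "(\<integral>\<^sup>+x. tail p R (dist a x) \<partial>\<nu>0) \<le> ennreal e"
      by (rule order_trans[OF nn_integral_mono R1]) (auto simp: R_def intro: tail_antimono)
    have R2': "(\<integral>\<^sup>+y. tail p R (dist a y / T n) \<partial>\<mu> (T n)) \<le> ennreal e" for n
      by (rule order_trans[OF nn_integral_mono R2[OF T]]) (auto simp: R_def intro: tail_antimono)
    have "(\<integral>\<^sup>+x. tail p (2 * c * R) (dist a x) \<partial>f n t) \<le> ennreal ep" for n
    proof -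
      have "(\<integral>\<^sup>+x. tail p (2 * c * R) (dist a x) \<partial>f n t) \<le> ennreal ((2 * c) powr p) *
          ((\<integral>\<^sup>+x. tail p R (dist a x) \<partial>\<nu>0) + (\<integral>\<^sup>+y. tail p R (dist a y / T n) \<partial>\<mu> (T n)))"
        unfolding f_def
        by (rule geodesic_to_ray_tail[OF pr p TP \<nu>0 g, where t="\<bar>t\<bar>"])
          (use h(1)[of n t] LT[of n] T[of n] in \<open>auto simp: c_def L_def h_def\<close>)
      also have "\<dots> \<le> ennreal ((2 * c) powr p) * (ennreal e + ennreal e)"
        by (intro mult_left_mono add_mono R1' R2') auto
      also have "\<dots> = ennreal ep"
        using e cp by (simp add: e_def flip: ennreal_plus ennreal_mult)
      finally show ?thesis .
    qed
    thus "\<exists>R. \<forall>n. (\<integral>\<^sup>+x. tail p R (dist a x) \<partial>f (r n) t) \<le> ennreal ep" by blast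
  qed (use Pp_D[OF fP] in auto)
  have "\<exists>r. strict_mono (r :: nat \<Rightarrow> nat) \<and> (\<forall>t. \<exists>l\<in>Pp p. (\<lambda>n. wass p (f (r n) t) l) \<longlonglongrightarrow> 0)"
    by (rule arzela_ascoli_pointwise[where K=1 and e="\<lambda>n. 0"])
      (use lip fP cpt wass_nonneg wass_commute wass_triangle[OF pr p] in auto)
  then obtain r \<rho> where r: "strict_mono (r :: nat \<Rightarrow> nat)" and \<rho>P: "\<And>t. \<rho> t \<in> Pp p"
    and \<rho>: "\<And>t. (\<lambda>n. wass p (f (r n) t) (\<rho> t)) \<longlonglongrightarrow> 0"
    by metis
  \<comment> \<open>Each fixed time eventually lies within the lengths of the geodesics, where the
    clamp from above is inactive.\<close>
  have big: "\<forall>\<^sub>F n in sequentially. t \<le> L (r n)" for t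
  proof -
    obtain N where N: "t \<le> real N" using real_arch_simple by blast
    have "t \<le> L (r n)" if "n \<ge> N" for n
      using N that LT(2)[of "r n"] seq_suble[OF r, of n] by linarith
    thus ?thesis by (auto simp: eventually_sequentially)
  qed
  have feq: "\<forall>\<^sub>F n in sequentially. f (r n) t = g (r n) t" if "t \<ge> 0" for t
    using big[of t] by eventually_elim (use that in \<open>simp add: f_def h_def\<close>)
  have conv: "(\<lambda>n. wass p (g (r n) t) (\<rho> t)) \<longlonglongrightarrow> 0" if "t \<ge> 0" for t
    by (rule Lim_transform_eventually[OF \<rho>[of t]]) (use feq[OF that] in eventually_elim, simp)
  have iso: "wass p (\<rho> s) (\<rho> t) = \<bar>s - t\<bar>" if st: "s \<ge> 0" "t \<ge> 0" for s t
  proof (rule LIMSEQ_unique)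
    show "(\<lambda>n. wass p (f (r n) s) (f (r n) t)) \<longlonglongrightarrow> wass p (\<rho> s) (\<rho> t)"
      by (rule wass_tendsto[OF pr p fP fP \<rho>P \<rho>P \<rho> \<rho>])
    have "\<forall>\<^sub>F n in sequentially. wass p (f (r n) s) (f (r n) t) = \<bar>s - t\<bar>"
      using big[of s] big[of t]
      by eventually_elim (use st in \<open>simp add: f_def h_def giso\<close>)
    thus "(\<lambda>n. wass p (f (r n) s) (f (r n) t)) \<longlonglongrightarrow> \<bar>s - t\<bar>" by (rule tendsto_eventually)
  qed
  have "wass p (\<rho> 0) \<nu>0 = 0"
    using conv[of 0] by (simp add: g0 LIMSEQ_const_iff wass_commute[of p "\<rho> 0"])
  hence \<rho>0: "\<rho> 0 = \<nu>0" by (rule wass_eq_0_imp_eq[OF pr \<rho>P \<nu>0 p0])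
  have "filterlim (\<lambda>n. T (r n)) at_top sequentially"
  proof (rule filterlim_at_top_mono[OF filterlim_real_sequentially])
    show "\<forall>\<^sub>F n in sequentially. real n \<le> T (r n)"
      using seq_suble[OF r] W by (intro always_eventually allI) (simp add: T_def add_increasing2)
  qed
  moreover have "wray p \<rho>" by (rule wray_of_isometric) (auto simp: \<rho>P iso)
  ultimately show ?thesis
    using \<rho>0 \<nu>0 g conv wass_self[OF \<nu>0 p0] unfolding coray_def
    by (intro exI[of _ \<rho>] conjI exI[of _ "\<lambda>n. T (r n)"] exI[of _ "\<lambda>_. \<nu>0"] exI[of _ "\<lambda>n. g (r n)"]) auto
qed

subsection \<open>Busemann functions and uniqueness\<close>

text \<open>An infimum in place of the customary limit at infinity, so that the value exists before
  monotonicity is known; \<open>busemann_limit\<close> shows that they agree.\<close>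

definition busemann :: "real \<Rightarrow> (real \<Rightarrow> 'a::metric_space measure) \<Rightarrow> 'a measure \<Rightarrow> real" where
  "busemann p \<mu> \<sigma> = (INF t\<in>{0..}. wass p \<sigma> (\<mu> t) - t)"

text \<open>By the triangle inequality the difference is nonincreasing in t and bounded below by
  minus the distance to \<open>\<mu> 0\<close>.\<close>

lemma busemann_limit:
  fixes \<mu> :: "real \<Rightarrow> 'a::{complete_space,second_countable_topology} measure"
  assumes pr: "proper_space TYPE('a)" and p: "p > 1" and ray: "unit_wray p \<mu>" and \<sigma>: "\<sigma> \<in> Pp p"
  shows "((\<lambda>t. wass p \<sigma> (\<mu> t) - t) \<longlongrightarrow> busemann p \<mu> \<sigma>) at_top"
proof -
  note \<mu> = unit_wrayD[OF ray]
  define b where "b t = wass p \<sigma> (\<mu> t) - t" for t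
  have mono: "b t \<le> b s" if "0 \<le> s" "s \<le> t" for s t
    using wass_triangle[OF pr p \<sigma> \<mu>(1)[of s] \<mu>(1)[of t]] \<mu>(2)[of s t] that by (simp add: b_def)
  have low: "- wass p \<sigma> (\<mu> 0) \<le> b t" if "0 \<le> t" for t
    using wass_triangle[OF pr p \<mu>(1)[of 0] \<sigma> \<mu>(1)[of t]] \<mu>(2)[of 0 t] that
      wass_commute[of p \<sigma> "\<mu> 0"] by (simp add: b_def)
  have bdd: "bdd_below (b ` {0..})" using low by (auto simp: bdd_below_def)
  have B: "busemann p \<mu> \<sigma> = (INF t\<in>{0..}. b t)" by (simp add: busemann_def b_def)
  have "(b \<longlongrightarrow> (INF t\<in>{0..}. b t)) at_top"
  proof (rule order_tendstoI)
    fix y assume "y < (INF t\<in>{0..}. b t)"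
    hence "y < b t" if "t \<ge> 0" for t using cINF_lower[OF bdd, of t] that by auto
    thus "\<forall>\<^sub>F t in at_top. y < b t" by (intro eventually_mono[OF eventually_ge_at_top[of 0]])
  next
    fix y assume "(INF t\<in>{0..}. b t) < y"
    then obtain s where s: "s \<ge> 0" "b s < y" using cINF_less_iff[OF _ bdd, of y] by auto
    show "\<forall>\<^sub>F t in at_top. b t < y"
      using eventually_ge_at_top[of s] by eventually_elim (use mono[of s] s in force)
  qed
  thus ?thesis unfolding B b_def .
qed

lemma busemann_lipschitz:
  fixes \<mu> :: "real \<Rightarrow> 'a::{complete_space,second_countable_topology} measure"
  assumes pr: "proper_space TYPE('a)" and p: "p > 1" and ray: "unit_wray p \<mu>"
    and \<sigma>: "\<sigma> \<in> Pp p" and \<sigma>': "\<sigma>' \<in> Pp p"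
  shows "busemann p \<mu> \<sigma> \<le> busemann p \<mu> \<sigma>' + wass p \<sigma> \<sigma>'"
proof (rule tendsto_le[OF _ _ busemann_limit[OF pr p ray \<sigma>]])
  show "((\<lambda>t. (wass p \<sigma>' (\<mu> t) - t) + wass p \<sigma> \<sigma>') \<longlongrightarrow> busemann p \<mu> \<sigma>' + wass p \<sigma> \<sigma>') at_top"
    by (intro tendsto_intros busemann_limit[OF pr p ray \<sigma>'])
  show "\<forall>\<^sub>F t in at_top. wass p \<sigma> (\<mu> t) - t \<le> wass p \<sigma>' (\<mu> t) - t + wass p \<sigma> \<sigma>'"
    using eventually_ge_at_top[of 0]
  proof eventually_elim
    case (elim t)
    thus ?case using wass_triangle[OF pr p \<sigma> \<sigma>' unit_wrayD(1)[OF ray]] by fastforce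
  qed
qed simp

text \<open>Since \<open>wgeods\<close> constrains a curve only up to its length, unbounded lengths
  are what brings every fixed time into range. They fall short of the ray parameter by a bounded
  amount.\<close>

lemma coray_lengths:
  fixes \<mu> :: "real \<Rightarrow> 'a::{complete_space,second_countable_topology} measure"
  assumes pr: "proper_space TYPE('a)" and p: "p > 1" and ray: "unit_wray p \<mu>" and \<sigma>: "\<sigma> \<in> Pp p"
    and tn: "filterlim tn at_top sequentially" and sP: "\<And>n. \<sigma>n n \<in> Pp p"
    and lim: "(\<lambda>n. wass p (\<sigma>n n) \<sigma>) \<longlonglongrightarrow> 0"
  shows "filterlim (\<lambda>n. wass p (\<sigma>n n) (\<mu> (tn n))) at_top sequentially"
proof (rule filterlim_at_top_mono)
  \<comment> \<open>The 1 absorbs the distance from \<open>\<sigma>n n\<close> to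
    \<open>\<sigma>\<close>, eventually below 1.\<close>
  show "filterlim (\<lambda>n. (- wass p (\<mu> 0) \<sigma> - 1) + tn n) at_top sequentially"
    by (rule filterlim_tendsto_add_at_top[OF tendsto_const tn])
  have "\<forall>\<^sub>F n in sequentially. wass p (\<sigma>n n) \<sigma> < 1" using lim by (rule order_tendstoD) simp
  moreover have "\<forall>\<^sub>F n in sequentially. tn n \<ge> 0" using tn unfolding filterlim_at_top by blast
  ultimately show "\<forall>\<^sub>F n in sequentially. (- wass p (\<mu> 0) \<sigma> - 1) + tn n \<le> wass p (\<sigma>n n) (\<mu> (tn n))"
  proof eventually_elim
    case (elim n)
    note \<mu> = unit_wrayD[OF ray]
    have P: "\<mu> 0 \<in> Pp p" "\<mu> (tn n) \<in> Pp p" using \<mu>(1) elim by auto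
    have "tn n = wass p (\<mu> 0) (\<mu> (tn n))" using \<mu>(2)[of 0 "tn n"] elim by simp
    thus ?case
      using wass_triangle[OF pr p P(1) \<sigma> P(2)] wass_triangle[OF pr p \<sigma> sP[of n] P(2)] elim
        wass_commute[of p "\<sigma>n n" \<sigma>] by linarith
  qed
qed

text \<open>Unit speed passes to the limit from the approximating geodesics. At time u these still
  have \<open>L n - u\<close> to go, so \<open>L n - tn n\<close> tends to
  \<open>busemann p \<mu> (\<nu> u) + u\<close>; as the sequence does not mention u, neither does
  its limit.\<close>

lemma coray_isometric_and_busemann:
  fixes \<mu> :: "real \<Rightarrow> 'a::{complete_space,second_countable_topology} measure"
  assumes pr: "proper_space TYPE('a)" and p: "p > 1" and ray: "unit_wray p \<mu>" and co: "coray p \<mu> \<nu>0 \<nu>"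
    and s: "s \<ge> 0" and t: "t \<ge> 0"
  shows "wass p (\<nu> s) (\<nu> t) = \<bar>s - t\<bar>"
    and "busemann p \<mu> (\<nu> s) + s = busemann p \<mu> (\<nu> t) + t"
proof -
  obtain tn \<sigma> g where \<nu>: "wray p \<nu>" "\<nu> 0 = \<nu>0" and tn: "filterlim tn at_top sequentially"
    and \<sigma>: "\<And>n. \<sigma> n \<in> Pp p" "(\<lambda>n. wass p (\<sigma> n) \<nu>0) \<longlonglongrightarrow> 0"
    and g: "\<And>n. g n \<in> wgeods p (\<sigma> n) (\<mu> (tn n))"
    and lim: "\<And>t. t \<ge> 0 \<Longrightarrow> (\<lambda>n. wass p (g n t) (\<nu> t)) \<longlonglongrightarrow> 0"
    using co unfolding coray_def by blast
  note \<mu> = unit_wrayD[OF ray]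
  have \<nu>P: "\<nu> t \<in> Pp p" if "t \<ge> 0" for t using \<nu>(1) that by (auto simp: wray_def)
  hence \<nu>0: "\<nu>0 \<in> Pp p" using \<nu>(2) by force
  define L where "L n = wass p (\<sigma> n) (\<mu> (tn n))" for n
  have L: "filterlim L at_top sequentially"
    unfolding L_def by (rule coray_lengths[OF pr p ray \<nu>0 tn \<sigma>])
  have "\<forall>\<^sub>F n in sequentially. max s t \<le> L n \<and> 0 \<le> tn n"
    using L tn unfolding filterlim_at_top by (simp add: eventually_conj_iff)
  then obtain N where N: "\<And>n. n \<ge> N \<Longrightarrow> max s t \<le> L n" "\<And>n. n \<ge> N \<Longrightarrow> 0 \<le> tn n"
    unfolding eventually_sequentially by blast
  \<comment> \<open>Dropping the first N indices puts s, t and the target times in range for every n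
    rather than eventually.\<close>
  define G where "G n = g (n + N)" for n
  have GP: "G n u \<in> Pp p" and giso: "wass p (G n u) (G n v) = \<bar>u - v\<bar>"
    if "u \<in> {0..L (n + N)}" "v \<in> {0..L (n + N)}" for n u v
    using g[of "n + N"] that unfolding wgeods_def L_def G_def by auto
  have Gend: "G n (L (n + N)) = \<mu> (tn (n + N))" for n using g[of "n + N"] by (simp add: wgeods_def G_def L_def)
  have st: "s \<in> {0..L (n + N)}" "t \<in> {0..L (n + N)}" for n using N(1)[of "n + N"] s t by auto
  have limG: "(\<lambda>n. wass p (G n u) (\<nu> u)) \<longlonglongrightarrow> 0" if "u \<ge> 0" for u
    unfolding G_def using LIMSEQ_ignore_initial_segment[OF lim[OF that]] .
  have "(\<lambda>n. wass p (G n s) (G n t)) \<longlonglongrightarrow> wass p (\<nu> s) (\<nu> t)"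
    using GP[OF st(1) st(1)] GP[OF st(2) st(2)] \<nu>P s t limG by (intro wass_tendsto[OF pr p]) auto
  thus "wass p (\<nu> s) (\<nu> t) = \<bar>s - t\<bar>"
    unfolding giso[OF st] by (simp add: LIMSEQ_const_iff)
  have key: "(\<lambda>n. L (n + N) - tn (n + N)) \<longlonglongrightarrow> busemann p \<mu> (\<nu> u) + u"
    if u: "u = s \<or> u = t" for u
  proof -
    have u0: "u \<ge> 0" and uL: "u \<in> {0..L (n + N)}" for n using u s t st by auto
    have tnN: "filterlim (\<lambda>n. tn (n + N)) at_top sequentially"
      using filterlim_compose[OF tn filterlim_add_const_nat_at_top] .
    have "(\<lambda>n. (wass p (\<nu> u) (\<mu> (tn (n + N))) - tn (n + N)) + u) \<longlonglongrightarrow> busemann p \<mu> (\<nu> u) + u"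
      using filterlim_compose[OF busemann_limit[OF pr p ray \<nu>P[OF u0]] tnN] by (intro tendsto_intros)
    moreover have "(\<lambda>n. L (n + N) - tn (n + N) - ((wass p (\<nu> u) (\<mu> (tn (n + N))) - tn (n + N)) + u)) \<longlonglongrightarrow> 0"
    proof (rule Lim_transform_bound[OF _ limG[OF u0]], intro always_eventually allI)
      fix n
      have Lend: "L (n + N) \<in> {0..L (n + N)}" using uL[of n] by auto
      have "wass p (G n u) (\<mu> (tn (n + N))) = L (n + N) - u"
        using giso[OF uL Lend] uL[of n] unfolding Gend by auto
      moreover have "\<mu> (tn (n + N)) \<in> Pp p" using \<mu>(1) N(2) by auto
      ultimately have "\<bar>L (n + N) - u - wass p (\<nu> u) (\<mu> (tn (n + N)))\<bar> \<le> wass p (G n u) (\<nu> u)"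
        using wass_triangle[OF pr p GP[OF uL uL] \<nu>P[OF u0], of "\<mu> (tn (n + N))" n]
          wass_triangle[OF pr p \<nu>P[OF u0] GP[OF uL uL], of "\<mu> (tn (n + N))" n]
          wass_commute[of p "\<nu> u" "G n u"] by linarith
      thus "norm (L (n + N) - tn (n + N) - ((wass p (\<nu> u) (\<mu> (tn (n + N))) - tn (n + N)) + u))
          \<le> norm (wass p (G n u) (\<nu> u))" using wass_nonneg[of p "G n u" "\<nu> u"] by simp
    qed
    ultimately show ?thesis using tendsto_add by fastforce
  qed
  show "busemann p \<mu> (\<nu> s) + s = busemann p \<mu> (\<nu> t) + t"
    using LIMSEQ_unique[OF key[of s] key[of t]] by simp
qed

text \<open>Glue the three optimal couplings over their common middle measure: almost surely both
  end points extend one and the same segment by the same amount.\<close>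

lemma wass_non_branching_endpoint:
  fixes \<mu>0 \<sigma> \<rho> \<rho>' :: "'a::{complete_space,second_countable_topology} measure"
  assumes geo: "geodesic_space TYPE('a)" and pr: "proper_space TYPE('a)" and nb: "non_branching TYPE('a)"
    and p: "p > 1" and P: "\<mu>0 \<in> Pp p" "\<sigma> \<in> Pp p" "\<rho> \<in> Pp p" "\<rho>' \<in> Pp p"
    and \<tau>: "wass p \<mu>0 \<sigma> = \<tau>" "\<tau> > 0" and t: "wass p \<sigma> \<rho> = t" "wass p \<sigma> \<rho>' = t" "t > 0"
    and l: "\<tau> + t \<le> wass p \<mu>0 \<rho>" "\<tau> + t \<le> wass p \<mu>0 \<rho>'"
  shows "\<rho> = \<rho>'"
proof -
  have p0: "p > 0" using p by simp
  obtain a :: 'a where True by simp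
  obtain \<pi>1 where \<pi>1: "\<pi>1 \<in> couplings \<mu>0 \<sigma>" "cost p \<pi>1 = ennreal (wass p \<mu>0 \<sigma> powr p)"
    using optimal_coupling_exists[OF pr P(1,2) p0] by blast
  obtain \<pi>3 where \<pi>3: "\<pi>3 \<in> couplings \<sigma> \<rho>'" "cost p \<pi>3 = ennreal (wass p \<sigma> \<rho>' powr p)"
    using optimal_coupling_exists[OF pr P(2,4) p0] by blast
  obtain \<Omega> :: "real measure" and X Y Z where \<Omega>: "prob_space \<Omega>"
    and [measurable]: "X \<in> \<Omega> \<rightarrow>\<^sub>M borel" "Y \<in> \<Omega> \<rightarrow>\<^sub>M borel" "Z \<in> \<Omega> \<rightarrow>\<^sub>M borel"
    and law: "distr \<Omega> borel X = \<mu>0" "distr \<Omega> borel Y = \<sigma>" "distr \<Omega> borel Z = \<rho>"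
    and c1: "(\<integral>\<^sup>+w. ennreal (dist (X w) (Y w) powr p) \<partial>\<Omega>) = ennreal (\<tau> powr p)"
    and c2: "(\<integral>\<^sup>+w. ennreal (dist (Y w) (Z w) powr p) \<partial>\<Omega>) = ennreal (t powr p)"
    using optimal_gluing[OF pr p0 P(1,2,3) \<pi>1] unfolding \<tau> t by blast
  \<comment> \<open>Pairing the outer coordinates leaves the middle one second, the position at
    which \<open>gluing\<close> attaches \<open>\<pi>3\<close>.\<close>
  define \<Lambda> where "\<Lambda> = distr \<Omega> borel (\<lambda>w. ((X w, Z w), Y w))"
  have \<Lambda>: "prob_space \<Lambda>" "sets \<Lambda> = sets borel" unfolding \<Lambda>_def by (auto intro!: prob_space.prob_space_distr[OF \<Omega>])
  have m\<Lambda>: "distr \<Lambda> borel snd = \<sigma>" "distr \<Lambda> borel fst = distr \<Omega> borel (\<lambda>w. (X w, Z w))"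
    unfolding \<Lambda>_def law(2)[symmetric] by (subst distr_distr; simp add: comp_def)+
  have XZ: "distr \<Omega> borel (\<lambda>w. (X w, Z w)) \<in> couplings \<mu>0 \<rho>"
    using couplings_pair[OF \<Omega>, of X Z] by (simp add: law)
  have mom: "(\<integral>\<^sup>+z. ennreal (dist ((a, a), a) z powr p) \<partial>\<Lambda>) < \<infinity>"
  proof (rule le_less_trans[OF prod_moment[OF \<Lambda>(2) p0, of "(a, a)" a]])
    have "(\<integral>\<^sup>+z. ennreal (dist (a, a) z powr p) \<partial>distr \<Omega> borel (\<lambda>w. (X w, Z w))) < \<infinity>"
      using coupling_moment[OF P(1,3) p0, of a] XZ by (auto intro: le_less_trans)
    thus "ennreal (2 powr p) * ((\<integral>\<^sup>+ x. ennreal (dist (a, a) x powr p) \<partial>distr \<Lambda> borel fst) +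
        (\<integral>\<^sup>+ x. ennreal (dist a x powr p) \<partial>distr \<Lambda> borel snd)) < \<infinity>"
      using Pp_moment[OF P(2) p0, of a] by (simp add: m\<Lambda> ennreal_mult_less_top)
  qed
  have mom3: "(\<integral>\<^sup>+z. ennreal (dist (a, a) z powr p) \<partial>\<pi>3) < \<infinity>"
    using coupling_moment[OF P(2,4) p0, of a] \<pi>3(1) by (auto intro: le_less_trans)
  have "\<exists>(\<Omega>::real measure) U Y Z. prob_space \<Omega> \<and> U \<in> \<Omega> \<rightarrow>\<^sub>M borel \<and> Y \<in> \<Omega> \<rightarrow>\<^sub>M borel \<and> Z \<in> \<Omega> \<rightarrow>\<^sub>M borel \<and>
    distr \<Omega> borel (\<lambda>w. (U w, Y w)) = \<Lambda> \<and> distr \<Omega> borel (\<lambda>w. (Y w, Z w)) = \<pi>3"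
    by (rule gluing[OF proper_space_prod[OF pr pr] pr pr \<Lambda> _ _ _ p0 mom mom3])
      (use \<pi>3(1) m\<Lambda> in \<open>auto simp: couplings_def\<close>)
  then obtain \<Omega>' :: "real measure" and U Y' Z' where \<Omega>': "prob_space \<Omega>'"
    and [measurable]: "U \<in> \<Omega>' \<rightarrow>\<^sub>M borel" "Y' \<in> \<Omega>' \<rightarrow>\<^sub>M borel" "Z' \<in> \<Omega>' \<rightarrow>\<^sub>M borel"
    and d1: "distr \<Omega>' borel (\<lambda>w. (U w, Y' w)) = \<Lambda>" and d2: "distr \<Omega>' borel (\<lambda>w. (Y' w, Z' w)) = \<pi>3"
    by blast
  have transfer: "(\<integral>\<^sup>+w. F (U w, Y' w) \<partial>\<Omega>') = (\<integral>\<^sup>+w. F ((X w, Z w), Y w) \<partial>\<Omega>)"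
    if [measurable]: "F \<in> borel_measurable borel" for F
  proof -
    have "(\<integral>\<^sup>+w. F (U w, Y' w) \<partial>\<Omega>') = (\<integral>\<^sup>+z. F z \<partial>\<Lambda>)" unfolding d1[symmetric] by (subst nn_integral_distr) auto
    also have "\<dots> = (\<integral>\<^sup>+w. F ((X w, Z w), Y w) \<partial>\<Omega>)" unfolding \<Lambda>_def by (subst nn_integral_distr) auto
    finally show ?thesis .
  qed
  have law_transfer: "distr \<Omega>' borel (\<lambda>w. F (U w, Y' w)) = distr \<Omega> borel (\<lambda>w. F ((X w, Z w), Y w))"
    if [measurable]: "F \<in> borel \<rightarrow>\<^sub>M borel" for F :: "('a \<times> 'a) \<times> 'a \<Rightarrow> 'a"
  proof -
    have "distr \<Omega>' borel (\<lambda>w. F (U w, Y' w)) = distr \<Lambda> borel F"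
      unfolding d1[symmetric] by (subst distr_distr) (auto simp: comp_def)
    also have "\<dots> = distr \<Omega> borel (\<lambda>w. F ((X w, Z w), Y w))"
      unfolding \<Lambda>_def by (subst distr_distr) (auto simp: comp_def)
    finally show ?thesis .
  qed
  define X1 where "X1 w = fst (U w)" for w
  define Z1 where "Z1 w = snd (U w)" for w
  have [measurable]: "X1 \<in> \<Omega>' \<rightarrow>\<^sub>M borel" "Z1 \<in> \<Omega>' \<rightarrow>\<^sub>M borel" unfolding X1_def Z1_def by measurable
  have bm: "(\<lambda>z::('a \<times> 'a) \<times> 'a. fst (fst z)) \<in> borel \<rightarrow>\<^sub>M borel" "(\<lambda>z::('a \<times> 'a) \<times> 'a. snd (fst z)) \<in> borel \<rightarrow>\<^sub>M borel"
    by (intro borel_measurable_continuous_onI continuous_intros)+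
  have law': "distr \<Omega>' borel X1 = \<mu>0" "distr \<Omega>' borel Z1 = \<rho>" "distr \<Omega>' borel Z' = \<rho>'"
  proof -
    show "distr \<Omega>' borel X1 = \<mu>0" using law_transfer[OF bm(1)] by (simp add: X1_def[abs_def] law)
    show "distr \<Omega>' borel Z1 = \<rho>" using law_transfer[OF bm(2)] by (simp add: Z1_def[abs_def] law)
    show "distr \<Omega>' borel Z' = \<rho>'" by (rule law_of_coupling(2)[of Y']) (use d2 \<pi>3 in auto)
  qed
  have bd: "(\<lambda>z. ennreal (dist (A z) (B z) powr p)) \<in> borel_measurable borel"
    if [measurable]: "A \<in> borel \<rightarrow>\<^sub>M borel" "B \<in> borel \<rightarrow>\<^sub>M borel" for A B :: "('a \<times> 'a) \<times> 'a \<Rightarrow> 'a"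
    by measurable
  have c1': "(\<integral>\<^sup>+w. ennreal (dist (X1 w) (Y' w) powr p) \<partial>\<Omega>') = ennreal (\<tau> powr p)"
    using transfer[OF bd[OF bm(1) borel_measurable_snd_prod]] c1 by (simp add: X1_def)
  have c2': "(\<integral>\<^sup>+w. ennreal (dist (Y' w) (Z1 w) powr p) \<partial>\<Omega>') = ennreal (t powr p)"
    using transfer[OF bd[OF borel_measurable_snd_prod bm(2)]] c2 by (simp add: Z1_def)
  have c3': "(\<integral>\<^sup>+w. ennreal (dist (Y' w) (Z' w) powr p) \<partial>\<Omega>') = ennreal (t powr p)"
    using cost_pair[of Y' \<Omega>' Z' p] \<pi>3(2) by (simp add: d2 t)
  have A1: "AE w in \<Omega>'. dist (X1 w) (Z1 w) = dist (X1 w) (Y' w) + dist (Y' w) (Z1 w) \<and>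
      t * dist (X1 w) (Y' w) = \<tau> * dist (Y' w) (Z1 w)"
    by (rule wass_collinear[OF \<Omega>' _ _ _ _ _ p \<tau>(2) c1' t(3) c2']) (simp_all add: law' P l)
  have A2: "AE w in \<Omega>'. dist (X1 w) (Z' w) = dist (X1 w) (Y' w) + dist (Y' w) (Z' w) \<and>
      t * dist (X1 w) (Y' w) = \<tau> * dist (Y' w) (Z' w)"
    by (rule wass_collinear[OF \<Omega>' _ _ _ _ _ p \<tau>(2) c1' t(3) c3']) (simp_all add: law' P l)
  have "AE w in \<Omega>'. Z1 w = Z' w"
    using A1 A2
  proof eventually_elim
    case (elim w)
    have "\<tau> * dist (Y' w) (Z1 w) = \<tau> * dist (Y' w) (Z' w)" using elim by linarith
    hence eq: "dist (Y' w) (Z1 w) = dist (Y' w) (Z' w)" using \<tau> by simp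
    show ?case
    \<comment> \<open>Where the incoming segment is trivial, proportionality makes both outgoing
      ones trivial too.\<close>
    proof (cases "X1 w = Y' w")
      case True
      thus ?thesis using elim \<tau> by simp
    next
      case False
      thus ?thesis using non_branching_endpoint[OF geo nb False eq] elim by simp
    qed
  qed
  hence "distr \<Omega>' borel Z1 = distr \<Omega>' borel Z'" by (intro distr_cong_AE) auto
  thus ?thesis by (simp add: law')
qed

text \<open>Cutting the approximating geodesics at tau leaves geodesics to the same targets;
  finitely many that may be too short are discarded. The definition's freedom of moving start points
  is used: \<open>g n \<tau>\<close> only converges to \<open>\<nu> \<tau>\<close>.\<close>

lemma coray_subray:
  fixes \<mu> :: "real \<Rightarrow> 'a::{complete_space,second_countable_topology} measure"
  assumes pr: "proper_space TYPE('a)" and p: "p > 1" and ray: "unit_wray p \<mu>" and co: "coray p \<mu> \<nu>0 \<nu>"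
    and \<tau>: "\<tau> \<ge> 0"
  shows "coray p \<mu> (\<nu> \<tau>) (\<lambda>t. \<nu> (t + \<tau>))"
proof -
  obtain tn \<sigma> g where \<nu>: "wray p \<nu>" "\<nu> 0 = \<nu>0" and tn: "filterlim tn at_top sequentially"
    and \<sigma>: "\<And>n. \<sigma> n \<in> Pp p" "(\<lambda>n. wass p (\<sigma> n) \<nu>0) \<longlonglongrightarrow> 0"
    and g: "\<And>n. g n \<in> wgeods p (\<sigma> n) (\<mu> (tn n))"
    and lim: "\<And>t. t \<ge> 0 \<Longrightarrow> (\<lambda>n. wass p (g n t) (\<nu> t)) \<longlonglongrightarrow> 0"
    using co unfolding coray_def by blast
  have \<nu>P: "\<nu> t \<in> Pp p" if "t \<ge> 0" for t using \<nu>(1) that by (auto simp: wray_def)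
  hence \<nu>0: "\<nu>0 \<in> Pp p" using \<nu>(2) by force
  define L where "L n = wass p (\<sigma> n) (\<mu> (tn n))" for n
  have "filterlim L at_top sequentially"
    unfolding L_def by (rule coray_lengths[OF pr p ray \<nu>0 tn \<sigma>])
  then obtain N where N: "\<And>n. n \<ge> N \<Longrightarrow> \<tau> \<le> L n"
    unfolding filterlim_at_top eventually_sequentially by blast
  have geod: "(\<lambda>t. g (n + N) (t + \<tau>)) \<in> wgeods p (g (n + N) \<tau>) (\<mu> (tn (n + N)))"
    and gP: "g (n + N) \<tau> \<in> Pp p" for n
  proof -
    define m where "m = n + N"
    have Lm: "\<tau> \<le> L m" using N by (simp add: m_def)
    have P: "\<And>u. u \<in> {0..L m} \<Longrightarrow> g m u \<in> Pp p" and e: "g m (L m) = \<mu> (tn m)"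
      and iso: "\<And>u v. u \<in> {0..L m} \<Longrightarrow> v \<in> {0..L m} \<Longrightarrow> wass p (g m u) (g m v) = \<bar>u - v\<bar>"
      using g[of m] unfolding wgeods_def L_def by auto
    \<comment> \<open>\<open>wgeods\<close> reads the length off the end points, so the cut curve
      must be seen to have length \<open>L m - \<tau>\<close>.\<close>
    have w: "wass p (g m \<tau>) (\<mu> (tn m)) = L m - \<tau>" using iso[of \<tau> "L m"] e Lm \<tau> by simp
    show "(\<lambda>t. g (n + N) (t + \<tau>)) \<in> wgeods p (g (n + N) \<tau>) (\<mu> (tn (n + N)))"
      unfolding m_def[symmetric] wgeods_def w using P e iso \<tau> Lm by auto
    show "g (n + N) \<tau> \<in> Pp p" unfolding m_def[symmetric] using P \<tau> Lm by auto
  qed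
  have "wray p (\<lambda>t. \<nu> (t + \<tau>))"
    by (rule wray_of_isometric) (use \<nu>P \<tau> coray_isometric_and_busemann(1)[OF pr p ray co] in auto)
  moreover have "filterlim (\<lambda>n. tn (n + N)) at_top sequentially"
    using filterlim_compose[OF tn filterlim_add_const_nat_at_top] .
  moreover have "(\<lambda>n. wass p (g (n + N) (t + \<tau>)) (\<nu> (t + \<tau>))) \<longlonglongrightarrow> 0" if "t \<ge> 0" for t
    by (rule LIMSEQ_ignore_initial_segment[OF lim]) (use that \<tau> in simp)
  moreover have "(\<lambda>n. wass p (g (n + N) \<tau>) (\<nu> \<tau>)) \<longlonglongrightarrow> 0"
    by (rule LIMSEQ_ignore_initial_segment[OF lim[OF \<tau>]])
  ultimately show ?thesis unfolding coray_def
    using geod gP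
    by (intro conjI exI[of _ "\<lambda>n. tn (n + N)"] exI[of _ "\<lambda>n. g (n + N) \<tau>"] exI[of _ "\<lambda>n t. g (n + N) (t + \<tau>)"]) auto
qed

lemma coray_unique:
  fixes \<mu> :: "real \<Rightarrow> 'a::{complete_space,second_countable_topology} measure"
  assumes geo: "geodesic_space TYPE('a)" and pr: "proper_space TYPE('a)" and nb: "non_branching TYPE('a)"
    and p: "p > 1" and ray: "unit_wray p \<mu>" and co: "coray p \<mu> \<nu>0 \<nu>" and \<tau>: "\<tau> > 0"
    and co': "coray p \<mu> (\<nu> \<tau>) \<gamma>" and t: "t \<ge> 0"
  shows "\<gamma> t = \<nu> (t + \<tau>)"
proof (cases "t = 0")
  case True
  thus ?thesis using co' by (simp add: coray_def)
next
  case False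
  hence t0: "t > 0" using t by simp
  have \<nu>P: "\<nu> t \<in> Pp p" if "t \<ge> 0" for t using co that by (auto simp: wray_def coray_def)
  have \<gamma>P: "\<gamma> t \<in> Pp p" if "t \<ge> 0" for t using co' that by (auto simp: wray_def coray_def)
  have \<gamma>0: "\<gamma> 0 = \<nu> \<tau>" using co' by (simp add: coray_def)
  note \<nu> = coray_isometric_and_busemann[OF pr p ray co]
  note \<gamma> = coray_isometric_and_busemann[OF pr p ray co']
  \<comment> \<open>The drop is tau along \<open>\<nu>\<close> and a further t along
    \<open>\<gamma>\<close>; the Lipschitz bound turns it into a lower bound on the distance from
    \<open>\<nu> 0\<close>.\<close>
  have "busemann p \<mu> (\<nu> 0) = busemann p \<mu> (\<gamma> t) + (\<tau> + t)"
    using \<nu>(2)[of 0 \<tau>] \<gamma>(2)[of 0 t] \<gamma>0 \<tau> t by simp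
  hence "\<tau> + t \<le> wass p (\<nu> 0) (\<gamma> t)"
    using busemann_lipschitz[OF pr p ray \<nu>P[of 0] \<gamma>P[OF t]] by simp
  moreover have "wass p (\<nu> 0) (\<nu> (t + \<tau>)) = \<tau> + t" using \<nu>(1)[of 0 "t + \<tau>"] \<tau> t by simp
  moreover have "wass p (\<nu> 0) (\<nu> \<tau>) = \<tau>" using \<nu>(1)[of 0 \<tau>] \<tau> by simp
  moreover have "wass p (\<nu> \<tau>) (\<gamma> t) = t" using \<gamma>(1)[of 0 t] \<gamma>0 t by simp
  moreover have "wass p (\<nu> \<tau>) (\<nu> (t + \<tau>)) = t" using \<nu>(1)[of \<tau> "t + \<tau>"] \<tau> t by simp
  ultimately show ?thesis
    using \<nu>P[of 0] \<nu>P[of \<tau>] \<nu>P[of "t + \<tau>"] \<gamma>P[OF t] \<tau> t0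
    by (intro wass_non_branching_endpoint[OF geo pr nb p, of "\<nu> 0" "\<nu> \<tau>"]) auto
qed

text \<open>Rays are functions on all reals constrained only at nonnegative times, so uniqueness
  means agreement there.\<close>

theorem theorem1p2:
  fixes p :: real and \<mu> :: "real \<Rightarrow> 'a::{metric_space, polish_space} measure"
  assumes "length_space TYPE('a)"
    and "\<not> compact (UNIV :: 'a set)"
    and "locally_compact_space (euclidean :: 'a topology)"
    and "p > 1"
    and "unit_wray p \<mu>"
  shows "(\<forall>\<nu>0 \<in> Pp p. \<exists>\<nu>. coray p \<mu> \<nu>0 \<nu>)
       \<and> (non_branching TYPE('a) \<longrightarrow>
          (\<forall>\<nu>0 \<nu>. coray p \<mu> \<nu>0 \<nu> \<longrightarrow>
             (\<forall>\<tau>>0. coray p \<mu> (\<nu> \<tau>) (\<lambda>t. \<nu> (t + \<tau>)) \<and>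
                (\<forall>\<gamma>. coray p \<mu> (\<nu> \<tau>) \<gamma> \<longrightarrow> (\<forall>t\<ge>0. \<gamma> t = \<nu> (t + \<tau>))))))"
proof -
  have pr: "proper_space TYPE('a)" by (rule hopf_rinow_proper[OF assms(1,3)])
  have geo: "geodesic_space TYPE('a)" by (rule length_proper_imp_geodesic_space[OF assms(1) pr])
  show ?thesis
    using coray_exists[OF geo pr assms(4,5)] coray_subray[OF pr assms(4,5)]
      coray_unique[OF geo pr _ assms(4,5)] by (meson less_imp_le)
qed

end
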